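(* Let $K:\mathbb{R}^2\to[0,\infty)$ satisfy: $K\in L^1(\mathbb{R}^2)\cap L^2(\mathbb{R}^2)$, $\int K\,d\lambda^2=1$, $\operatorname{supp}(\mathcal{F}K)\subseteq[-1,1]^2$, and $\mathcal{F}K$ is Lipschitz continuous. Let $X=(X_t)_{t\ge0}$ be a two-dimensional compound Poisson process with drift $\alpha\in\mathbb{R}^2$ and Lévy measure $\nu$. For $x,y\in[0,\infty)$ put $U(x,y)=\nu([x,\infty)\times[y,\infty))$, $U_1(x)=U(x,0)$, $U_2(y)=U(0,y)$ and assume (i) $0<\Lambda:=\nu(\mathbb{R}^2)=\nu([0,\infty)^2)<\infty$; (ii) there is $\gamma>0$ with $\int|x|^{8+\gamma}\,\nu(dx)<\infty$; (iii) there is $c>0$ with $|\mathcal{F}((x_1^4+x_2^4)\nu)(u)|\le c\,(1+|u_1|)^{-1}(1+|u_2|)^{-1}$ for all $u\in\mathbb{R}^2$; (iv) for $k=1,2$, $U_k:(0,\infty)\to(0,\Lambda)$ is a $\mathcal{C}^1$-bijection with $U_k'<0$, $\inf_{0<x\le1}|U_k'(x)|>0$ and $\sup_{x>0}(1\wedge x)|U_k'(x)|<\infty$. Let $C$ be the copula of the probability measure $\Lambda^{-1}\nu$ and let $\widehat C_n$ be the estimator of $C$ defined in the context, based on $X_1,\dots,X_n$, with $h_n=n^{-1/2}$ and $\delta_n=(\log n)^{-1}$. Then for arbitrary fixed $0<a<b<1$, $$\sup_{a\le u,v\le b}|C(u,v)-\widehat C_n(u,v)|=O_{P_{\nu,\alpha}}\Big(\frac{(\log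 n)^{10}}{\sqrt n}\Big),\qquad n\to\infty .$$
   Context: Notation: $\mathfrak{R}=[0,\infty)^2\setminus\{(0,0)\}$; $\lambda^2$ is Lebesgue measure on $\mathbb{R}^2$; $(\mathcal{F}f)(u)=\int e^{i\langle u,x\rangle}f(x)\,\lambda^2(dx)$ and $(\mathcal{F}\mu)(u)=\int e^{i\langle u,x\rangle}\mu(dx)$; $(\mathcal{F}^{-1}f)(x)=(2\pi)^{-2}\int e^{-i\langle u,x\rangle}f(u)\,\lambda^2(du)$. $(x_1^4+x_2^4)\nu$ is the measure with $\nu$-density $x_1^4+x_2^4$. $K_h(x)=h^{-2}K(h^{-1}x)$. $\Re_+(z)=\max(\Re z,0)$ for $z\in\mathbb{C}$. $Y_n=O_P(r_n)$ means: for every $\delta>0$ there is $M>0$ with $P(|Y_n/r_n|\ge M)\le\delta$ for all $n$ (for which the quantities are defined, here $n\ge2$). Inversion operation: for a continuous $g:(0,\infty)\to[0,\infty)$ with $\lim_{x\to\infty}g(x)=0$ and $\delta>0$, $\mathcal{I}(g,\delta)(z)=\inf\{x\ge\delta:\ \inf_{\delta\le y\le x}g(y)\le z\}$, $z>0$. Under $P_{\nu,\alpha}$ the variable $X_1$ has characteristic function $\varphi(u)=\exp\big(i\langle u,\alpha\rangle+\int_{\mathbb{R}^2}(e^{i\langle u,x\rangle}-1)\,\nu(dx)\big)$. Estimator $\widehat N_n$. With $X_0=0$, put $\widehat\varphi_n(u)=\frac1n\sum_{t=1}^n e^{i\langle u,X_t-X_{t-1}\rangle}$, $u\in\mathbb{R}^2$.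 For $k=1,2$, writing $\partial_k=\partial/\partial u_k$, define (wherever $\widehat\varphi_n\ne0$) the function denoted $\frac{\partial^4\widehat\Psi_n}{\partial u_k^4}$ by $$\frac{\partial^4\widehat\Psi_n}{\partial u_k^4}=\frac{\partial_k^4\widehat\varphi_n}{\widehat\varphi_n}-4\frac{\partial_k\widehat\varphi_n\,\partial_k^3\widehat\varphi_n}{\widehat\varphi_n^2}-3\Big(\frac{\partial_k^2\widehat\varphi_n}{\widehat\varphi_n}\Big)^2+12\frac{(\partial_k\widehat\varphi_n)^2\,\partial_k^2\widehat\varphi_n}{\widehat\varphi_n^3}-6\Big(\frac{\partial_k\widehat\varphi_n}{\widehat\varphi_n}\Big)^4 .$$ Let $h=h_n=n^{-1/2}$, $A_{h,n}=\{|\widehat\varphi_n(u)|>\frac12|\varphi(u)|\text{ for all }u\in[-\frac1h,\frac1h]^2\}$ and $g_{a,b}(x)=\frac{1}{x_1^4+x_2^4}\mathbf{1}_{[a,\infty)\times[b,\infty)}(x_1,x_2)$. For $(a,b)\in\mathfrak{R}$, $$\widehat N_n(a,b)=\int_{\mathbb{R}^2}g_{a,b}(x)\,\mathcal{F}^{-1}\Big(\Big(\frac{\partial^4\widehat\Psi_n}{\partial u_1^4}+\frac{\partial^4\widehat\Psi_n}{\partial u_2^4}\Big)\mathcal{F}K_h\Big)(x)\,\lambda^2(dx)\ \text{ on }A_{h,n},\qquad \widehat N_n(a,b)=0\ \text{ on }A_{h,n}^c ,$$ where the product with $\mathcal{F}K_h$ is understood as $0$ outside $[-\frac1h,\frac1h]^2$.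 Copula and its estimator (the intensity $\Lambda$ is assumed known). Put $V_1(x)=\Lambda^{-1}\nu([0,x]\times[0,\infty))$, $V_2(x)=\Lambda^{-1}\nu([0,\infty)\times[0,x])$ for $x>0$; these are bijections $(0,\infty)\to(0,1)$. For $(a,b)\in\mathfrak{R}$ let $M(a,b)=\Lambda^{-1}\nu([0,a]\times[0,b])=1+\Lambda^{-1}(U(a,b)-U(a,0)-U(0,b))$. The copula of $\Lambda^{-1}\nu$ is $C(u,v)=M(V_1^{-1}(u),V_2^{-1}(v))$, $0<u,v<1$. Put $$\widehat U_{1,n}^{-1}=\mathcal{I}(\Re_+\widehat N_n(\cdot,0),\delta_n),\quad \widehat U_{2,n}^{-1}=\mathcal{I}(\Re_+\widehat N_n(0,\cdot),\delta_n),\quad \widehat V_{k,n}^{-1}(u)=\widehat U_{k,n}^{-1}(\Lambda(1-u)),\ 0<u<1,\ k=1,2,$$ $$\widehat M_n(a,b)=1+\Lambda^{-1}\big(\widehat N_n(a,b)-\widehat N_n(a,0)-\widehat N_n(0,b)\big),\qquad \widehat C_n(u,v)=\widehat M_n\big(\widehat V_{1,n}^{-1}(u),\widehat V_{2,n}^{-1}(v)\big),\ 0<u,v<1 .$$ *)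

theory Defs
  imports "HOL-Probability.Probability"
begin

type_synonym plane = "real \<times> real"

section \<open>Fourier transforms and partial derivatives on the plane\<close>

definition fourier :: "(plane \<Rightarrow> complex) \<Rightarrow> plane \<Rightarrow> complex" where
  "fourier f u = (LINT x|lebesgue. iexp (u \<bullet> x) * f x)"

definition fourier_measure :: "plane measure \<Rightarrow> plane \<Rightarrow> complex" where
  "fourier_measure \<mu> u = (LINT x|\<mu>. iexp (u \<bullet> x))"

definition inv_fourier :: "(plane \<Rightarrow> complex) \<Rightarrow> plane \<Rightarrow> complex" where
  "inv_fourier f x = 1 / (2 * pi)\<^sup>2 * (LINT u|lebesgue. iexp (- (u \<bullet> x)) * f u)"

definition scaled_kernel :: "(plane \<Rightarrow> real) \<Rightarrow> real \<Rightarrow> plane \<Rightarrow> real" where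
  "scaled_kernel K h x = K ((1 / h) *\<^sub>R x) / h\<^sup>2"

text \<open>Partial derivative in the direction of the basis vector \<open>e\<close>, for complex-valued functions
  of a real argument. The iterates are \<open>(partial e ^^ j) f\<close>.\<close>
definition partial :: "plane \<Rightarrow> (plane \<Rightarrow> complex) \<Rightarrow> plane \<Rightarrow> complex" where
  "partial e f u = vector_derivative (\<lambda>s. f (u + s *\<^sub>R e)) (at 0)"

section \<open>Compound Poisson processes with drift\<close>

text \<open>Processes are indexed by \<open>real\<close>; only the indices \<open>t \<ge> 0\<close> are used. Stochastic continuity
  follows from stationarity of the increments and right continuity.\<close>
definition levy_process :: "'w measure \<Rightarrow> (real \<Rightarrow> 'w \<Rightarrow> plane) \<Rightarrow> bool" where
  "levy_process P X \<longleftrightarrow>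
     prob_space P \<and>
     (\<forall>t\<ge>0. X t \<in> borel_measurable P) \<and>
     (AE \<omega> in P. X 0 \<omega> = 0) \<and>
     (\<forall>(s :: nat \<Rightarrow> real) m. 0 \<le> s 0 \<and> (\<forall>i<m. s i \<le> s (Suc i)) \<longrightarrow>
        prob_space.indep_vars P (\<lambda>_. borel) (\<lambda>i \<omega>. X (s (Suc i)) \<omega> - X (s i) \<omega>) {..<m}) \<and>
     (\<forall>s\<ge>0. \<forall>t\<ge>0. distr P borel (\<lambda>\<omega>. X (s + t) \<omega> - X s \<omega>) = distr P borel (X t)) \<and>
     (AE \<omega> in P. \<forall>t\<ge>0. ((\<lambda>s. X s \<omega>) \<longlongrightarrow> X t \<omega>) (at_right t) \<and>
        (t > 0 \<longrightarrow> (\<exists>l. ((\<lambda>s. X s \<omega>) \<longlongrightarrow> l) (at_left t))))"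

definition cpp_cf :: "plane \<Rightarrow> plane measure \<Rightarrow> real \<Rightarrow> plane \<Rightarrow> complex" where
  "cpp_cf \<alpha> \<nu> t u =
     exp (complex_of_real t * (\<i> * complex_of_real (u \<bullet> \<alpha>) + (LINT x|\<nu>. (iexp (u \<bullet> x) - 1))))"

text \<open>The usual textbook definition: a Levy process whose marginals are (shifted) compound Poisson
  distributions, the latter being given by their characteristic function. The jump intensity is
  the total mass of \<open>\<nu>\<close> and the jump law is the normalised \<open>\<nu>\<close>.\<close>
definition compound_poisson_with_drift ::
  "'w measure \<Rightarrow> (real \<Rightarrow> 'w \<Rightarrow> plane) \<Rightarrow> plane \<Rightarrow> plane measure \<Rightarrow> bool" where
  "compound_poisson_with_drift P X \<alpha> \<nu> \<longleftrightarrow>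
     levy_process P X \<and>
     sets \<nu> = sets borel \<and> finite_measure \<nu> \<and> emeasure \<nu> {0} = 0 \<and>
     (\<forall>t\<ge>0. \<forall>u. fourier_measure (distr P borel (X t)) u = cpp_cf \<alpha> \<nu> t u)"

section \<open>Tail integral and copula of the jump law\<close>

definition tail :: "plane measure \<Rightarrow> real \<Rightarrow> real \<Rightarrow> real" where
  "tail \<nu> x y = measure \<nu> ({x..} \<times> {y..})"

definition marginal1 :: "plane measure \<Rightarrow> real \<Rightarrow> real" where
  "marginal1 \<nu> x = measure \<nu> ({0..x} \<times> {0..}) / measure \<nu> UNIV"

definition marginal2 :: "plane measure \<Rightarrow> real \<Rightarrow> real" where
  "marginal2 \<nu> x = measure \<nu> ({0..} \<times> {0..x}) / measure \<nu> UNIV"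

definition joint_df :: "plane measure \<Rightarrow> real \<Rightarrow> real \<Rightarrow> real" where
  "joint_df \<nu> a b = measure \<nu> ({0..a} \<times> {0..b}) / measure \<nu> UNIV"

definition jump_copula :: "plane measure \<Rightarrow> real \<Rightarrow> real \<Rightarrow> real" where
  "jump_copula \<nu> u v =
     joint_df \<nu> (the_inv_into {0<..} (marginal1 \<nu>) u) (the_inv_into {0<..} (marginal2 \<nu>) v)"

section \<open>The estimators\<close>

text \<open>The observations are a sequence \<open>x\<close> with \<open>x t\<close> in the role of \<open>X\<^sub>t\<close>, starting at \<open>t = 0\<close>.\<close>
definition emp_cf :: "(nat \<Rightarrow> plane) \<Rightarrow> nat \<Rightarrow> plane \<Rightarrow> complex" where
  "emp_cf x n u = (\<Sum>t = 1..n. iexp (u \<bullet> (x t - x (t - 1)))) / of_nat n"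

text \<open>The fourth derivative in direction \<open>e\<close> of the logarithm of \<open>f\<close>, written out.\<close>
definition log_deriv4 :: "plane \<Rightarrow> (plane \<Rightarrow> complex) \<Rightarrow> plane \<Rightarrow> complex" where
  "log_deriv4 e f u =
     (let d = (\<lambda>j. (partial e ^^ j) f u) in
        d 4 / f u
        - 4 * (d 1 * d 3 / (f u)\<^sup>2)
        - 3 * (d 2 / f u)\<^sup>2
        + 12 * ((d 1)\<^sup>2 * d 2 / (f u) ^ 3)
        - 6 * (d 1 / f u) ^ 4)"

definition freq_box :: "real \<Rightarrow> plane set" where
  "freq_box h = {- (1 / h)..1 / h} \<times> {- (1 / h)..1 / h}"

definition weight :: "real \<Rightarrow> real \<Rightarrow> plane \<Rightarrow> real" where
  "weight a b x = indicator ({a..} \<times> {b..}) x / (fst x ^ 4 + snd x ^ 4)"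

text \<open>Here \<open>\<phi>\<close> is the true characteristic function, which enters only through the event
  \<open>A\<^sub>h\<^sub>,\<^sub>n\<close>.\<close>
definition N_hat ::
  "(plane \<Rightarrow> complex) \<Rightarrow> (plane \<Rightarrow> real) \<Rightarrow> real \<Rightarrow> (nat \<Rightarrow> plane) \<Rightarrow> nat \<Rightarrow> real \<Rightarrow> real \<Rightarrow> complex" where
  "N_hat \<phi> K h x n a b =
     (if \<forall>u\<in>freq_box h. cmod (emp_cf x n u) > 1 / 2 * cmod (\<phi> u)
      then (LINT y|lebesgue. complex_of_real (weight a b y) *
              inv_fourier (\<lambda>u. if u \<in> freq_box h
                 then (log_deriv4 (1, 0) (emp_cf x n) u + log_deriv4 (0, 1) (emp_cf x n) u) *
                      fourier (\<lambda>z. complex_of_real (scaled_kernel K h z)) u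
                 else 0) y)
      else 0)"

text \<open>The inversion operation. For continuous \<open>g \<ge> 0\<close> vanishing at infinity and \<open>z > 0\<close> both
  infima are over nonempty sets that are bounded below.\<close>
definition inversion :: "(real \<Rightarrow> real) \<Rightarrow> real \<Rightarrow> real \<Rightarrow> real" where
  "inversion g \<delta> z = Inf {x. \<delta> \<le> x \<and> (INF y\<in>{\<delta>..x}. g y) \<le> z}"

text \<open>In the following, \<open>N\<close> is the estimated tail integral and \<open>\<Lambda>\<close> the (known) intensity.\<close>

definition V1_hat_inv :: "(real \<Rightarrow> real \<Rightarrow> complex) \<Rightarrow> real \<Rightarrow> real \<Rightarrow> real \<Rightarrow> real" where
  "V1_hat_inv N \<Lambda> \<delta> u = inversion (\<lambda>x. max (Re (N x 0)) 0) \<delta> (\<Lambda> * (1 - u))"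

definition V2_hat_inv :: "(real \<Rightarrow> real \<Rightarrow> complex) \<Rightarrow> real \<Rightarrow> real \<Rightarrow> real \<Rightarrow> real" where
  "V2_hat_inv N \<Lambda> \<delta> u = inversion (\<lambda>y. max (Re (N 0 y)) 0) \<delta> (\<Lambda> * (1 - u))"

definition M_hat :: "(real \<Rightarrow> real \<Rightarrow> complex) \<Rightarrow> real \<Rightarrow> real \<Rightarrow> real \<Rightarrow> complex" where
  "M_hat N \<Lambda> a b = 1 + (N a b - N a 0 - N 0 b) / complex_of_real \<Lambda>"

definition C_hat :: "(real \<Rightarrow> real \<Rightarrow> complex) \<Rightarrow> real \<Rightarrow> real \<Rightarrow> real \<Rightarrow> real \<Rightarrow> complex" where
  "C_hat N \<Lambda> \<delta> u v = M_hat N \<Lambda> (V1_hat_inv N \<Lambda> \<delta> u) (V2_hat_inv N \<Lambda> \<delta> v)"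

text \<open>The copula estimator for compound Poisson processes with the bandwidth \<open>h\<^sub>n = n\<^sup>-\<^sup>1\<^sup>/\<^sup>2\<close> and the
  cutoff \<open>\<delta>\<^sub>n = (log n)\<^sup>-\<^sup>1\<close>.\<close>
definition copula_estimator ::
  "plane \<Rightarrow> plane measure \<Rightarrow> (plane \<Rightarrow> real) \<Rightarrow> (nat \<Rightarrow> plane) \<Rightarrow> nat \<Rightarrow> real \<Rightarrow> real \<Rightarrow> complex" where
  "copula_estimator \<alpha> \<nu> K x n u v =
     C_hat (N_hat (cpp_cf \<alpha> \<nu> 1) K (1 / sqrt (real n)) x n) (measure \<nu> UNIV) (1 / ln (real n)) u v"

section \<open>Stochastic boundedness\<close>

text \<open>\<open>Y\<^sub>n = O\<^sub>P(r\<^sub>n)\<close> over the indices \<open>n \<ge> n0\<close>, for nonnegative \<open>Y\<^sub>n\<close> and positive \<open>r\<^sub>n\<close>. Suprema over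
  uncountable sets are not known to be measurable a priori, hence the outer measure; it agrees with
  the probability on every measurable event (while \<open>measure\<close> would be \<open>0\<close> on other sets).
  Values in \<open>ennreal\<close> make an unbounded supremum infinite instead of unspecified.\<close>
definition bigO_P :: "'w measure \<Rightarrow> nat \<Rightarrow> (nat \<Rightarrow> 'w \<Rightarrow> ennreal) \<Rightarrow> (nat \<Rightarrow> real) \<Rightarrow> bool" where
  "bigO_P P n0 Y r \<longleftrightarrow>
     (\<forall>\<delta>>0. \<exists>M>0. \<forall>n\<ge>n0.
        outer_measure_of P {\<omega> \<in> space P. Y n \<omega> / ennreal (r n) \<ge> ennreal M} \<le> ennreal \<delta>)"

end

theory Submission
  imports Defs "HOL-Real_Asymp.Real_Asymp"
begin

text \<open>
  Let \<open>\<epsilon>\<close> be the supremum of the error of the estimated tail integral over the arguments \<open>(x, y)\<close>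
  with \<open>max x y \<ge> \<delta>\<close>. The generalised inverse of any function \<open>\<epsilon>\<close>-close to a continuous decreasing
  \<open>U\<close> is mapped by \<open>U\<close> to within \<open>\<epsilon>\<close> of its argument, and the joint distribution function is Lipschitz
  in the marginal ones, so the copula error is at most \<open>5 \<epsilon> / \<Lambda>\<close> as soon as the cutoff \<open>\<delta>\<close> is small.

  By Parseval's identity, the error of the tail integral is the integral of the Fourier transform of
  the weight \<open>g\<^sub>a\<^sub>,\<^sub>b\<close> against the error of the fourth logarithmic derivatives (stochastic part) and against
  \<open>\<F>K(h u) - 1\<close> times the transform of \<open>(x\<^sub>1\<^sup>4 + x\<^sub>2\<^sup>4) \<nu>\<close> (bias). Writing \<open>1 / (x\<^sub>1\<^sup>4 + x\<^sub>2\<^sup>4)\<close> as the integral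
  of \<open>exp (- t x\<^sub>1\<^sup>4) exp (- t x\<^sub>2\<^sup>4)\<close> over \<open>t > 0\<close> makes the weight a mixture of products, which bounds
  its transform by a multiple of \<open>(1 + \<delta>\<^sup>-\<^sup>4) / ((1 + \<bar>u\<^sub>1\<bar>) (1 + \<bar>u\<^sub>2\<bar>))\<close>, uniformly in \<open>(a, b)\<close>.
  Hence it suffices to bound the expected error of the empirical moments pointwise in \<open>u\<close>; uniformity
  in \<open>u\<close> is only needed for \<open>A\<^sub>h\<^sub>,\<^sub>n\<close>, where Hoeffding's inequality on a polynomially large grid is enough.
\<close>

section \<open>Inversion and copulas\<close>

text \<open>Finite intensity makes the inverse problem benign: \<open>cmod (\<phi> u)\<close> never
  falls below \<open>exp (- 2 * \<Lambda>)\<close>, so dividing by the empirical characteristic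
  function costs a constant only, and the fourth logarithmic derivatives depend on the empirical
  derivatives in a Lipschitz way, uniformly in the frequency. The eighth moment enters through the
  variances of fourth-order empirical derivatives. For the increments it is not given: their law is
  known through its characteristic function, so each projection is first identified with an explicit
  Poisson mixture. The logarithms have two sources. The cutoff 1 / ln n costs a fourth power, and
  the decay profile 1 / ((1 + |u1|) (1 + |u2|)), which is not integrable, has an integral of order
  (ln n)^2 over the frequency box of side 2 sqrt n. In the bias two such profiles meet and leave a
  single logarithm. Boundedness in probability is asserted for every n from 2 on, so the finitely
  many n before the asymptotic regime need a crude bound of their own.\<close>

text \<open>The function \<open>g\<close> may be neither monotone nor continuous, so nothing is
  known at the infimum itself. To its left \<open>g\<close> exceeds \<open>z\<close>; before any
  point to its right, \<open>g\<close> has come below each level above \<open>z\<close>. Closeness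
  turns this into bounds for the antitone \<open>U\<close>, and continuity of \<open>U\<close>
  carries them to the infimum. The condition \<open>z \<le> U \<delta>\<close> says that the true
  inverse is not cut off at \<delta>.\<close>

lemma inversion_error:
  fixes g U :: "real \<Rightarrow> real"
  assumes g_nonneg: "\<And>x. \<delta> \<le> x \<Longrightarrow> 0 \<le> g x"
    and g_lim: "(g \<longlongrightarrow> 0) at_top"
    and z: "0 < z"
    and close: "\<And>x. \<delta> \<le> x \<Longrightarrow> \<bar>g x - U x\<bar> \<le> \<epsilon>"
    and anti: "\<And>x y. \<delta> \<le> x \<Longrightarrow> x \<le> y \<Longrightarrow> U y \<le> U x"
    and cont: "continuous_on {\<delta>..} U"
  shows inversion_ge: "\<delta> \<le> inversion g \<delta> z"
    and inversion_error_le: "z \<le> U \<delta> \<Longrightarrow> \<bar>U (inversion g \<delta> z) - z\<bar> \<le> \<epsilon>"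
proof -
  define S where "S = {x. \<delta> \<le> x \<and> (INF y\<in>{\<delta>..x}. g y) \<le> z}"
  define x where "x = inversion g \<delta> z"
  have x_eq: "x = Inf S" by (simp add: x_def S_def inversion_def)
  have bdd: "bdd_below (g ` {\<delta>..y})" for y
    by (rule bdd_belowI2[of _ 0]) (use g_nonneg in auto)
  have "eventually (\<lambda>x. g x < z) at_top"
    using order_tendstoD(2)[OF g_lim z] .
  then obtain w where w: "\<delta> \<le> w" "g w < z"
    using eventually_happens[OF eventually_conj[OF _ eventually_ge_at_top[of \<delta>]]] by fastforce
  have "(INF y\<in>{\<delta>..w}. g y) \<le> g w"
    using w by (intro cINF_lower bdd) auto
  then have "w \<in> S" using w by (simp add: S_def)
  then have ne: "S \<noteq> {}" by auto
  have bS: "bdd_below S" by (rule bdd_belowI[of _ \<delta>]) (simp add: S_def)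
  show ge: "\<delta> \<le> inversion g \<delta> z"
    unfolding x_def[symmetric] x_eq using ne by (rule cInf_greatest) (simp add: S_def)
  assume z_le: "z \<le> U \<delta>"
  have eps: "0 \<le> \<epsilon>" using close[of \<delta>] by auto
  have x_ge: "\<delta> \<le> x" using ge by (simp add: x_def)
  have below: "z - \<epsilon> \<le> U y" if "\<delta> \<le> y" "y < x" for y
  proof -
    have "y \<notin> S" using that cInf_lower[OF _ bS, of y] by (auto simp: x_eq)
    then have "z < (INF y\<in>{\<delta>..y}. g y)" using that by (simp add: S_def)
    also have "\<dots> \<le> g y" using that by (intro cINF_lower bdd) auto
    finally show ?thesis using close[OF that(1)] by simp
  qed
  have tend: "(U \<longlongrightarrow> U x) (at x within {\<delta>..})"
    using cont x_ge by (simp add: continuous_on_def)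
  \<comment> \<open>If the infimum is \<delta> itself there are no points to its left, and
    \<open>z \<le> U \<delta>\<close> replaces the left limit.\<close>
  have lower: "z - \<epsilon> \<le> U x"
  proof (cases "x = \<delta>")
    case False
    then have "\<delta> < x" using x_ge by simp
    have "(U \<longlongrightarrow> U x) (at_left x)"
      using tendsto_within_subset[OF tend, of "{\<delta>..x}"] at_within_Icc_at_left[OF \<open>\<delta> < x\<close>] by auto
    then show ?thesis
      by (rule tendsto_lowerbound)
         (use eventually_at_left_real[OF \<open>\<delta> < x\<close>] below in \<open>auto elim: eventually_mono\<close>)
  qed (use z_le eps in simp)
  have above: "U y \<le> z + \<epsilon>" if "x < y" for y
  proof -
    obtain s where s: "s \<in> S" "s < y"
      using cInf_lessD[OF ne, of y] \<open>x < y\<close> by (auto simp: x_eq)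
    \<comment> \<open>The infimum of \<open>g\<close> over an interval may not be attained, hence
      the slack \<open>e\<close>.\<close>
    have "U y \<le> z + \<epsilon> + e" if "e > 0" for e
    proof -
      have "(INF y\<in>{\<delta>..s}. g y) < z + e"
        using s(1) that by (simp add: S_def)
      then obtain t where t: "\<delta> \<le> t" "t \<le> s" "g t < z + e"
        using s(1) by (subst (asm) cINF_less_iff) (auto simp: S_def bdd)
      have "U y \<le> U t" using t s by (intro anti) auto
      also have "\<dots> \<le> g t + \<epsilon>" using close[OF t(1)] by simp
      finally show ?thesis using t by simp
    qed
    then show ?thesis by (rule field_le_epsilon)
  qed
  have "(U \<longlongrightarrow> U x) (at_right x)"
    by (rule tendsto_within_subset[OF tend]) (use x_ge in auto)
  then have upper: "U x \<le> z + \<epsilon>"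
    by (rule tendsto_upperbound)
       (use above in \<open>auto simp: eventually_at_filter\<close>)
  show "\<bar>U (inversion g \<delta> z) - z\<bar> \<le> \<epsilon>"
    using lower upper by (simp add: x_def)
qed

section \<open>Marginals of the jump measure have no atoms\<close>

text \<open>The tail takes every value below the total mass at a positive argument, so the mass of
  \<open>0 < f\<close> is at least each such value and nothing is left for
  \<open>f \<le> 0\<close>.\<close>

lemma (in finite_measure) AE_pos_of_tail:
  fixes f :: "'a \<Rightarrow> real"
  assumes [measurable]: "f \<in> borel_measurable M"
    and surj: "{0<..<measure M (space M)} \<subseteq> (\<lambda>x. measure M {y \<in> space M. x \<le> f y}) ` {0<..}"
  shows "AE y in M. 0 < f y"
proof -
  let ?A = "{y \<in> space M. 0 < f y}"
  have "measure M (space M) \<le> measure M ?A"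
  proof (rule dense_le)
    fix z assume z: "z < measure M (space M)"
    show "z \<le> measure M ?A"
    proof (cases "0 < z")
      case True
      then obtain x where x: "0 < x" "z = measure M {y \<in> space M. x \<le> f y}"
        using surj z by auto
      show ?thesis unfolding x(2) by (rule finite_measure_mono) (use x(1) in auto)
    next
      case False
      then show ?thesis using measure_nonneg[of M ?A] by linarith
    qed
  qed
  then have "measure M ?A = measure M (space M)"
    using bounded_measure[of ?A] by simp
  moreover have "measure M (space M - ?A) = measure M (space M) - measure M ?A"
    by (rule finite_measure_compl) measurable
  ultimately have "measure M (space M - ?A) = 0" by simp
  then have "emeasure M (space M - ?A) = 0" by (simp add: emeasure_eq_measure)
  then show ?thesis
    by (intro AE_I[of _ _ "space M - ?A"]) auto
qed

text \<open>An atom at \<open>x\<close> would make the tail drop by its mass immediately to the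
  right of \<open>x\<close>.\<close>

lemma (in finite_measure) AE_neq_of_tail_continuous:
  fixes f :: "'a \<Rightarrow> real"
  assumes [measurable]: "f \<in> borel_measurable M"
    and cont: "continuous_on {0<..} (\<lambda>x. measure M {y \<in> space M. x \<le> f y})"
    and x: "0 < x"
  shows "AE y in M. f y \<noteq> x"
proof -
  let ?A = "{y \<in> space M. f y = x}" and ?U = "\<lambda>x. measure M {y \<in> space M. x \<le> f y}"
  have tend: "(?U \<longlongrightarrow> ?U x) (at_right x)"
    by (rule tendsto_within_subset[of _ _ _ "{0<..}"]) (use cont x in \<open>auto simp: continuous_on_def\<close>)
  have le: "?U t \<le> ?U x - measure M ?A" if "x < t" for t
  proof -
    have "measure M ?A + ?U t = measure M (?A \<union> {y \<in> space M. t \<le> f y})"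
      by (rule finite_measure_Union[symmetric]) (use that in auto)
    also have "\<dots> \<le> ?U x"
      by (rule finite_measure_mono) (use that in auto)
    finally show ?thesis by simp
  qed
  have "?U x \<le> ?U x - measure M ?A"
    by (rule tendsto_upperbound[OF tend]) (use le in \<open>auto simp: eventually_at_filter\<close>)
  then have "measure M ?A = 0" using measure_nonneg[of M ?A] by linarith
  then have "emeasure M ?A = 0" by (simp add: emeasure_eq_measure)
  then show ?thesis by (intro AE_I[of _ _ ?A]) auto
qed

text \<open>The smoothness of the one-dimensional tails enters as continuity and bijectivity: these
  exclude atoms and make exact inverses available.\<close>

locale jump_measure =
  fixes \<nu> :: "plane measure" and \<Lambda> :: real
  assumes sets_nu [measurable_cong]: "sets \<nu> = sets borel"
    and Lambda_pos: "0 < \<Lambda>"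
    and total: "emeasure \<nu> UNIV = ennreal \<Lambda>"
    and quadrant: "emeasure \<nu> ({0..} \<times> {0..}) = ennreal \<Lambda>"
    and tail1_bij: "bij_betw (\<lambda>x. tail \<nu> x 0) {0<..} {0<..<\<Lambda>}"
    and tail2_bij: "bij_betw (\<lambda>y. tail \<nu> 0 y) {0<..} {0<..<\<Lambda>}"
    and tail1_cont: "continuous_on {0<..} (\<lambda>x. tail \<nu> x 0)"
    and tail2_cont: "continuous_on {0<..} (\<lambda>y. tail \<nu> 0 y)"
begin

sublocale finite_measure \<nu>
proof
  have "space \<nu> = UNIV" using sets_eq_imp_space_eq[OF sets_nu] by simp
  then show "emeasure \<nu> (space \<nu>) \<noteq> \<infinity>" using total by simp
qed

lemma space_nu [simp]: "space \<nu> = UNIV"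
  using sets_eq_imp_space_eq[OF sets_nu] by simp

lemma measure_UNIV [simp]: "measure \<nu> UNIV = \<Lambda>"
  using total Lambda_pos by (simp add: measure_def)

lemma times_sets [measurable]:
  fixes A B :: "real set"
  assumes "A \<in> sets borel" "B \<in> sets borel"
  shows "A \<times> B \<in> sets \<nu>"
  using assms unfolding sets_nu by (simp add: pair_measureI flip: borel_prod)

lemma tail_antimono:
  assumes "x \<le> x'" "y \<le> y'"
  shows "tail \<nu> x' y' \<le> tail \<nu> x y"
  unfolding tail_def by (rule finite_measure_mono) (use assms in auto)

lemma AE_quadrant: "AE x in \<nu>. 0 \<le> fst x \<and> 0 \<le> snd x"
proof -
  have "emeasure \<nu> (UNIV - {0..} \<times> {0..}) = emeasure \<nu> UNIV - emeasure \<nu> ({0..} \<times> {0..})"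
    by (rule emeasure_compl[of _ \<nu>, simplified]) (auto simp: quadrant)
  then have "emeasure \<nu> (UNIV - {0..} \<times> {0..}) = 0" by (simp add: total quadrant)
  then show ?thesis
    by (intro AE_I[of _ _ "UNIV - {0..} \<times> {0..}"]) auto
qed

lemma fst_nu_measurable [measurable]: "fst \<in> borel_measurable \<nu>"
  and snd_nu_measurable [measurable]: "snd \<in> borel_measurable \<nu>"
  unfolding measurable_cong_sets[OF sets_nu refl]
  by (auto intro!: borel_measurable_continuous_onI continuous_intros)

lemma measure_eqI_AE:
  assumes "AE x in \<nu>. P x \<longleftrightarrow> Q x" "Measurable.pred \<nu> P" "Measurable.pred \<nu> Q"
  shows "measure \<nu> {x. P x} = measure \<nu> {x. Q x}"
  using assms by (intro measure_eq_AE) (auto simp: pred_def)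

lemma tail_eq1: "tail \<nu> x 0 = measure \<nu> {y. x \<le> fst y}"
proof -
  have "tail \<nu> x 0 = measure \<nu> {y. x \<le> fst y \<and> 0 \<le> snd y}"
    unfolding tail_def by (rule arg_cong[where f = "measure \<nu>"]) auto
  also have "\<dots> = measure \<nu> {y. x \<le> fst y}"
    by (rule measure_eqI_AE) (use AE_quadrant in \<open>auto elim: eventually_mono\<close>)
  finally show ?thesis .
qed

lemma tail_eq2: "tail \<nu> 0 x = measure \<nu> {y. x \<le> snd y}"
proof -
  have "tail \<nu> 0 x = measure \<nu> {y. 0 \<le> fst y \<and> x \<le> snd y}"
    unfolding tail_def by (rule arg_cong[where f = "measure \<nu>"]) auto
  also have "\<dots> = measure \<nu> {y. x \<le> snd y}"
    by (rule measure_eqI_AE) (use AE_quadrant in \<open>auto elim: eventually_mono\<close>)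
  finally show ?thesis .
qed

lemma AE_fst_pos: "AE y in \<nu>. 0 < fst y"
  by (rule AE_pos_of_tail) (use tail1_bij in \<open>auto simp: bij_betw_def tail_eq1\<close>)

lemma AE_snd_pos: "AE y in \<nu>. 0 < snd y"
  by (rule AE_pos_of_tail) (use tail2_bij in \<open>auto simp: bij_betw_def tail_eq2\<close>)

lemma AE_fst_neq:
  assumes "0 \<le> x" shows "AE y in \<nu>. fst y \<noteq> x"
proof (cases "x = 0")
  case False
  show ?thesis
    by (rule AE_neq_of_tail_continuous) (use tail1_cont assms False in \<open>auto simp: tail_eq1\<close>)
qed (use AE_fst_pos in \<open>auto elim: eventually_mono\<close>)

lemma AE_snd_neq:
  assumes "0 \<le> x" shows "AE y in \<nu>. snd y \<noteq> x"
proof (cases "x = 0")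
  case False
  show ?thesis
    by (rule AE_neq_of_tail_continuous) (use tail2_cont assms False in \<open>auto simp: tail_eq2\<close>)
qed (use AE_snd_pos in \<open>auto elim: eventually_mono\<close>)

section \<open>Distribution functions in terms of tail integrals\<close>

text \<open>Strict inequalities are complementary to those in \<open>tail\<close>; they agree with
  the weak ones because neither marginal has atoms.\<close>

lemma joint_df_eq_measure:
  assumes "0 \<le> x" "0 \<le> y"
  shows "joint_df \<nu> x y = measure \<nu> {z. fst z < x \<and> snd z < y} / \<Lambda>"
proof -
  have "measure \<nu> ({0..x} \<times> {0..y}) = measure \<nu> {z. 0 \<le> fst z \<and> fst z \<le> x \<and> 0 \<le> snd z \<and> snd z \<le> y}"
    by (rule arg_cong[where f = "measure \<nu>"]) auto
  also have "\<dots> = measure \<nu> {z. fst z < x \<and> snd z < y}"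
    by (rule measure_eqI_AE)
       (use AE_quadrant AE_fst_neq[OF assms(1)] AE_snd_neq[OF assms(2)] in \<open>auto elim: eventually_elim2\<close>)
  finally show ?thesis by (simp add: joint_df_def)
qed

lemma measure_fst_less: "measure \<nu> {z. fst z < x} = \<Lambda> - tail \<nu> x 0"
proof -
  have "measure \<nu> (UNIV - {y. x \<le> fst y}) = \<Lambda> - tail \<nu> x 0"
    using finite_measure_compl[of "{y. x \<le> fst y}"] by (simp add: tail_eq1)
  moreover have "UNIV - {y. x \<le> fst y} = {z :: plane. fst z < x}" by auto
  ultimately show ?thesis by simp
qed

lemma measure_snd_less: "measure \<nu> {z. snd z < x} = \<Lambda> - tail \<nu> 0 x"
proof -
  have "measure \<nu> (UNIV - {y. x \<le> snd y}) = \<Lambda> - tail \<nu> 0 x"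
    using finite_measure_compl[of "{y. x \<le> snd y}"] by (simp add: tail_eq2)
  moreover have "UNIV - {y. x \<le> snd y} = {z :: plane. snd z < x}" by auto
  ultimately show ?thesis by simp
qed

text \<open>Inclusion-exclusion, in the shape of \<open>M_hat\<close>, so that the error of
  \<open>M_hat\<close> becomes a sum of three tail errors.\<close>

lemma joint_df_eq_tail:
  assumes "0 \<le> x" "0 \<le> y"
  shows "joint_df \<nu> x y = 1 + (tail \<nu> x y - tail \<nu> x 0 - tail \<nu> 0 y) / \<Lambda>"
proof -
  let ?A = "{z :: plane. x \<le> fst z}" and ?B = "{z :: plane. y \<le> snd z}"
  have "tail \<nu> x y = measure \<nu> (?A \<inter> ?B)"
    unfolding tail_def by (rule arg_cong[where f = "measure \<nu>"]) auto
  moreover have "measure \<nu> (?A \<union> ?B) = measure \<nu> ?A + measure \<nu> ?B - measure \<nu> (?A \<inter> ?B)"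
    by (rule measure_Un3) (auto simp: fmeasurable_eq_sets)
  moreover have "measure \<nu> (UNIV - (?A \<union> ?B)) = \<Lambda> - measure \<nu> (?A \<union> ?B)"
    using finite_measure_compl[of "?A \<union> ?B"] by simp
  moreover have "UNIV - (?A \<union> ?B) = {z. fst z < x \<and> snd z < y}" by auto
  ultimately show ?thesis
    using Lambda_pos by (simp add: joint_df_eq_measure[OF assms] tail_eq1 tail_eq2 field_simps)
qed

lemma joint_df_bounds: "0 \<le> joint_df \<nu> x y" "joint_df \<nu> x y \<le> 1"
  using bounded_measure[of "{0..x} \<times> {0..y}"] Lambda_pos by (auto simp: joint_df_def)

lemma measure_diff_le:
  assumes "Measurable.pred \<nu> P" "Measurable.pred \<nu> Q" "Measurable.pred \<nu> R"
    and "\<And>z. P z \<Longrightarrow> Q z" "\<And>z. Q z \<Longrightarrow> \<not> P z \<Longrightarrow> R z"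
  shows "measure \<nu> {z. Q z} - measure \<nu> {z. P z} \<le> measure \<nu> {z. R z}"
proof -
  have "measure \<nu> {z. Q z} \<le> measure \<nu> ({z. P z} \<union> {z. R z})"
    by (rule finite_measure_mono) (use assms in \<open>auto simp: pred_def\<close>)
  also have "\<dots> \<le> measure \<nu> {z. P z} + measure \<nu> {z. R z}"
    by (rule measure_Un_le) (use assms in \<open>auto simp: pred_def\<close>)
  finally show ?thesis by simp
qed

lemma measure_Diff_pred:
  assumes "Measurable.pred \<nu> P" "Measurable.pred \<nu> Q" "\<And>z. P z \<Longrightarrow> Q z"
  shows "measure \<nu> {z. Q z \<and> \<not> P z} = measure \<nu> {z. Q z} - measure \<nu> {z. P z}"
proof -
  have "{z. Q z \<and> \<not> P z} = {z. Q z} - {z. P z}" by auto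
  then show ?thesis
    using assms by (simp add: pred_def finite_measure_Diff Collect_mono)
qed

text \<open>The two values differ by the mass of part of a vertical strip, and the full strip has
  the difference of the first tails as its mass. Quantile errors therefore matter only after the
  tail has been applied to them.\<close>

lemma joint_df_diff1:
  assumes "0 \<le> x" "0 \<le> x'" "0 \<le> y"
  shows "\<bar>joint_df \<nu> x y - joint_df \<nu> x' y\<bar> \<le> \<bar>tail \<nu> x 0 - tail \<nu> x' 0\<bar> / \<Lambda>"
proof -
  have *: "\<bar>joint_df \<nu> x y - joint_df \<nu> x' y\<bar> \<le> \<bar>tail \<nu> x 0 - tail \<nu> x' 0\<bar> / \<Lambda>"
    if le: "x \<le> x'" and pos: "0 \<le> x" for x x'
  proof -
    let ?m = "measure \<nu>"
    have "?m {z. fst z < x \<and> snd z < y} \<le> ?m {z. fst z < x' \<and> snd z < y}"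
      by (rule finite_measure_mono) (use le in auto)
    moreover have "?m {z. fst z < x' \<and> snd z < y} - ?m {z. fst z < x \<and> snd z < y} \<le> ?m {z. fst z < x' \<and> \<not> fst z < x}"
      by (rule measure_diff_le) (use le in auto)
    moreover have "?m {z. fst z < x' \<and> \<not> fst z < x} = ?m {z. fst z < x'} - ?m {z. fst z < x}"
      by (rule measure_Diff_pred) (use le in auto)
    moreover have "tail \<nu> x' 0 \<le> tail \<nu> x 0" by (rule tail_antimono) (use le in auto)
    ultimately have "\<bar>?m {z. fst z < x \<and> snd z < y} - ?m {z. fst z < x' \<and> snd z < y}\<bar> \<le> \<bar>tail \<nu> x 0 - tail \<nu> x' 0\<bar>"
      unfolding measure_fst_less by linarith
    then show ?thesis
      using Lambda_pos le pos assms(3)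
      by (simp add: joint_df_eq_measure diff_divide_distrib[symmetric] divide_right_mono)
  qed
  show ?thesis
    using *[of x x'] *[of x' x] assms by (cases "x \<le> x'") (auto simp: abs_minus_commute)
qed

lemma joint_df_diff2:
  assumes "0 \<le> y" "0 \<le> y'" "0 \<le> x"
  shows "\<bar>joint_df \<nu> x y - joint_df \<nu> x y'\<bar> \<le> \<bar>tail \<nu> 0 y - tail \<nu> 0 y'\<bar> / \<Lambda>"
proof -
  have *: "\<bar>joint_df \<nu> x y - joint_df \<nu> x y'\<bar> \<le> \<bar>tail \<nu> 0 y - tail \<nu> 0 y'\<bar> / \<Lambda>"
    if le: "y \<le> y'" and pos: "0 \<le> y" for y y'
  proof -
    let ?m = "measure \<nu>"
    have "?m {z. fst z < x \<and> snd z < y} \<le> ?m {z. fst z < x \<and> snd z < y'}"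
      by (rule finite_measure_mono) (use le in auto)
    moreover have "?m {z. fst z < x \<and> snd z < y'} - ?m {z. fst z < x \<and> snd z < y} \<le> ?m {z. snd z < y' \<and> \<not> snd z < y}"
      by (rule measure_diff_le) (use le in auto)
    moreover have "?m {z. snd z < y' \<and> \<not> snd z < y} = ?m {z. snd z < y'} - ?m {z. snd z < y}"
      by (rule measure_Diff_pred) (use le in auto)
    moreover have "tail \<nu> 0 y' \<le> tail \<nu> 0 y" by (rule tail_antimono) (use le in auto)
    ultimately have "\<bar>?m {z. fst z < x \<and> snd z < y} - ?m {z. fst z < x \<and> snd z < y'}\<bar> \<le> \<bar>tail \<nu> 0 y - tail \<nu> 0 y'\<bar>"
      unfolding measure_snd_less by linarith
    then show ?thesis
      using Lambda_pos le pos assms(3)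
      by (simp add: joint_df_eq_measure diff_divide_distrib[symmetric] divide_right_mono)
  qed
  show ?thesis
    using *[of y y'] *[of y' y] assms by (cases "y \<le> y'") (auto simp: abs_minus_commute)
qed

lemma marginal1_eq: "0 \<le> x \<Longrightarrow> marginal1 \<nu> x = 1 - tail \<nu> x 0 / \<Lambda>"
proof -
  assume x: "0 \<le> x"
  have "measure \<nu> ({0..x} \<times> {0..}) = measure \<nu> {z. 0 \<le> fst z \<and> fst z \<le> x \<and> 0 \<le> snd z}"
    by (rule arg_cong[where f = "measure \<nu>"]) auto
  also have "\<dots> = measure \<nu> {z. fst z < x}"
    by (rule measure_eqI_AE)
       (use AE_quadrant AE_fst_neq[OF x] in \<open>auto elim: eventually_elim2\<close>)
  finally show ?thesis
    using Lambda_pos by (simp add: marginal1_def measure_fst_less diff_divide_distrib)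
qed

lemma marginal2_eq: "0 \<le> x \<Longrightarrow> marginal2 \<nu> x = 1 - tail \<nu> 0 x / \<Lambda>"
proof -
  assume x: "0 \<le> x"
  have "measure \<nu> ({0..} \<times> {0..x}) = measure \<nu> {z. 0 \<le> fst z \<and> 0 \<le> snd z \<and> snd z \<le> x}"
    by (rule arg_cong[where f = "measure \<nu>"]) auto
  also have "\<dots> = measure \<nu> {z. snd z < x}"
    by (rule measure_eqI_AE)
       (use AE_quadrant AE_snd_neq[OF x] in \<open>auto elim: eventually_elim2\<close>)
  finally show ?thesis
    using Lambda_pos by (simp add: marginal2_def measure_snd_less diff_divide_distrib)
qed

text \<open>Turns a marginal quantile into a solution of \<open>T x = \<Lambda> * (1 - u)\<close>,
  the equation which the inversion operation solves approximately.\<close>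

lemma the_inv_into_one_minus:
  fixes T :: "real \<Rightarrow> real"
  assumes bij: "bij_betw T {0<..} {0<..<\<Lambda>}" and V: "\<And>x. 0 < x \<Longrightarrow> V x = 1 - T x / \<Lambda>"
    and u: "0 < u" "u < 1"
  shows "0 < the_inv_into {0<..} V u" "T (the_inv_into {0<..} V u) = \<Lambda> * (1 - u)"
proof -
  have "\<Lambda> * (1 - u) \<in> {0<..<\<Lambda>}"
    using u Lambda_pos by (auto simp: algebra_simps)
  then obtain x where x: "0 < x" "T x = \<Lambda> * (1 - u)"
    using bij unfolding bij_betw_def by (metis greaterThan_iff imageE)
  have "inj_on V {0<..}"
    using bij Lambda_pos by (auto simp: inj_on_def bij_betw_def V)
  moreover have "V x = u" using x Lambda_pos by (simp add: V)
  ultimately have "the_inv_into {0<..} V u = x"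
    using x by (auto intro: the_inv_into_f_eq)
  then show "0 < the_inv_into {0<..} V u" "T (the_inv_into {0<..} V u) = \<Lambda> * (1 - u)"
    using x by auto
qed

text \<open>The factor 5 counts three tail errors in \<open>M_hat\<close> at the estimated quantiles
  and one for each quantile, measured through the tails. Estimated quantiles are at least \<delta>,
  so the estimated tail integral is only evaluated where one argument is. The crude version bounds
  the effect of the quantile errors by 1, since distribution functions take values in the unit
  interval; it holds even when the cutoff truncates the inverses.\<close>

lemma copula_estimation_error:
  fixes N :: "real \<Rightarrow> real \<Rightarrow> complex"
  assumes \<delta>: "0 < \<delta>"
    and close: "\<And>x y. 0 \<le> x \<Longrightarrow> 0 \<le> y \<Longrightarrow> \<delta> \<le> x \<or> \<delta> \<le> y \<Longrightarrow> cmod (N x y - tail \<nu> x y) \<le> \<epsilon>"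
    and lim1: "((\<lambda>x. N x 0) \<longlongrightarrow> 0) at_top" and lim2: "(N 0 \<longlongrightarrow> 0) at_top"
    and uv: "0 < u" "u < 1" "0 < v" "v < 1"
  shows copula_error_crude: "cmod (jump_copula \<nu> u v - C_hat N \<Lambda> \<delta> u v) \<le> 1 + 3 * \<epsilon> / \<Lambda>"
    and copula_error_sharp: "\<Lambda> * (1 - u) \<le> tail \<nu> \<delta> 0 \<Longrightarrow> \<Lambda> * (1 - v) \<le> tail \<nu> 0 \<delta> \<Longrightarrow>
      cmod (jump_copula \<nu> u v - C_hat N \<Lambda> \<delta> u v) \<le> 5 * \<epsilon> / \<Lambda>"
proof -
  define x where "x = the_inv_into {0<..} (marginal1 \<nu>) u"
  define y where "y = the_inv_into {0<..} (marginal2 \<nu>) v"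
  define x' where "x' = V1_hat_inv N \<Lambda> \<delta> u"
  define y' where "y' = V2_hat_inv N \<Lambda> \<delta> v"
  have x: "0 < x" "tail \<nu> x 0 = \<Lambda> * (1 - u)"
    unfolding x_def by (rule the_inv_into_one_minus[OF tail1_bij], use marginal1_eq uv in auto)+
  have y: "0 < y" "tail \<nu> 0 y = \<Lambda> * (1 - v)"
    unfolding y_def by (rule the_inv_into_one_minus[OF tail2_bij], use marginal2_eq uv in auto)+
  have pos: "0 < \<Lambda> * (1 - u)" "0 < \<Lambda> * (1 - v)" using uv Lambda_pos by auto
  have tail_nonneg: "0 \<le> tail \<nu> s t" for s t by (simp add: tail_def)
  \<comment> \<open>Taking the real part and cutting off at 0 cannot increase the distance to a
    nonnegative number.\<close>
  have Re_close: "\<bar>max (Re z) 0 - t\<bar> \<le> \<epsilon>" if "cmod (z - complex_of_real t) \<le> \<epsilon>" "0 \<le> t" for z t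
    using abs_Re_le_cmod[of "z - complex_of_real t"] that by (auto simp: max_def abs_le_iff)
  have lim1': "((\<lambda>x. max (Re (N x 0)) 0) \<longlongrightarrow> 0) at_top" and lim2': "((\<lambda>x. max (Re (N 0 x)) 0) \<longlongrightarrow> 0) at_top"
    by (rule tendsto_eq_intros lim1 lim2 refl | simp)+
  note inv1 = inversion_ge[OF _ lim1' pos(1), of \<delta> "\<lambda>x. tail \<nu> x 0" \<epsilon>] inversion_error_le[OF _ lim1' pos(1), of \<delta> "\<lambda>x. tail \<nu> x 0" \<epsilon>]
  note inv2 = inversion_ge[OF _ lim2' pos(2), of \<delta> "tail \<nu> 0" \<epsilon>] inversion_error_le[OF _ lim2' pos(2), of \<delta> "tail \<nu> 0" \<epsilon>]
  have cont: "continuous_on {\<delta>..} (\<lambda>x. tail \<nu> x 0)" "continuous_on {\<delta>..} (tail \<nu> 0)"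
    by (rule continuous_on_subset[OF tail1_cont] continuous_on_subset[OF tail2_cont], use \<delta> in auto)+
  have x'_ge: "\<delta> \<le> x'" unfolding x'_def V1_hat_inv_def
    by (rule inv1) (use \<delta> in \<open>auto intro!: Re_close close tail_nonneg tail_antimono cont\<close>)
  have y'_ge: "\<delta> \<le> y'" unfolding y'_def V2_hat_inv_def
    by (rule inv2) (use \<delta> in \<open>auto intro!: Re_close close tail_nonneg tail_antimono cont\<close>)
  have J: "complex_of_real (joint_df \<nu> x' y') - M_hat N \<Lambda> x' y' =
      ((tail \<nu> x' y' - N x' y') - (tail \<nu> x' 0 - N x' 0) - (tail \<nu> 0 y' - N 0 y')) / \<Lambda>"
    using x'_ge y'_ge \<delta> by (simp add: joint_df_eq_tail M_hat_def diff_divide_distrib)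
  have "cmod ((tail \<nu> x' y' - N x' y') - (tail \<nu> x' 0 - N x' 0) - (tail \<nu> 0 y' - N 0 y')) \<le> \<epsilon> + \<epsilon> + \<epsilon>"
  proof -
    have "cmod (tail \<nu> s t - N s t) \<le> \<epsilon>" if "0 \<le> s" "0 \<le> t" "\<delta> \<le> s \<or> \<delta> \<le> t" for s t
      using close[OF that] by (simp add: norm_minus_commute)
    from this[of x' y'] this[of x' 0] this[of 0 y'] show ?thesis
      using x'_ge y'_ge \<delta> norm_triangle_ineq4[of "(tail \<nu> x' y' - N x' y') - (tail \<nu> x' 0 - N x' 0)" "tail \<nu> 0 y' - N 0 y'"]
        norm_triangle_ineq4[of "tail \<nu> x' y' - N x' y'" "tail \<nu> x' 0 - N x' 0"]
      by linarith
  qed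
  then have M_err: "cmod (joint_df \<nu> x' y' - M_hat N \<Lambda> x' y') \<le> 3 * \<epsilon> / \<Lambda>"
    using Lambda_pos unfolding J by (simp add: norm_divide divide_right_mono)
  have C: "jump_copula \<nu> u v = joint_df \<nu> x y" "C_hat N \<Lambda> \<delta> u v = M_hat N \<Lambda> x' y'"
    by (auto simp: jump_copula_def C_hat_def x_def y_def x'_def y'_def)
  have split: "cmod (jump_copula \<nu> u v - C_hat N \<Lambda> \<delta> u v) \<le> \<bar>joint_df \<nu> x y - joint_df \<nu> x' y'\<bar> + 3 * \<epsilon> / \<Lambda>"
  proof -
    have "jump_copula \<nu> u v - C_hat N \<Lambda> \<delta> u v =
      complex_of_real (joint_df \<nu> x y - joint_df \<nu> x' y') + (complex_of_real (joint_df \<nu> x' y') - M_hat N \<Lambda> x' y')"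
      by (simp add: C)
    then show ?thesis
      using M_err by (metis add_left_mono norm_of_real norm_triangle_ineq order_trans)
  qed
  show "cmod (jump_copula \<nu> u v - C_hat N \<Lambda> \<delta> u v) \<le> 1 + 3 * \<epsilon> / \<Lambda>"
    using split joint_df_bounds[of x y] joint_df_bounds[of x' y'] by (auto simp: abs_le_iff)
  assume tu: "\<Lambda> * (1 - u) \<le> tail \<nu> \<delta> 0" and tv: "\<Lambda> * (1 - v) \<le> tail \<nu> 0 \<delta>"
  have "\<bar>tail \<nu> x' 0 - \<Lambda> * (1 - u)\<bar> \<le> \<epsilon>" unfolding x'_def V1_hat_inv_def
    by (rule inv1) (use \<delta> tu in \<open>auto intro!: Re_close close tail_nonneg tail_antimono cont\<close>)
  then have 1: "\<bar>joint_df \<nu> x y - joint_df \<nu> x' y\<bar> \<le> \<epsilon> / \<Lambda>"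
    using joint_df_diff1[of x x' y] x y x'_ge \<delta> Lambda_pos
    by (intro order_trans[OF joint_df_diff1]) (auto simp: divide_right_mono abs_minus_commute)
  have "\<bar>tail \<nu> 0 y' - \<Lambda> * (1 - v)\<bar> \<le> \<epsilon>" unfolding y'_def V2_hat_inv_def
    by (rule inv2) (use \<delta> tv in \<open>auto intro!: Re_close close tail_nonneg tail_antimono cont\<close>)
  then have 2: "\<bar>joint_df \<nu> x' y - joint_df \<nu> x' y'\<bar> \<le> \<epsilon> / \<Lambda>"
    using x y x'_ge y'_ge \<delta> Lambda_pos
    by (intro order_trans[OF joint_df_diff2]) (auto simp: divide_right_mono abs_minus_commute)
  have "5 * \<epsilon> / \<Lambda> = \<epsilon> / \<Lambda> + \<epsilon> / \<Lambda> + 3 * \<epsilon> / \<Lambda>" by (simp add: field_simps)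
  then show "cmod (jump_copula \<nu> u v - C_hat N \<Lambda> \<delta> u v) \<le> 5 * \<epsilon> / \<Lambda>"
    using split 1 2 by linarith
qed

end

section \<open>Fourier transform of the weight\<close>

text \<open>Integrability is demanded of the dominating function alone: if it fails for
  \<open>f\<close>, the integral of \<open>f\<close> is 0 by convention, and \<open>g\<close> is
  nonnegative.\<close>

lemma integral_norm_bound_integral':
  fixes f :: "'a \<Rightarrow> 'b :: {banach, second_countable_topology}"
  assumes "integrable M g" and le: "\<And>x. norm (f x) \<le> g x"
  shows "norm (LINT x|M. f x) \<le> (LINT x|M. g x)"
proof (cases "integrable M f")
  case True
  show ?thesis
    by (rule order_trans[OF integral_norm_bound integral_mono]) (use True assms in auto)
next
  case False
  have "0 \<le> g x" for x using norm_ge_zero le by (rule order_trans)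
  then show ?thesis using False by (simp add: not_integrable_integral_eq)
qed

text \<open>The total variation of a function decreasing to 0 on a half-line is its initial
  value.\<close>

lemma integrable_halfline_of_deriv:
  fixes f :: "real \<Rightarrow> real"
  assumes f': "\<And>x. a \<le> x \<Longrightarrow> DERIV f x :> f' x"
    and meas: "f' \<in> borel_measurable borel"
    and dec: "\<And>x. a \<le> x \<Longrightarrow> f' x \<le> 0"
    and lim: "(f \<longlongrightarrow> 0) at_top"
  shows "has_bochner_integral lborel (\<lambda>x. indicator {a..} x * - f' x) (f a)"
proof -
  have mono: "f x \<le> f a" if "a \<le> x" for x
    by (rule DERIV_nonpos_imp_nonincreasing[OF that]) (use f' dec in force)
  have ge: "0 \<le> f a"
    by (rule tendsto_upperbound[OF lim]) (auto intro!: eventually_at_top_linorderI[of a] mono)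
  have "(\<integral>\<^sup>+x. ennreal (- f' x) * indicator {a..} x \<partial>lborel) = ennreal (0 - (- f a))"
    by (rule nn_integral_FTC_atLeast)
       (auto intro!: derivative_eq_intros f' measurable_compose[OF meas] tendsto_eq_intros lim simp: dec meas)
  then have "(\<integral>\<^sup>+x. ennreal (indicator {a..} x * - f' x) \<partial>lborel) = ennreal (f a)"
    by (subst (asm) nn_integral_cong[of _ _ "\<lambda>x. ennreal (indicator {a..} x * - f' x)"])
       (auto simp: indicator_def)
  then show ?thesis
    by (intro has_bochner_integral_nn_integral) (use meas dec ge in \<open>auto simp: indicator_def\<close>)
qed

text \<open>One integration by parts against \<open>iexp (v * x)\<close>. The boundary term and the
  total variation of \<open>f\<close> both equal \<open>f a\<close>, whence the factor 2.\<close>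

lemma cmod_oscillatory_integral_le:
  fixes f f' :: "real \<Rightarrow> real"
  assumes f': "\<And>x. DERIV f x :> f' x"
    and cont: "continuous_on UNIV f'"
    and dec: "\<And>x. a \<le> x \<Longrightarrow> f' x \<le> 0"
    and lim: "(f \<longlongrightarrow> 0) at_top"
    and int: "integrable lborel (\<lambda>x. indicator {a..} x * f x)"
  shows "\<bar>v\<bar> * cmod (LINT x|lborel. complex_of_real (indicator {a..} x * f x) * iexp (v * x)) \<le> 2 * f a"
proof -
  define G where "G x = complex_of_real (f x) * iexp (v * x)" for x
  define G1 where "G1 x = complex_of_real (f' x) * iexp (v * x)" for x
  have meas': "f' \<in> borel_measurable borel"
    using cont by (rule borel_measurable_continuous_onI)
  have contf: "continuous_on UNIV f"
    by (rule DERIV_continuous_on[of _ f f']) (use f' in \<open>auto intro: has_field_derivative_at_within\<close>)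
  have df: "has_bochner_integral lborel (\<lambda>x. indicator {a..} x * - f' x) (f a)"
    by (rule integrable_halfline_of_deriv) (use f' meas' dec lim in auto)
  have dG: "(G has_vector_derivative G1 x + \<i> * v * G x) (at x)" for x
  proof -
    have "((\<lambda>x. f x *\<^sub>R exp (x *\<^sub>R (\<i> * v))) has_vector_derivative
        (f x *\<^sub>R (exp (x *\<^sub>R (\<i> * v)) * (\<i> * v)) + f' x *\<^sub>R exp (x *\<^sub>R (\<i> * v)))) (at x)"
      by (intro has_vector_derivative_scaleR f' exp_scaleR_has_vector_derivative_right)
    moreover have "G = (\<lambda>x. f x *\<^sub>R exp (x *\<^sub>R (\<i> * v)))"
      by (simp add: G_def fun_eq_iff scaleR_conv_of_real algebra_simps)
    ultimately show ?thesis
      by (simp add: G1_def scaleR_conv_of_real algebra_simps)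
  qed
  have measG [measurable]: "G \<in> borel_measurable borel" "G1 \<in> borel_measurable borel"
    using meas' borel_measurable_continuous_onI[OF contf] by (auto simp: G_def[abs_def] G1_def[abs_def])
  have iG: "integrable lborel (\<lambda>x. indicator {a..} x *\<^sub>R G x)"
    by (rule Bochner_Integration.integrable_bound[OF int])
       (measurable, auto simp: G_def norm_mult indicator_def)
  have iG1: "integrable lborel (\<lambda>x. indicator {a..} x *\<^sub>R G1 x)"
    by (rule Bochner_Integration.integrable_bound[OF integrable.intros[OF df]])
       (measurable, auto simp: G1_def norm_mult indicator_def)
  have lim_G: "(G \<longlongrightarrow> 0) at_top"
    by (rule tendsto_norm_zero_cancel) (use tendsto_rabs[OF lim] in \<open>simp add: G_def norm_mult\<close>)
  have sub: "integrable lborel (\<lambda>x. indicator {a<..} x *\<^sub>R F x)"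
    if "integrable lborel (\<lambda>x. indicator {a..} x *\<^sub>R F x)" for F :: "real \<Rightarrow> complex"
    using set_integrable_subset[of lborel "{a..}" F "{a<..}"] that by (simp add: set_integrable_def subset_eq)
  \<comment> \<open>The interval integral below runs over the open half-line, the remaining
    integrals over the closed one.\<close>
  have swap: "(LINT x|lborel. indicator {a<..} x *\<^sub>R F x) = (LINT x|lborel. indicator {a..} x *\<^sub>R F x)"
    if "integrable lborel (\<lambda>x. indicator {a..} x *\<^sub>R F x)" for F :: "real \<Rightarrow> complex"
    by (rule integral_cong_AE)
       (use that sub[OF that] AE_lborel_singleton[of a] in \<open>auto simp: indicator_def elim!: eventually_mono\<close>)
  have iS: "integrable lborel (\<lambda>x. indicator {a..} x *\<^sub>R (G1 x + \<i> * v * G x))"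
    using iG1 integrable_mult_right[OF iG, of "\<i> * v"]
    by (simp add: scaleR_right_distrib mult_scaleR_right)
  have "(LBINT x=ereal a..\<infinity>. G1 x + \<i> * v * G x) = 0 - G a"
  proof (rule interval_integral_FTC_integrable)
    show "set_integrable lborel (einterval (ereal a) \<infinity>) (\<lambda>x. G1 x + \<i> * v * G x)"
      using sub[OF iS] by (simp add: set_integrable_def)
    show "isCont (\<lambda>x. G1 x + \<i> * v * G x) x" for x
      by (rule continuous_on_interior[of UNIV])
         (auto simp: G_def G1_def intro!: continuous_intros contf cont)
    have "isCont G a"
      by (rule continuous_on_interior[of UNIV]) (auto simp: G_def intro!: continuous_intros contf)
    then show "((G \<circ> real_of_ereal) \<longlongrightarrow> G a) (at_right (ereal a))"
      by (simp add: ereal_tendsto_simps isCont_def filterlim_at_split)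
    show "((G \<circ> real_of_ereal) \<longlongrightarrow> 0) (at_left \<infinity>)"
      using lim_G by (simp add: ereal_tendsto_simps)
  qed (use dG in auto)
  then have "- G a = (LINT x|lborel. indicator {a..} x *\<^sub>R (G1 x + \<i> * v * G x))"
    by (simp add: interval_integral_to_infinity_eq set_lebesgue_integral_def swap[OF iS])
  also have "\<dots> = (LINT x|lborel. indicator {a..} x *\<^sub>R G1 x) + \<i> * v * (LINT x|lborel. indicator {a..} x *\<^sub>R G x)"
  proof -
    have "(\<lambda>x. indicator {a..} x *\<^sub>R (G1 x + \<i> * v * G x)) = (\<lambda>x. indicator {a..} x *\<^sub>R G1 x + (\<i> * v) * (indicator {a..} x *\<^sub>R G x))"
      by (auto simp: fun_eq_iff indicator_def)
    then show ?thesis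
      using iG1 integrable_mult_right[OF iG, of "\<i> * v"] by (simp only: Bochner_Integration.integral_add integral_mult_right_zero)
  qed
  finally have "\<i> * v * (LINT x|lborel. indicator {a..} x *\<^sub>R G x) = - G a - (LINT x|lborel. indicator {a..} x *\<^sub>R G1 x)"
    by (simp add: algebra_simps)
  then have "\<bar>v\<bar> * cmod (LINT x|lborel. indicator {a..} x *\<^sub>R G x) = cmod (- G a - (LINT x|lborel. indicator {a..} x *\<^sub>R G1 x))"
    by (metis norm_mult norm_ii norm_of_real mult_1)
  also have "\<dots> \<le> cmod (G a) + cmod (LINT x|lborel. indicator {a..} x *\<^sub>R G1 x)"
    by (metis norm_minus_cancel norm_triangle_ineq4)
  also have "cmod (LINT x|lborel. indicator {a..} x *\<^sub>R G1 x) \<le> (LINT x|lborel. indicator {a..} x * - f' x)"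
    by (rule integral_norm_bound_integral')
       (use integrable.intros[OF df] dec in \<open>auto simp: G1_def norm_mult indicator_def\<close>)
  also have "\<dots> = f a"
    using df by (rule has_bochner_integral_integral_eq)
  also have "cmod (G a) = f a"
  proof -
    have "0 \<le> (LINT x|lborel. indicator {a..} x * - f' x)"
      by (rule Bochner_Integration.integral_nonneg) (use dec in \<open>auto simp: indicator_def\<close>)
    then show ?thesis
      using has_bochner_integral_integral_eq[OF df] by (simp add: G_def norm_mult)
  qed
  finally show ?thesis
    by (simp add: G_def scaleR_conv_of_real mult.assoc)
qed

section \<open>Quartic exponentials on a half-line\<close>

text \<open>Superadditivity of fourth powers, x^4 >= a^4 + (x - a)^4, splits off the factor at
  \<open>a\<close>. The elementary s^4 >= s - 1 then bounds the rest by an exponential of rate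
  t^(1/4) and the constant e, rounded up to 3.\<close>

lemma exp_quartic_tail_nn_integral_le:
  fixes t a :: real
  assumes "0 < t" "0 \<le> a"
  shows "(\<integral>\<^sup>+x. ennreal (indicator {a..} x * exp (- (t * x ^ 4))) \<partial>lborel)
    \<le> ennreal (3 * exp (- (t * a ^ 4)) * t powr (- 1 / 4))"
proof -
  define r where "r = t powr (1 / 4)"
  have r: "r > 0" "r ^ 4 = t" "1 / r = t powr (- 1 / 4)"
    using assms by (auto simp: r_def powr_power powr_minus_divide)
  have le: "exp (- (t * x ^ 4)) \<le> 3 * exp (- (t * a ^ 4)) * exp (- (r * (x - a)))" if "a \<le> x" for x
  proof -
    have "a ^ 4 + (x - a) ^ 4 \<le> x ^ 4"
    proof -
      define d where "d = x - a"
      have "(a + d) ^ 4 = a ^ 4 + d ^ 4 + (4 * a ^ 3 * d + 6 * a ^ 2 * d ^ 2 + 4 * a * d ^ 3)"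
        by (simp add: power4_eq_xxxx power3_eq_cube power2_eq_square algebra_simps)
      moreover have "0 \<le> 4 * a ^ 3 * d + 6 * a ^ 2 * d ^ 2 + 4 * a * d ^ 3"
        using assms that by (auto simp: d_def)
      ultimately show ?thesis by (simp add: d_def)
    qed
    then have "t * a ^ 4 + (r * (x - a)) ^ 4 \<le> t * x ^ 4"
      using assms r by (simp add: power_mult_distrib flip: distrib_left)
    moreover have "s - 1 \<le> s ^ 4" for s :: real
    proof -
      \<comment> \<open>This sum of squares equals s^4 - s + 1/2.\<close>
      have "0 \<le> (s\<^sup>2 - 1/2)\<^sup>2 + (s - 1/2)\<^sup>2" by simp
      then show ?thesis by (simp add: power2_eq_square power4_eq_xxxx algebra_simps)
    qed
    from this[of "r * (x - a)"] have "r * (x - a) - 1 \<le> (r * (x - a)) ^ 4" .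
    ultimately have "- (t * x ^ 4) \<le> 1 + (- (t * a ^ 4) + - (r * (x - a)))"
      by linarith
    then have "exp (- (t * x ^ 4)) \<le> exp 1 * (exp (- (t * a ^ 4)) * exp (- (r * (x - a))))"
      by (metis exp_add exp_le_cancel_iff)
    also have "\<dots> \<le> 3 * (exp (- (t * a ^ 4)) * exp (- (r * (x - a))))"
      by (intro mult_right_mono exp_le) auto
    finally show ?thesis by simp
  qed
  have "(\<integral>\<^sup>+x. ennreal (indicator {a..} x * exp (- (t * x ^ 4))) \<partial>lborel)
    \<le> (\<integral>\<^sup>+x. ennreal (3 * exp (- (t * a ^ 4)) * exp (- (r * (x - a)))) * indicator {a..} x \<partial>lborel)"
    by (intro nn_integral_mono) (use le in \<open>auto simp: indicator_def intro!: ennreal_leI\<close>)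
  also have "\<dots> = ennreal (0 - (- (3 * exp (- (t * a ^ 4)) * exp (- (r * (a - a))) / r)))"
    by (rule nn_integral_FTC_atLeast[where F = "\<lambda>s. - (3 * exp (- (t * a ^ 4)) * exp (- (r * (s - a))) / r)"])
       (use r in \<open>auto intro!: derivative_eq_intros simp: field_simps\<close>, real_asymp)
  finally show ?thesis unfolding r(3)[symmetric] by simp
qed

text \<open>The one-dimensional factor of the transform of the weight, at mixing parameter
  \<open>t\<close>.\<close>

definition quartic_ft :: "real \<Rightarrow> real \<Rightarrow> real \<Rightarrow> complex" where
  "quartic_ft a t v = (LINT x|lborel. complex_of_real (indicator {a..} x * exp (- (t * x ^ 4))) * iexp (v * x))"

lemma exp_quartic_tail:
  fixes t a :: real
  assumes "0 < t" "0 \<le> a"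
  shows "integrable lborel (\<lambda>x. indicator {a..} x * exp (- (t * x ^ 4)))"
    and "(LINT x|lborel. indicator {a..} x * exp (- (t * x ^ 4))) \<le> 3 * exp (- (t * a ^ 4)) * t powr (- 1 / 4)"
proof -
  show int: "integrable lborel (\<lambda>x. indicator {a..} x * exp (- (t * x ^ 4)))"
    by (rule integrableI_nonneg)
       (auto intro: le_less_trans[OF exp_quartic_tail_nn_integral_le[OF assms]])
  show "(LINT x|lborel. indicator {a..} x * exp (- (t * x ^ 4))) \<le> 3 * exp (- (t * a ^ 4)) * t powr (- 1 / 4)"
    using exp_quartic_tail_nn_integral_le[OF assms]
    by (subst (asm) nn_integral_eq_integral[OF int]) (auto simp: ennreal_le_iff)
qed

lemma quartic_ft_integrable:
  fixes t a v :: real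
  assumes "0 < t" "0 \<le> a"
  shows "integrable lborel (\<lambda>x. complex_of_real (indicator {a..} x * exp (- (t * x ^ 4))) * iexp (v * x))"
  by (rule Bochner_Integration.integrable_bound[OF exp_quartic_tail(1)[OF assms]])
     (auto simp: norm_mult)

text \<open>The L1 bound, singular as \<open>t\<close> tends to 0, and the oscillatory bound are
  added to give decay in \<open>v\<close> for small and large frequencies at once.\<close>

lemma quartic_ft_bound:
  assumes "0 < t" "0 \<le> a"
  shows "(1 + \<bar>v\<bar>) * cmod (quartic_ft a t v) \<le> exp (- (t * a ^ 4)) * (2 + 3 * t powr (- 1 / 4))"
proof -
  have int: "integrable lborel (\<lambda>x. indicator {a..} x * exp (- (t * x ^ 4)))"
    by (rule exp_quartic_tail[OF assms])
  have "\<bar>v\<bar> * cmod (quartic_ft a t v) \<le> 2 * exp (- (t * a ^ 4))"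
    unfolding quartic_ft_def
  proof (rule cmod_oscillatory_integral_le[where f' = "\<lambda>x. - (4 * t * x ^ 3) * exp (- (t * x ^ 4))", OF _ _ _ _ int])
    show "((\<lambda>x. exp (- (t * x ^ 4))) \<longlongrightarrow> 0) at_top"
      using assms by real_asymp
  qed (use assms in \<open>auto intro!: derivative_eq_intros continuous_intros mult_nonneg_nonneg mult_nonpos_nonneg\<close>)
  moreover have "cmod (quartic_ft a t v) \<le> (LINT x|lborel. indicator {a..} x * exp (- (t * x ^ 4)))"
    unfolding quartic_ft_def
    by (rule order_trans[OF integral_norm_bound]) (simp add: norm_mult)
  ultimately show ?thesis
    using exp_quartic_tail(2)[OF assms] by (simp add: algebra_simps)
qed

text \<open>The integrand is the product of two bounds from \<open>quartic_ft_bound\<close>, with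
  the exponentials merged. At 0 the singularity t^(-1/2) is integrable, at infinity the exponential
  yields 1 / D. Of the constants, 26 is 8 + 18, and 36 is 18 times the integral of t^(-1/2) over the
  unit interval.\<close>

lemma gamma_kernel_nn_integral_le:
  fixes D :: real
  assumes "0 < D"
  shows "(\<integral>\<^sup>+t. ennreal (indicator {0<..} t * (exp (- (t * D)) * (2 + 3 * t powr (- 1 / 4))\<^sup>2)) \<partial>lborel)
    \<le> ennreal (36 * (1 + 1 / D))"
proof -
  have sq: "(2 + 3 * t powr (- 1 / 4))\<^sup>2 \<le> 8 + 18 * t powr (- 1 / 2)" if "t > 0" for t :: real
  proof -
    have "(t powr (- 1 / 4))\<^sup>2 = t powr (- 1 / 2)"
      using that by (simp add: power2_eq_square flip: powr_add)
    moreover have "(2 + 3 * s)\<^sup>2 \<le> 8 + 18 * s\<^sup>2" for s :: real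
      using sum_squares_ge_zero[of "2 - 3 * s" 0] by (simp add: power2_eq_square algebra_simps)
    ultimately show ?thesis by metis
  qed
  \<comment> \<open>Up to 1 the exponential is dropped from the singular term; beyond 1 the power is
    at most 1 and is dropped instead.\<close>
  have le: "indicator {0<..} t * (exp (- (t * D)) * (2 + 3 * t powr (- 1 / 4))\<^sup>2)
      \<le> 26 * exp (- (t * D)) * indicator {0..} t + 18 * t powr (- 1 / 2) * indicator {0<..1} t" for t :: real
  proof (cases "t > 0")
    case t: True
    have "exp (- (t * D)) * (2 + 3 * t powr (- 1 / 4))\<^sup>2 \<le> exp (- (t * D)) * (8 + 18 * t powr (- 1 / 2))"
      using sq[OF t] by (intro mult_left_mono) auto
    moreover have "exp (- (t * D)) \<le> 1" using t assms by auto
    then have "exp (- (t * D)) * t powr (- 1 / 2) \<le> t powr (- 1 / 2)"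
      by (intro mult_left_le_one_le) auto
    moreover have "t powr (- 1 / 2) \<le> 1" if "t > 1"
      using powr_mono[of "- 1 / 2" 0 t] that by simp
    then have "t > 1 \<Longrightarrow> exp (- (t * D)) * t powr (- 1 / 2) \<le> exp (- (t * D))"
      by (intro mult_left_le) auto
    moreover define A B C where "A = exp (- (t * D))" and "B = t powr (- 1 / 2)" and "C = (2 + 3 * t powr (- 1 / 4))\<^sup>2"
    ultimately have "A * C \<le> A * (8 + 18 * B)" "A * B \<le> B" "t > 1 \<Longrightarrow> A * B \<le> A" "0 \<le> A"
      by auto
    then have "A * C \<le> 26 * A * indicator {0..} t + 18 * B * indicator {0<..1} t"
      using t by (cases "t \<le> 1") (auto simp: algebra_simps)
    then show ?thesis using t by (simp add: A_def B_def C_def)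
  qed auto
  have "(\<integral>\<^sup>+t. ennreal (indicator {0<..} t * (exp (- (t * D)) * (2 + 3 * t powr (- 1 / 4))\<^sup>2)) \<partial>lborel)
    \<le> (\<integral>\<^sup>+t. ennreal (26 * exp (- (t * D))) * indicator {0..} t + ennreal (18 * t powr (- 1 / 2)) * indicator {0<..1} t \<partial>lborel)"
  proof (intro nn_integral_mono)
    fix t :: real
    have "ennreal (26 * exp (- (t * D))) * indicator {0..} t + ennreal (18 * t powr (- 1 / 2)) * indicator {0<..1} t
      = ennreal (26 * exp (- (t * D)) * indicator {0..} t + 18 * t powr (- 1 / 2) * indicator {0<..1} t)"
      by (auto simp: indicator_def ennreal_plus[symmetric] simp del: ennreal_plus)
    then show "ennreal (indicator {0<..} t * (exp (- (t * D)) * (2 + 3 * t powr (- 1 / 4))\<^sup>2))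
      \<le> ennreal (26 * exp (- (t * D))) * indicator {0..} t + ennreal (18 * t powr (- 1 / 2)) * indicator {0<..1} t"
      using le[of t] by (simp only: ennreal_leI)
  qed
  also have "\<dots> = (\<integral>\<^sup>+t. ennreal (26 * exp (- (t * D))) * indicator {0..} t \<partial>lborel)
      + (\<integral>\<^sup>+t. ennreal (18 * t powr (- 1 / 2)) * indicator {0<..1} t \<partial>lborel)"
    by (rule nn_integral_add) auto
  also have "(\<integral>\<^sup>+t. ennreal (26 * exp (- (t * D))) * indicator {0..} t \<partial>lborel) = ennreal (0 - (- (26 * exp (- (0 * D)) / D)))"
    by (rule nn_integral_FTC_atLeast[where F = "\<lambda>t. - (26 * exp (- (t * D)) / D)"])
       (use assms in \<open>auto intro!: derivative_eq_intros\<close>, real_asymp)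
  also have "(\<integral>\<^sup>+t. ennreal (18 * t powr (- 1 / 2)) * indicator {0<..1} t \<partial>lborel) = ennreal 36"
  proof -
    have "((\<lambda>t. 18 * t powr (- 1 / 2)) has_integral 36) {0..1::real}"
      using has_integral_mult_right[OF has_integral_powr_from_0[of "- 1 / 2" 1], of 18] by simp
    then have "(\<integral>\<^sup>+t. ennreal (indicator {0..1} t * (18 * t powr (- 1 / 2))) \<partial>lborel) = ennreal 36"
      using nn_integral_has_integral_lebesgue[where f = "\<lambda>t. 18 * t powr (- 1 / 2)" and \<Omega> = "{0..1}" and I = 36] by simp
    moreover have "(\<integral>\<^sup>+t. ennreal (18 * t powr (- 1 / 2)) * indicator {0<..1} t \<partial>lborel)
        = (\<integral>\<^sup>+t. ennreal (indicator {0..1} t * (18 * t powr (- 1 / 2))) \<partial>lborel)"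
      by (intro nn_integral_cong) (auto simp: indicator_def)
    ultimately show ?thesis by simp
  qed
  also have "ennreal (0 - (- (26 * exp (- (0 * D)) / D))) + ennreal 36 = ennreal (26 / D + 36)"
    using assms by (subst ennreal_plus) auto
  also have "\<dots> \<le> ennreal (36 * (1 + 1 / D))"
    using assms by (intro ennreal_leI) (simp add: field_simps)
  finally show ?thesis .
qed

section \<open>Product integrals on the plane and the mixture for the weight\<close>

lemma fst_plane_measurable [measurable]: "fst \<in> borel_measurable (borel :: plane measure)"
  and snd_plane_measurable [measurable]: "snd \<in> borel_measurable (borel :: plane measure)"
  by (auto intro!: borel_measurable_continuous_onI continuous_intros)

lemma nn_integral_lborel_plane_mult:
  fixes f g :: "real \<Rightarrow> ennreal"
  assumes [measurable]: "f \<in> borel_measurable borel" "g \<in> borel_measurable borel"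
  shows "(\<integral>\<^sup>+y. f (fst y) * g (snd y) \<partial>(lborel :: plane measure)) = (\<integral>\<^sup>+x. f x \<partial>lborel) * (\<integral>\<^sup>+x. g x \<partial>lborel)"
proof -
  have "(\<integral>\<^sup>+y. f (fst y) * g (snd y) \<partial>(lborel :: plane measure)) = (\<integral>\<^sup>+x. \<integral>\<^sup>+x'. f x * g x' \<partial>lborel \<partial>lborel)"
    by (subst lborel_prod[symmetric], subst lborel.nn_integral_fst[symmetric]) auto
  then show ?thesis
    by (simp add: nn_integral_cmult nn_integral_multc)
qed

lemma
  fixes f g :: "real \<Rightarrow> complex"
  assumes f: "integrable lborel f" and g: "integrable lborel g"
  shows integrable_lborel_plane_mult: "integrable (lborel :: plane measure) (\<lambda>y. f (fst y) * g (snd y))"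
    and integral_lborel_plane_mult: "(LINT y|(lborel :: plane measure). f (fst y) * g (snd y)) = (LINT x|lborel. f x) * (LINT x|lborel. g x)"
proof -
  have [measurable]: "f \<in> borel_measurable borel" "g \<in> borel_measurable borel"
    using assms by auto
  have fin: "(\<integral>\<^sup>+x. norm (f x) \<partial>lborel) < \<infinity>" "(\<integral>\<^sup>+x. norm (g x) \<partial>lborel) < \<infinity>"
    using assms by (auto simp: integrable_iff_bounded)
  show int: "integrable (lborel :: plane measure) (\<lambda>y. f (fst y) * g (snd y))"
  proof (rule integrableI_bounded)
    have "(\<integral>\<^sup>+y. ennreal (cmod (f (fst y) * g (snd y))) \<partial>(lborel :: plane measure)) =
        (\<integral>\<^sup>+x. norm (f x) \<partial>lborel) * (\<integral>\<^sup>+x. norm (g x) \<partial>lborel)"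
      by (subst nn_integral_lborel_plane_mult[symmetric]) (auto simp: norm_mult ennreal_mult)
    then show "(\<integral>\<^sup>+y. ennreal (cmod (f (fst y) * g (snd y))) \<partial>(lborel :: plane measure)) < \<infinity>"
      using fin by (simp add: ennreal_mult_less_top)
  qed measurable
  have "(LINT x|lborel. (LINT y|lborel. f x * g y)) = (LINT y|(lborel \<Otimes>\<^sub>M lborel). f (fst y) * g (snd y))"
    using lborel_pair.integral_fst'[of "\<lambda>y. f (fst y) * g (snd y)"] int by (simp add: lborel_prod)
  then show "(LINT y|(lborel :: plane measure). f (fst y) * g (snd y)) = (LINT x|lborel. f x) * (LINT x|lborel. g x)"
    by (simp add: lborel_prod)
qed

lemma nn_integral_exp_halfline:
  fixes s :: real
  assumes "0 < s"
  shows "(\<integral>\<^sup>+t. ennreal (indicator {0<..} t * exp (- (t * s))) \<partial>lborel) = ennreal (1 / s)"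
proof -
  have "(\<integral>\<^sup>+t. ennreal (exp (- (t * s))) * indicator {0..} t \<partial>lborel) = ennreal (0 - (- (exp (- (0 * s)) / s)))"
    by (rule nn_integral_FTC_atLeast[where F = "\<lambda>t. - (exp (- (t * s)) / s)"])
       (use assms in \<open>auto intro!: derivative_eq_intros\<close>, real_asymp)
  also have "(\<integral>\<^sup>+t. ennreal (exp (- (t * s))) * indicator {0..} t \<partial>lborel) = (\<integral>\<^sup>+t. ennreal (indicator {0<..} t * exp (- (t * s))) \<partial>lborel)"
    by (rule nn_integral_cong_AE) (use AE_lborel_singleton[of 0] in \<open>auto simp: indicator_def elim!: eventually_mono\<close>)
  finally show ?thesis by simp
qed

lemma weight_measurable [measurable]: "weight a b \<in> borel_measurable borel"
proof -
  have [measurable]: "{a..} \<times> {b..} \<in> sets (borel :: plane measure)"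
    by (intro borel_closed closed_Times) auto
  show ?thesis unfolding weight_def[abs_def] by measurable
qed

text \<open>One of \<open>a\<close> and \<open>b\<close> may vanish: the exponentials of the two
  factors combine to exp (- t (a^4 + b^4)), for which a positive sum is enough. Integrability and
  the bound for the transform come from the same kernel in \<open>t\<close>.\<close>

lemma
  assumes ab: "0 \<le> a" "0 \<le> b" and D: "0 < a ^ 4 + b ^ 4"
  shows integrable_weight: "integrable lborel (weight a b)"
    and fourier_weight_bound: "cmod (fourier (\<lambda>y. complex_of_real (weight a b y)) u)
      \<le> 36 * (1 + 1 / (a ^ 4 + b ^ 4)) / ((1 + \<bar>fst u\<bar>) * (1 + \<bar>snd u\<bar>))"
proof -
  define q where "q a t x = indicator {a..} x * exp (- (t * x ^ 4))" for a t x :: real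
  define F where "F y t = indicator {0<..} t * (q a t (fst y) * q b t (snd y))" for y :: plane and t :: real
  have [measurable]: "(\<lambda>x. q a (t x) (g x)) \<in> borel_measurable M" if "t \<in> borel_measurable M" "g \<in> borel_measurable M" for M a t g
    using that unfolding q_def by measurable
  have F_nonneg: "0 \<le> F y t" for y t by (simp add: F_def q_def)
  have F_le: "(\<integral>\<^sup>+y. ennreal (F y t) \<partial>lborel) \<le> ennreal (indicator {0<..} t * (exp (- (t * (a ^ 4 + b ^ 4))) * (2 + 3 * t powr (- 1 / 4))\<^sup>2))" for t
  proof (cases "0 < t")
    case t: True
    let ?r = "t powr (- 1 / 4)"
    have "(\<integral>\<^sup>+y. ennreal (F y t) \<partial>lborel) = (\<integral>\<^sup>+y. ennreal (q a t (fst y)) * ennreal (q b t (snd y)) \<partial>(lborel :: plane measure))"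
      using t by (intro nn_integral_cong) (auto simp: F_def ennreal_mult q_def)
    also have "\<dots> = (\<integral>\<^sup>+x. ennreal (q a t x) \<partial>lborel) * (\<integral>\<^sup>+x. ennreal (q b t x) \<partial>lborel)"
      by (rule nn_integral_lborel_plane_mult) auto
    also have "\<dots> \<le> ennreal (3 * exp (- (t * a ^ 4)) * ?r) * ennreal (3 * exp (- (t * b ^ 4)) * ?r)"
      unfolding q_def by (intro mult_mono exp_quartic_tail_nn_integral_le t ab) auto
    also have "\<dots> = ennreal (exp (- (t * (a ^ 4 + b ^ 4))) * (3 * ?r)\<^sup>2)"
      by (simp add: ennreal_mult[symmetric] exp_add[symmetric] algebra_simps power2_eq_square mult_exp_exp)
    \<comment> \<open>Weakening \<open>3 * ?r\<close> to \<open>2 + 3 * ?r\<close> produces the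
      kernel that also bounds the transform below.\<close>
    also have "\<dots> \<le> ennreal (exp (- (t * (a ^ 4 + b ^ 4))) * (2 + 3 * ?r)\<^sup>2)"
      by (intro ennreal_leI mult_left_mono power_mono) auto
    finally show ?thesis using t by simp
  qed (simp add: F_def)
  have fin: "(\<integral>\<^sup>+t. \<integral>\<^sup>+y. ennreal (F y t) \<partial>lborel \<partial>lborel) < \<infinity>"
    by (rule le_less_trans[OF order_trans[OF nn_integral_mono[OF F_le] gamma_kernel_nn_integral_le[OF D]]]) simp
  have weight_nn: "(\<integral>\<^sup>+t. ennreal (F y t) \<partial>lborel) = ennreal (weight a b y)" for y
  proof (cases "a \<le> fst y \<and> b \<le> snd y")
    case True
    define s where "s = fst y ^ 4 + snd y ^ 4"
    have "a ^ 4 + b ^ 4 \<le> s"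
      using True ab unfolding s_def by (intro add_mono power_mono) auto
    then have s: "0 < s" using D by simp
    have "(\<integral>\<^sup>+t. ennreal (F y t) \<partial>lborel) = (\<integral>\<^sup>+t. ennreal (indicator {0<..} t * exp (- (t * s))) \<partial>lborel)"
      using True by (intro nn_integral_cong) (auto simp: F_def q_def s_def algebra_simps mult_exp_exp)
    then show ?thesis
      using nn_integral_exp_halfline[OF s] True by (cases y) (simp add: weight_def s_def indicator_def)
  next
    case False
    then have "F y t = 0" for t by (auto simp: F_def q_def)
    then show ?thesis using False by (cases y) (auto simp: weight_def indicator_def)
  qed
  define G where "G y t = complex_of_real (F y t) * iexp (u \<bullet> y)" for y t
  have [measurable]: "case_prod F \<in> borel_measurable (lborel \<Otimes>\<^sub>M lborel)"
    unfolding F_def by measurable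
  have [measurable]: "case_prod G \<in> borel_measurable (lborel \<Otimes>\<^sub>M lborel)"
    unfolding G_def by measurable
  have fin': "(\<integral>\<^sup>+y. \<integral>\<^sup>+t. ennreal (F y t) \<partial>lborel \<partial>lborel) < \<infinity>"
    using fin by (subst lborel_pair.Fubini') auto
  have intG: "integrable (lborel \<Otimes>\<^sub>M lborel) (case_prod G)"
  proof (rule integrableI_bounded)
    have "(\<integral>\<^sup>+z. ennreal (norm (case_prod G z)) \<partial>(lborel \<Otimes>\<^sub>M lborel)) = (\<integral>\<^sup>+y. \<integral>\<^sup>+t. ennreal (F y t) \<partial>lborel \<partial>lborel)"
      by (subst lborel.nn_integral_fst[symmetric]) (auto simp: G_def norm_mult F_nonneg)
    then show "(\<integral>\<^sup>+z. ennreal (norm (case_prod G z)) \<partial>(lborel \<Otimes>\<^sub>M lborel)) < \<infinity>"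
      using fin' by simp
  qed measurable
  have weight_nonneg: "0 \<le> weight a b y" for y by (simp add: weight_def)
  show "integrable lborel (weight a b)"
    by (rule integrableI_nonneg) (use fin' weight_nonneg in \<open>auto simp: weight_nn\<close>)
  have int_F: "(LINT t|lborel. F y t) = weight a b y" for y
    using weight_nn[of y] weight_nonneg[of y] F_nonneg by (subst integral_eq_nn_integral) (auto simp: F_def)
  have "fourier (\<lambda>y. complex_of_real (weight a b y)) u = (LINT y|lborel. iexp (u \<bullet> y) * complex_of_real (weight a b y))"
    unfolding fourier_def by (rule integral_completion) auto
  also have "\<dots> = (LINT y|lborel. (LINT t|lborel. G y t))"
    by (simp add: G_def int_F mult.commute)
  also have "\<dots> = (LINT t|lborel. (LINT y|lborel. G y t))"
    by (rule lborel_pair.Fubini_integral[symmetric, OF intG])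
  also have "\<dots> = (LINT t|lborel. indicator {0<..} t *\<^sub>R (quartic_ft a t (fst u) * quartic_ft b t (snd u)))"
  proof (intro Bochner_Integration.integral_cong refl)
    fix t :: real
    show "(LINT y|lborel. G y t) = indicator {0<..} t *\<^sub>R (quartic_ft a t (fst u) * quartic_ft b t (snd u))"
    proof (cases "0 < t")
      case t: True
      have "(LINT y|lborel. G y t) = (LINT y|(lborel :: plane measure). (complex_of_real (q a t (fst y)) * iexp (fst u * fst y)) *
          (complex_of_real (q b t (snd y)) * iexp (snd u * snd y)))"
        using t by (intro Bochner_Integration.integral_cong)
          (auto simp: G_def F_def inner_prod_def distrib_left exp_add)
      also have "\<dots> = quartic_ft a t (fst u) * quartic_ft b t (snd u)"
        unfolding quartic_ft_def q_def
        by (rule integral_lborel_plane_mult) (intro quartic_ft_integrable t ab)+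
      finally show ?thesis using t by simp
    qed (simp add: G_def F_def)
  qed
  finally have eq: "fourier (\<lambda>y. complex_of_real (weight a b y)) u
    = (LINT t|lborel. indicator {0<..} t *\<^sub>R (quartic_ft a t (fst u) * quartic_ft b t (snd u)))" .
  define W where "W = (1 + \<bar>fst u\<bar>) * (1 + \<bar>snd u\<bar>)"
  define k where "k t = indicator {0<..} t * (exp (- (t * (a ^ 4 + b ^ 4))) * (2 + 3 * t powr (- 1 / 4))\<^sup>2)" for t :: real
  have W: "W > 0" unfolding W_def by (intro mult_pos_pos) auto
  have k_nn: "(\<integral>\<^sup>+t. ennreal (k t) \<partial>lborel) \<le> ennreal (36 * (1 + 1 / (a ^ 4 + b ^ 4)))"
    unfolding k_def by (rule gamma_kernel_nn_integral_le[OF D])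
  have k_int: "integrable lborel k"
  proof (rule integrableI_nonneg)
    show "k \<in> borel_measurable lborel" unfolding k_def by measurable
    show "(\<integral>\<^sup>+t. ennreal (k t) \<partial>lborel) < \<infinity>" by (rule le_less_trans[OF k_nn]) simp
  qed (auto simp: k_def)
  have k_le: "(LINT t|lborel. k t) \<le> 36 * (1 + 1 / (a ^ 4 + b ^ 4))"
  proof -
    have "0 \<le> k t" for t by (simp add: k_def)
    then have "ennreal (LINT t|lborel. k t) \<le> ennreal (36 * (1 + 1 / (a ^ 4 + b ^ 4)))"
      using k_nn by (simp add: nn_integral_eq_integral[OF k_int])
    then show ?thesis using D by (subst (asm) ennreal_le_iff) auto
  qed
  \<comment> \<open>The decay factor is moved under the integral, where it is shared between the two
    one-dimensional factors.\<close>
  have "W * cmod (fourier (\<lambda>y. complex_of_real (weight a b y)) u)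
     = cmod (LINT t|lborel. W *\<^sub>R (indicator {0<..} t *\<^sub>R (quartic_ft a t (fst u) * quartic_ft b t (snd u))))"
    unfolding eq using W by (simp del: scaleR_scaleR)
  also have "\<dots> \<le> (LINT t|lborel. k t)"
  proof (rule integral_norm_bound_integral')
    show "integrable lborel k" by (rule k_int)
    show "norm (W *\<^sub>R (indicator {0<..} t *\<^sub>R (quartic_ft a t (fst u) * quartic_ft b t (snd u)))) \<le> k t" for t
    proof (cases "0 < t")
      case t: True
      have "((1 + \<bar>fst u\<bar>) * cmod (quartic_ft a t (fst u))) * ((1 + \<bar>snd u\<bar>) * cmod (quartic_ft b t (snd u)))
        \<le> (exp (- (t * a ^ 4)) * (2 + 3 * t powr (- 1 / 4))) * (exp (- (t * b ^ 4)) * (2 + 3 * t powr (- 1 / 4)))"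
        by (intro mult_mono quartic_ft_bound t ab mult_nonneg_nonneg) auto
      also have "\<dots> = exp (- (t * (a ^ 4 + b ^ 4))) * (2 + 3 * t powr (- 1 / 4))\<^sup>2"
        by (simp add: power2_eq_square distrib_left exp_add exp_diff exp_minus field_simps)
      finally show ?thesis
        using t W by (simp add: k_def norm_mult W_def mult_ac)
    qed (simp add: k_def)
  qed
  also note k_le
  finally show "cmod (fourier (\<lambda>y. complex_of_real (weight a b y)) u)
      \<le> 36 * (1 + 1 / (a ^ 4 + b ^ 4)) / ((1 + \<bar>fst u\<bar>) * (1 + \<bar>snd u\<bar>))"
    using W unfolding W_def[symmetric] by (simp add: pos_le_divide_eq mult.commute)
qed

section \<open>Parseval's identity for a finite measure\<close>

text \<open>Transforms are defined with the completed measure; for Borel integrands this passes to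
  \<open>lborel\<close>, where Fubini's theorem is applied.\<close>

lemma fourier_eq_lborel:
  assumes "f \<in> borel_measurable borel"
  shows "fourier f u = (LINT x|lborel. iexp (u \<bullet> x) * f x)"
  unfolding fourier_def using assms by (intro integral_completion) measurable

lemma integral_gaussian_iexp:
  "integrable lborel (\<lambda>v :: real. complex_of_real (exp (- v\<^sup>2 / 2)) * iexp (t * v))"
  "(LINT v|lborel. complex_of_real (exp (- v\<^sup>2 / 2)) * iexp (t * v)) = complex_of_real (sqrt (2 * pi) * exp (- t\<^sup>2 / 2))"
proof -
  have int: "integrable lborel (\<lambda>v :: real. exp (- v\<^sup>2 / 2))"
    using integrable_mult_right[OF integrable_normal_density[of 1 0], of "sqrt (2 * pi)"]
    by (simp add: normal_density_def)
  show "integrable lborel (\<lambda>v :: real. complex_of_real (exp (- v\<^sup>2 / 2)) * iexp (t * v))"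
    by (rule Bochner_Integration.integrable_bound[OF int]) (auto simp: norm_mult)
  have "exp (- t\<^sup>2 / 2) = char std_normal_distribution t"
    by (simp add: char_std_normal_distribution)
  also have "\<dots> = (LINT v|lborel. std_normal_density v *\<^sub>R iexp (t * v))"
    unfolding char_def by (rule integral_density) auto
  also have "\<dots> = (LINT v|lborel. complex_of_real (1 / sqrt (2 * pi)) * (complex_of_real (exp (- v\<^sup>2 / 2)) * iexp (t * v)))"
    by (intro Bochner_Integration.integral_cong) (auto simp: std_normal_density_def scaleR_conv_of_real mult.assoc)
  also have "\<dots> = complex_of_real (1 / sqrt (2 * pi)) * (LINT v|lborel. complex_of_real (exp (- v\<^sup>2 / 2)) * iexp (t * v))"
    by simp
  finally show "(LINT v|lborel. complex_of_real (exp (- v\<^sup>2 / 2)) * iexp (t * v)) = complex_of_real (sqrt (2 * pi) * exp (- t\<^sup>2 / 2))"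
    by (simp add: field_simps)
qed

text \<open>Left unnormalised: its total mass and the factor by which the Fourier transform
  reproduces it are both 2 pi.\<close>

definition gauss :: "plane \<Rightarrow> real" where
  "gauss z = exp (- (z \<bullet> z) / 2)"

lemma gauss_measurable [measurable]: "gauss \<in> borel_measurable borel"
  unfolding gauss_def by measurable

lemma gauss_bounds: "0 < gauss z" "gauss z \<le> 1"
  by (auto simp: gauss_def)

lemma gauss_fourier:
  "integrable lborel (\<lambda>z. complex_of_real (gauss z) * iexp (w \<bullet> z))"
  "(LINT z|lborel. complex_of_real (gauss z) * iexp (w \<bullet> z)) = complex_of_real (2 * pi * gauss w)"
proof -
  let ?g = "\<lambda>t v :: real. complex_of_real (exp (- v\<^sup>2 / 2)) * iexp (t * v)"
  have gauss_eq: "gauss z = exp (- (fst z)\<^sup>2 / 2) * exp (- (snd z)\<^sup>2 / 2)" for z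
    by (simp add: gauss_def inner_prod_def power2_eq_square mult_exp_exp diff_divide_distrib)
  have eq: "complex_of_real (gauss z) * iexp (w \<bullet> z) = ?g (fst w) (fst z) * ?g (snd w) (snd z)" for z
    by (simp add: gauss_eq inner_prod_def distrib_left exp_add)
  show "integrable lborel (\<lambda>z. complex_of_real (gauss z) * iexp (w \<bullet> z))"
    unfolding eq by (rule integrable_lborel_plane_mult) (rule integral_gaussian_iexp)+
  have "(LINT z|lborel. complex_of_real (gauss z) * iexp (w \<bullet> z)) =
      complex_of_real (sqrt (2 * pi) * exp (- (fst w)\<^sup>2 / 2)) * complex_of_real (sqrt (2 * pi) * exp (- (snd w)\<^sup>2 / 2))"
    unfolding eq by (subst integral_lborel_plane_mult[OF integral_gaussian_iexp(1) integral_gaussian_iexp(1)])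
      (simp only: integral_gaussian_iexp(2))
  also have "\<dots> = complex_of_real ((sqrt (2 * pi) * sqrt (2 * pi)) * gauss w)"
    unfolding gauss_eq of_real_mult by (simp only: mult_ac)
  also have "sqrt (2 * pi) * sqrt (2 * pi) = 2 * pi" by simp
  finally show "(LINT z|lborel. complex_of_real (gauss z) * iexp (w \<bullet> z)) = complex_of_real (2 * pi * gauss w)" .
qed

lemma integrable_gauss: "integrable lborel gauss"
  using gauss_fourier(1)[of 0] by (simp add: complex_of_real_integrable_eq)

lemma integral_lborel_plane_affine:
  fixes f :: "plane \<Rightarrow> complex"
  assumes [measurable]: "f \<in> borel_measurable borel" and c: "c \<noteq> 0"
  shows "(LINT y|lborel. f y) = complex_of_real (c\<^sup>2) * (LINT z|lborel. f (t + c *\<^sub>R z))"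
proof -
  have "(LINT y|lborel. f y) = (LINT y|density (distr lborel borel (\<lambda>x. t + c *\<^sub>R x)) (\<lambda>_. ennreal (\<bar>c\<bar> ^ DIM(plane))). f y)"
    by (subst lborel_affine[OF c, of t]) simp
  also have "\<dots> = (LINT y|distr lborel borel (\<lambda>x. t + c *\<^sub>R x). c\<^sup>2 *\<^sub>R f y)"
    by (subst integral_density) (auto simp: power2_eq_square)
  also have "\<dots> = (LINT z|lborel. c\<^sup>2 *\<^sub>R f (t + c *\<^sub>R z))"
    by (subst integral_distr) auto
  finally show ?thesis by (simp add: scaleR_conv_of_real)
qed

lemma gauss_scaled_fourier:
  assumes \<sigma>: "0 < \<sigma>"
  shows "(LINT u|lborel. complex_of_real (gauss (\<sigma> *\<^sub>R u)) * iexp (u \<bullet> w)) = complex_of_real (2 * pi / \<sigma>\<^sup>2 * gauss ((1 / \<sigma>) *\<^sub>R w))"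
proof -
  have "(LINT u|lborel. complex_of_real (gauss (\<sigma> *\<^sub>R u)) * iexp (u \<bullet> w)) =
      complex_of_real ((1 / \<sigma>)\<^sup>2) * (LINT z|lborel. complex_of_real (gauss (\<sigma> *\<^sub>R (0 + (1 / \<sigma>) *\<^sub>R z))) * iexp ((0 + (1 / \<sigma>) *\<^sub>R z) \<bullet> w))"
    by (rule integral_lborel_plane_affine) (use \<sigma> in auto)
  also have "(\<lambda>z. complex_of_real (gauss (\<sigma> *\<^sub>R (0 + (1 / \<sigma>) *\<^sub>R z))) * iexp ((0 + (1 / \<sigma>) *\<^sub>R z) \<bullet> w)) =
      (\<lambda>z. complex_of_real (gauss z) * iexp (((1 / \<sigma>) *\<^sub>R w) \<bullet> z))"
    using \<sigma> by (simp add: fun_eq_iff inner_commute)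
  also have "complex_of_real ((1 / \<sigma>)\<^sup>2) * (LINT z|lborel. complex_of_real (gauss z) * iexp (((1 / \<sigma>) *\<^sub>R w) \<bullet> z)) =
      complex_of_real (2 * pi / \<sigma>\<^sup>2 * gauss ((1 / \<sigma>) *\<^sub>R w))"
    unfolding gauss_fourier(2) by (simp add: power_divide)
  finally show ?thesis .
qed

lemma integrable_gauss_scaled:
  assumes \<sigma>: "0 < \<sigma>"
  shows "integrable lborel (\<lambda>u. gauss (\<sigma> *\<^sub>R u))"
proof -
  have "(lborel :: plane measure) = density (distr lborel borel (\<lambda>x. 0 + (1 / \<sigma>) *\<^sub>R x)) (\<lambda>_. ennreal (\<bar>1 / \<sigma>\<bar> ^ DIM(plane)))"
    using \<sigma> by (intro lborel_affine) simp
  moreover have "integrable (density (distr lborel borel (\<lambda>x. 0 + (1 / \<sigma>) *\<^sub>R x)) (\<lambda>_. ennreal (\<bar>1 / \<sigma>\<bar> ^ DIM(plane)))) (\<lambda>u. gauss (\<sigma> *\<^sub>R u))"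
    using \<sigma> integrable_gauss by (simp add: integrable_density integrable_distr_eq)
  ultimately show ?thesis by metis
qed

text \<open>Smoothing by a Gaussian of width \<open>\<sigma>\<close> multiplies the integrand on the Fourier side by a Gaussian,
  which makes all the integrals absolutely convergent.\<close>
lemma parseval_gauss:
  fixes \<mu> :: "plane measure" and g :: "plane \<Rightarrow> real"
  assumes sets [measurable_cong]: "sets \<mu> = sets borel" and "finite_measure \<mu>"
    and int_g: "integrable lborel g" and \<sigma>: "0 < \<sigma>"
  shows "(LINT u|lborel. complex_of_real (gauss (\<sigma> *\<^sub>R u)) * (fourier (\<lambda>y. complex_of_real (g y)) (- u) * fourier_measure \<mu> u))
    = complex_of_real (2 * pi * (LINT x|\<mu>. LINT z|lborel. g (x + \<sigma> *\<^sub>R z) * gauss z))"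
proof -
  interpret \<mu>: finite_measure \<mu> by fact
  interpret L\<mu>: pair_sigma_finite lborel \<mu> ..
  have g_meas [measurable]: "g \<in> borel_measurable borel" using int_g by auto
  let ?k = "\<lambda>u. complex_of_real (gauss (\<sigma> *\<^sub>R u))"
  let ?g = "\<lambda>u. LINT y|lborel. iexp ((- u) \<bullet> y) * complex_of_real (g y)"
  have g_le: "cmod (?g u) \<le> (LINT y|lborel. \<bar>g y\<bar>)" for u
    by (rule order_trans[OF integral_norm_bound]) (simp add: norm_mult)
  have [measurable]: "?g \<in> borel_measurable borel"
    by measurable
  have [measurable]: "fst \<in> borel_measurable (lborel \<Otimes>\<^sub>M \<mu>)" by measurable
  have int_k: "integrable lborel (\<lambda>u. gauss (\<sigma> *\<^sub>R u))"
    by (rule integrable_gauss_scaled[OF \<sigma>])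
  have "(LINT u|lborel. ?k u * (fourier (\<lambda>y. complex_of_real (g y)) (- u) * fourier_measure \<mu> u))
      = (LINT u|lborel. LINT x|\<mu>. ?k u * (?g u * iexp (u \<bullet> x)))"
    unfolding fourier_measure_def by (subst fourier_eq_lborel) (auto simp: mult.assoc)
  also have "\<dots> = (LINT x|\<mu>. LINT u|lborel. ?k u * (?g u * iexp (u \<bullet> x)))"
  proof (rule L\<mu>.Fubini_integral[symmetric])
    show "integrable (lborel \<Otimes>\<^sub>M \<mu>) (\<lambda>(u, x). ?k u * (?g u * iexp (u \<bullet> x)))"
    proof (rule L\<mu>.Fubini_integrable)
      have "integrable lborel (\<lambda>u. measure \<mu> (space \<mu>) * (gauss (\<sigma> *\<^sub>R u) * cmod (?g u)))"
        by (intro integrable_mult_right Bochner_Integration.integrable_bound[OF integrable_mult_right[OF int_k, of "LINT y|lborel. \<bar>g y\<bar>"]])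
           (use g_le in \<open>auto simp: abs_mult gauss_def mult.commute intro!: mult_mono order_trans[OF _ abs_ge_self]\<close>)
      moreover have "(\<lambda>u. LINT x|\<mu>. norm (case (u, x) of (u, x) \<Rightarrow> ?k u * (?g u * iexp (u \<bullet> x)))) =
          (\<lambda>u. measure \<mu> (space \<mu>) * (gauss (\<sigma> *\<^sub>R u) * cmod (?g u)))"
        by (rule ext) (simp add: norm_mult abs_of_pos[OF gauss_bounds(1)])
      ultimately show "integrable lborel (\<lambda>u. LINT x|\<mu>. norm (case (u, x) of (u, x) \<Rightarrow> ?k u * (?g u * iexp (u \<bullet> x))))"
        by (simp only:)
      show "AE u in lborel. integrable \<mu> (\<lambda>x. case (u, x) of (u, x) \<Rightarrow> ?k u * (?g u * iexp (u \<bullet> x)))"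
      proof (rule AE_I2)
        fix u :: plane
        have "integrable \<mu> (\<lambda>x. iexp (u \<bullet> x))"
          by (rule \<mu>.integrable_const_bound[of _ 1]) auto
        then show "integrable \<mu> (\<lambda>x. case (u, x) of (u, x) \<Rightarrow> ?k u * (?g u * iexp (u \<bullet> x)))"
          by simp
      qed
    qed measurable
  qed
  also have "\<dots> = (LINT x|\<mu>. complex_of_real (2 * pi) * (LINT z|lborel. complex_of_real (g (x + \<sigma> *\<^sub>R z) * gauss z)))"
  proof (intro Bochner_Integration.integral_cong refl)
    fix x
    have "(LINT u|lborel. ?k u * (?g u * iexp (u \<bullet> x))) = (LINT u|lborel. LINT y|lborel. complex_of_real (g y) * (?k u * iexp (u \<bullet> (x - y))))"
    proof (intro Bochner_Integration.integral_cong refl)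
      fix u :: plane
      have "?k u * (?g u * iexp (u \<bullet> x)) = (?k u * iexp (u \<bullet> x)) * ?g u" by (simp only: mult_ac)
      also have "\<dots> = (LINT y|lborel. (?k u * iexp (u \<bullet> x)) * (iexp ((- u) \<bullet> y) * complex_of_real (g y)))"
        by (rule integral_mult_right_zero[symmetric])
      also have "\<dots> = (LINT y|lborel. complex_of_real (g y) * (?k u * iexp (u \<bullet> (x - y))))"
        by (intro Bochner_Integration.integral_cong refl)
           (simp add: inner_diff_right right_diff_distrib exp_diff exp_minus divide_inverse mult_ac)
      finally show "?k u * (?g u * iexp (u \<bullet> x)) = (LINT y|lborel. complex_of_real (g y) * (?k u * iexp (u \<bullet> (x - y))))" .
    qed
    also have "\<dots> = (LINT y|lborel. LINT u|lborel. complex_of_real (g y) * (?k u * iexp (u \<bullet> (x - y))))"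
    proof (rule lborel_pair.Fubini_integral[symmetric])
      show "integrable (lborel \<Otimes>\<^sub>M lborel) (\<lambda>(u, y). complex_of_real (g y) * (?k u * iexp (u \<bullet> (x - y))))"
      proof (rule lborel_pair.Fubini_integrable)
        have "integrable lborel (\<lambda>u. (LINT y|lborel. \<bar>g y\<bar>) * gauss (\<sigma> *\<^sub>R u))"
          by (intro integrable_mult_right int_k)
        then show "integrable lborel (\<lambda>u. LINT y|lborel. norm (case (u, y) of (u, y) \<Rightarrow> complex_of_real (g y) * (?k u * iexp (u \<bullet> (x - y)))))"
          by (simp add: norm_mult gauss_def)
        show "AE u in lborel. integrable lborel (\<lambda>y. case (u, y) of (u, y) \<Rightarrow> complex_of_real (g y) * (?k u * iexp (u \<bullet> (x - y))))"
          by (intro AE_I2, rule Bochner_Integration.integrable_bound[OF int_g])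
             (use gauss_bounds in \<open>auto simp: norm_mult abs_of_pos intro!: mult_left_le\<close>)
      qed measurable
    qed
    also have "\<dots> = (LINT y|lborel. complex_of_real (g y * (2 * pi / \<sigma>\<^sup>2 * gauss ((1 / \<sigma>) *\<^sub>R (x - y)))))"
      unfolding integral_mult_right_zero gauss_scaled_fourier[OF \<sigma>] by simp
    \<comment> \<open>Substituting y = x + \<sigma> z: the Jacobian \<sigma>^2 cancels against the
      transform of the scaled Gaussian.\<close>
    also have "\<dots> = complex_of_real (\<sigma>\<^sup>2) * (LINT z|lborel. complex_of_real (g (x + \<sigma> *\<^sub>R z) * (2 * pi / \<sigma>\<^sup>2 * gauss ((1 / \<sigma>) *\<^sub>R (x - (x + \<sigma> *\<^sub>R z))))))"
      by (rule integral_lborel_plane_affine) (use \<sigma> in auto)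
    also have "\<dots> = (LINT z|lborel. complex_of_real (\<sigma>\<^sup>2) * complex_of_real (g (x + \<sigma> *\<^sub>R z) * (2 * pi / \<sigma>\<^sup>2 * gauss ((1 / \<sigma>) *\<^sub>R (x - (x + \<sigma> *\<^sub>R z))))))"
      by (rule integral_mult_right_zero[symmetric])
    also have "\<dots> = (LINT z|lborel. complex_of_real (2 * pi) * complex_of_real (g (x + \<sigma> *\<^sub>R z) * gauss z))"
      using \<sigma> by (intro Bochner_Integration.integral_cong refl) (simp add: gauss_def field_simps)
    also have "\<dots> = complex_of_real (2 * pi) * (LINT z|lborel. complex_of_real (g (x + \<sigma> *\<^sub>R z) * gauss z))"
      by (rule integral_mult_right_zero)
    finally show "(LINT u|lborel. ?k u * (?g u * iexp (u \<bullet> x))) = complex_of_real (2 * pi) * (LINT z|lborel. complex_of_real (g (x + \<sigma> *\<^sub>R z) * gauss z))" .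
  qed
  also have "\<dots> = complex_of_real (2 * pi * (LINT x|\<mu>. LINT z|lborel. g (x + \<sigma> *\<^sub>R z) * gauss z))"
    unfolding integral_mult_right_zero integral_complex_of_real by (simp only: of_real_mult)
  finally show ?thesis .
qed

lemma integral_gauss: "(LINT z|lborel. gauss z) = 2 * pi"
proof -
  have "complex_of_real (LINT z|lborel. gauss z) = complex_of_real (2 * pi)"
    using gauss_fourier(2)[of 0] by (simp add: gauss_def)
  then show ?thesis by (simp only: of_real_eq_iff)
qed

text \<open>The width of the Gaussian tends to 0. On the frequency side the assumed integrable
  product dominates; on the other side \<open>g\<close> is bounded and continuous at \<mu>-almost
  every point. Continuity everywhere would be too much to ask, as the weight jumps at the edges of
  its quadrant.\<close>

lemma parseval_measure:
  fixes \<mu> :: "plane measure" and g :: "plane \<Rightarrow> real"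
  assumes sets [measurable_cong]: "sets \<mu> = sets borel" and "finite_measure \<mu>"
    and int_g: "integrable lborel g" and g_le: "\<And>x. \<bar>g x\<bar> \<le> B"
    and cont: "AE x in \<mu>. isCont g x"
    and int: "integrable lborel (\<lambda>u. fourier (\<lambda>y. complex_of_real (g y)) (- u) * fourier_measure \<mu> u)"
  shows "(LINT u|lborel. fourier (\<lambda>y. complex_of_real (g y)) (- u) * fourier_measure \<mu> u)
    = complex_of_real ((2 * pi)\<^sup>2 * (LINT x|\<mu>. g x))"
proof -
  interpret \<mu>: finite_measure \<mu> by fact
  have g_meas [measurable]: "g \<in> borel_measurable borel" using int_g by auto
  let ?F = "\<lambda>u. fourier (\<lambda>y. complex_of_real (g y)) (- u) * fourier_measure \<mu> u"
  let ?s = "\<lambda>i. 1 / real (Suc i)"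
  have s: "?s \<longlonglongrightarrow> 0" by (rule LIMSEQ_Suc[OF lim_1_over_n])
  have isc_gauss: "isCont gauss z" for z unfolding gauss_def by (intro continuous_intros) auto
  have B: "0 \<le> B" using g_le[of 0] by linarith
  have "(\<lambda>i. LINT u|lborel. complex_of_real (gauss (?s i *\<^sub>R u)) * ?F u) \<longlonglongrightarrow> (LINT u|lborel. ?F u)"
  proof (rule integral_dominated_convergence[where w = "\<lambda>u. norm (?F u)"])
    show "AE u in lborel. (\<lambda>i. complex_of_real (gauss (?s i *\<^sub>R u)) * ?F u) \<longlonglongrightarrow> ?F u"
    proof (rule AE_I2)
      fix u :: plane
      have "(\<lambda>i. gauss (?s i *\<^sub>R u)) \<longlonglongrightarrow> gauss (0 *\<^sub>R u)"
        by (rule isCont_tendsto_compose[OF isc_gauss]) (intro tendsto_intros s)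
      then have "(\<lambda>i. complex_of_real (gauss (?s i *\<^sub>R u)) * ?F u) \<longlonglongrightarrow> complex_of_real (gauss (0 *\<^sub>R u)) * ?F u"
        by (intro tendsto_intros)
      then show "(\<lambda>i. complex_of_real (gauss (?s i *\<^sub>R u)) * ?F u) \<longlonglongrightarrow> ?F u"
        by (simp add: gauss_def)
    qed
    show "AE u in lborel. norm (complex_of_real (gauss (?s i *\<^sub>R u)) * ?F u) \<le> norm (?F u)" for i
      using gauss_bounds by (intro AE_I2) (simp add: norm_mult mult_left_le_one_le abs_of_pos less_imp_le)
  qed (use int borel_measurable_integrable[OF int] in auto)
  moreover have "(\<lambda>i. complex_of_real (2 * pi * (LINT x|\<mu>. LINT z|lborel. g (x + ?s i *\<^sub>R z) * gauss z)))
    \<longlonglongrightarrow> complex_of_real (2 * pi * (LINT x|\<mu>. LINT z|lborel. g x * gauss z))"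
  proof (intro tendsto_intros integral_dominated_convergence[where w = "\<lambda>_. B * (2 * pi)"])
    show "AE x in \<mu>. (\<lambda>i. LINT z|lborel. g (x + ?s i *\<^sub>R z) * gauss z) \<longlonglongrightarrow> (LINT z|lborel. g x * gauss z)"
      using cont
    proof eventually_elim
      case (elim x)
      show ?case
      proof (rule integral_dominated_convergence[where w = "\<lambda>z. B * gauss z"])
        show "integrable lborel (\<lambda>z. B * gauss z)" by (intro integrable_mult_right integrable_gauss)
        show "AE z in lborel. (\<lambda>i. g (x + ?s i *\<^sub>R z) * gauss z) \<longlonglongrightarrow> g x * gauss z"
        proof (rule AE_I2)
          fix z :: plane
          have "(\<lambda>i. x + ?s i *\<^sub>R z) \<longlonglongrightarrow> x + 0 *\<^sub>R z" by (intro tendsto_intros s)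
          then have "(\<lambda>i. g (x + ?s i *\<^sub>R z)) \<longlonglongrightarrow> g x"
            using isCont_tendsto_compose[OF elim, of "\<lambda>i. x + ?s i *\<^sub>R z"] by simp
          then show "(\<lambda>i. g (x + ?s i *\<^sub>R z) * gauss z) \<longlonglongrightarrow> g x * gauss z"
            by (intro tendsto_intros)
        qed
        show "AE z in lborel. norm (g (x + ?s i *\<^sub>R z) * gauss z) \<le> B * gauss z" for i
          using gauss_bounds by (intro AE_I2) (simp add: abs_mult abs_of_pos g_le mult_right_mono less_imp_le)
      qed measurable
    qed
    show "AE x in \<mu>. norm (LINT z|lborel. g (x + ?s i *\<^sub>R z) * gauss z) \<le> B * (2 * pi)" for i
    proof (rule AE_I2)
      fix x
      have "norm (LINT z|lborel. g (x + ?s i *\<^sub>R z) * gauss z) \<le> (LINT z|lborel. B * gauss z)"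
        by (rule integral_norm_bound_integral')
           (use gauss_bounds in \<open>auto simp: abs_mult abs_of_pos g_le mult_right_mono less_imp_le intro!: integrable_gauss integrable_mult_right\<close>)
      then show "norm (LINT z|lborel. g (x + ?s i *\<^sub>R z) * gauss z) \<le> B * (2 * pi)"
        by (simp add: integral_gauss)
    qed
  qed measurable
  ultimately have "(LINT u|lborel. ?F u) = complex_of_real (2 * pi * (LINT x|\<mu>. LINT z|lborel. g x * gauss z))"
    using parseval_gauss[OF assms(1-3)] by (intro LIMSEQ_unique) auto
  also have "\<dots> = complex_of_real ((2 * pi)\<^sup>2 * (LINT x|\<mu>. g x))"
    by (simp add: integral_gauss power2_eq_square)
  finally show ?thesis .
qed

section \<open>Derivatives of the logarithm of a characteristic function\<close>

text \<open>What the \<open>j\<close>-th derivative of the transform in direction \<open>e\<close>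
  becomes when taken under the integral sign.\<close>

definition fourier_moment :: "plane measure \<Rightarrow> plane \<Rightarrow> nat \<Rightarrow> plane \<Rightarrow> complex" where
  "fourier_moment M e j u = (LINT x|M. (\<i> * complex_of_real (e \<bullet> x)) ^ j * iexp (u \<bullet> x))"

lemma fourier_moment_0: "fourier_moment M e 0 = fourier_measure M"
  by (simp add: fourier_moment_def fourier_measure_def fun_eq_iff)

lemma partial_eqI:
  assumes "((\<lambda>s. f (u + s *\<^sub>R e)) has_vector_derivative d) (at 0)"
  shows "partial e f u = d"
  unfolding partial_def using assms by (rule vector_derivative_at)

lemma norm_iexp_diff_le: "cmod (iexp s - 1) \<le> \<bar>s\<bar>"
  using iexp_approx1[of s 0] by simp

text \<open>Difference quotients are the form to which dominated convergence applies.\<close>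

lemma has_vector_derivative_at_0_iff:
  "(f has_vector_derivative d) (at (0 :: real)) \<longleftrightarrow> ((\<lambda>s. (f s - f 0) /\<^sub>R s) \<longlongrightarrow> d) (at 0)"
proof -
  have eq: "norm (f (0 + h) - f 0 - h *\<^sub>R d) / norm h = norm ((f h - f 0) /\<^sub>R h - d)" if "h \<noteq> 0" for h
  proof -
    have "(f h - f 0) /\<^sub>R h - d = (f h - f 0 - h *\<^sub>R d) /\<^sub>R h"
      using that by (simp add: scaleR_diff_right)
    then show ?thesis by (simp add: divide_inverse mult.commute)
  qed
  have "(f has_vector_derivative d) (at 0) \<longleftrightarrow> ((\<lambda>h. norm (f (0 + h) - f 0 - h *\<^sub>R d) / norm h) \<longlongrightarrow> 0) (at 0)"
    unfolding has_vector_derivative_def has_derivative_at by (auto intro: bounded_linear_scaleR_left)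
  also have "\<dots> \<longleftrightarrow> ((\<lambda>h. norm ((f h - f 0) /\<^sub>R h - d)) \<longlongrightarrow> 0) (at 0)"
    by (rule filterlim_cong[OF refl refl]) (simp add: eventually_at_filter eq[simplified])
  also have "\<dots> \<longleftrightarrow> ((\<lambda>s. (f s - f 0) /\<^sub>R s) \<longlongrightarrow> d) (at 0)"
    using Lim_null[of "\<lambda>s. (f s - f 0) /\<^sub>R s" d "at 0"] tendsto_norm_zero_iff by metis
  finally show ?thesis .
qed

text \<open>Differentiation under the integral sign: since |exp (i s) - 1| <= |s|, the difference
  quotients are dominated by the next absolute moment.\<close>

lemma fourier_moment_has_derivative:
  fixes M :: "plane measure"
  assumes sets [measurable_cong]: "sets M = sets borel"
    and int: "integrable M (\<lambda>x. \<bar>e \<bullet> x\<bar> ^ j)" and int': "integrable M (\<lambda>x. \<bar>e \<bullet> x\<bar> ^ Suc j)"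
  shows "((\<lambda>s. fourier_moment M e j (u + s *\<^sub>R e)) has_vector_derivative fourier_moment M e (Suc j) u) (at 0)"
proof -
  have [measurable]: "(\<lambda>x. v \<bullet> x) \<in> borel_measurable M" for v
    unfolding measurable_cong_sets[OF sets refl]
    by (intro borel_measurable_continuous_onI continuous_intros)
  let ?h = "\<lambda>s x. (\<i> * complex_of_real (e \<bullet> x)) ^ j * iexp ((u + s *\<^sub>R e) \<bullet> x)"
  have int_h: "integrable M (?h s)" for s
    by (rule Bochner_Integration.integrable_bound[OF int]) (auto simp: norm_mult norm_power)
  let ?q = "\<lambda>s x. (?h s x - ?h 0 x) /\<^sub>R s"
  have q: "((\<lambda>s. LINT x|M. ?q s x) \<longlongrightarrow> (LINT x|M. (\<i> * complex_of_real (e \<bullet> x)) ^ Suc j * iexp (u \<bullet> x))) (at 0)"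
    unfolding tendsto_at_iff_sequentially comp_def
  proof (intro allI impI)
    fix S :: "nat \<Rightarrow> real" assume S: "\<forall>i. S i \<in> UNIV - {0}" "S \<longlonglongrightarrow> 0"
    show "(\<lambda>i. LINT x|M. ?q (S i) x) \<longlonglongrightarrow> (LINT x|M. (\<i> * complex_of_real (e \<bullet> x)) ^ Suc j * iexp (u \<bullet> x))"
    proof (rule integral_dominated_convergence[OF _ _ int'])
      show "AE x in M. (\<lambda>i. ?q (S i) x) \<longlonglongrightarrow> (\<i> * complex_of_real (e \<bullet> x)) ^ Suc j * iexp (u \<bullet> x)"
      proof (rule AE_I2)
        fix x
        have "((\<lambda>s. ?q s x) \<longlongrightarrow> (\<i> * complex_of_real (e \<bullet> x)) ^ Suc j * iexp (u \<bullet> x)) (at 0)"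
        proof -
          let ?c = "(\<i> * complex_of_real (e \<bullet> x)) ^ j * iexp (u \<bullet> x)"
          have "((\<lambda>s. ?c * exp (s *\<^sub>R (\<i> * complex_of_real (e \<bullet> x)))) has_vector_derivative
              ?c * (exp (0 *\<^sub>R (\<i> * complex_of_real (e \<bullet> x))) * (\<i> * complex_of_real (e \<bullet> x)))) (at 0)"
            by (intro has_vector_derivative_mult_right exp_scaleR_has_vector_derivative_right)
          moreover have "(\<lambda>s. ?c * exp (s *\<^sub>R (\<i> * complex_of_real (e \<bullet> x)))) = (\<lambda>s. ?h s x)"
            by (simp add: fun_eq_iff inner_add_left distrib_left exp_add scaleR_conv_of_real mult_ac)
          ultimately have "((\<lambda>s. ?h s x) has_vector_derivative (\<i> * complex_of_real (e \<bullet> x)) ^ Suc j * iexp (u \<bullet> x)) (at 0)"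
            by (simp add: mult_ac)
          then show ?thesis unfolding has_vector_derivative_at_0_iff .
        qed
        then show "(\<lambda>i. ?q (S i) x) \<longlonglongrightarrow> (\<i> * complex_of_real (e \<bullet> x)) ^ Suc j * iexp (u \<bullet> x)"
          using S unfolding tendsto_at_iff_sequentially comp_def by blast
      qed
      show "AE x in M. norm (?q (S i) x) \<le> \<bar>e \<bullet> x\<bar> ^ Suc j" for i
      proof (rule AE_I2)
        fix x
        have "?h (S i) x - ?h 0 x = (\<i> * complex_of_real (e \<bullet> x)) ^ j * iexp (u \<bullet> x) * (iexp (S i * (e \<bullet> x)) - 1)"
          by (simp add: inner_add_left distrib_left exp_add algebra_simps)
        then have "norm (?q (S i) x) = \<bar>e \<bullet> x\<bar> ^ j * cmod (iexp (S i * (e \<bullet> x)) - 1) / \<bar>S i\<bar>"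
          by (simp add: norm_mult norm_power divide_inverse)
        also have "\<dots> \<le> \<bar>e \<bullet> x\<bar> ^ j * \<bar>S i * (e \<bullet> x)\<bar> / \<bar>S i\<bar>"
          by (intro divide_right_mono mult_left_mono norm_iexp_diff_le) auto
        finally show "norm (?q (S i) x) \<le> \<bar>e \<bullet> x\<bar> ^ Suc j"
          using S by (simp add: abs_mult mult_ac)
      qed
    qed measurable
  qed
  show ?thesis
  proof -
    have eq: "(\<lambda>s. LINT x|M. ?q s x) = (\<lambda>s. (fourier_moment M e j (u + s *\<^sub>R e) - fourier_moment M e j (u + 0 *\<^sub>R e)) /\<^sub>R s)"
      unfolding fourier_moment_def using int_h int_h[of 0]
      by (intro ext) (simp only: integral_scaleR_right Bochner_Integration.integral_diff)
    show ?thesis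
      using q[unfolded eq] unfolding has_vector_derivative_at_0_iff fourier_moment_def[of M e "Suc j" u] .
  qed
qed

lemma partial_iterate_fourier_measure:
  fixes M :: "plane measure"
  assumes "sets M = sets borel" and int: "\<And>i. i \<le> j \<Longrightarrow> integrable M (\<lambda>x. \<bar>e \<bullet> x\<bar> ^ i)"
  shows "(partial e ^^ j) (fourier_measure M) = fourier_moment M e j"
  using int
proof (induction j)
  case (Suc j)
  then have "(partial e ^^ Suc j) (fourier_measure M) = partial e (fourier_moment M e j)"
    by simp
  also have "\<dots> = fourier_moment M e (Suc j)"
    by (rule ext, rule partial_eqI, rule fourier_moment_has_derivative) (use assms(1) Suc.prems[of j] Suc.prems[of "Suc j"] in auto)
  finally show ?case .
qed (simp add: fourier_moment_0)

lemma partial_iterate_emp_cf: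
  "(partial e ^^ j) (emp_cf x n) =
    (\<lambda>u. (\<Sum>t = 1..n. (\<i> * complex_of_real (e \<bullet> (x t - x (t - 1)))) ^ j * iexp (u \<bullet> (x t - x (t - 1)))) / of_nat n)"
proof (induction j)
  case (Suc j)
  show ?case
  proof (simp only: funpow.simps(2) comp_def Suc.IH, rule ext, rule partial_eqI)
    fix u
    let ?z = "\<lambda>t. x t - x (t - 1)"
    let ?c = "\<lambda>t. (\<i> * complex_of_real (e \<bullet> ?z t)) ^ j * iexp (u \<bullet> ?z t)"
    have "((\<lambda>s. (\<Sum>t = 1..n. ?c t * exp (s *\<^sub>R (\<i> * complex_of_real (e \<bullet> ?z t)))) * inverse (of_nat n)) has_vector_derivative
       (\<Sum>t = 1..n. ?c t * (exp (0 *\<^sub>R (\<i> * complex_of_real (e \<bullet> ?z t))) * (\<i> * complex_of_real (e \<bullet> ?z t)))) * inverse (of_nat n)) (at 0)"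
      by (intro has_vector_derivative_mult_left has_vector_derivative_sum has_vector_derivative_mult_right
          exp_scaleR_has_vector_derivative_right)
    moreover have "(\<lambda>s. (\<Sum>t = 1..n. ?c t * exp (s *\<^sub>R (\<i> * complex_of_real (e \<bullet> ?z t)))) * inverse (of_nat n)) =
      (\<lambda>s. (\<Sum>t = 1..n. (\<i> * complex_of_real (e \<bullet> ?z t)) ^ j * iexp ((u + s *\<^sub>R e) \<bullet> ?z t)) / of_nat n)"
      by (simp add: fun_eq_iff inner_add_left distrib_left exp_add scaleR_conv_of_real divide_inverse mult_ac)
    ultimately show "((\<lambda>s. (\<Sum>t = 1..n. (\<i> * complex_of_real (e \<bullet> ?z t)) ^ j * iexp ((u + s *\<^sub>R e) \<bullet> ?z t)) / of_nat n) has_vector_derivative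
       (\<Sum>t = 1..n. (\<i> * complex_of_real (e \<bullet> ?z t)) ^ Suc j * iexp (u \<bullet> ?z t)) / of_nat n) (at 0)"
      by (simp add: divide_inverse mult_ac)
  qed
qed (simp add: emp_cf_def fun_eq_iff)

text \<open>\<open>log_deriv4\<close> expresses the fourth derivative of a logarithm through
  derivatives of the function, just as the fourth cumulant is expressed through moments. Here the
  logarithm is the explicit exponent, in which the drift is linear and so disappears.\<close>

lemma log_deriv4_cpp_cf:
  fixes \<nu> :: "plane measure"
  assumes sets: "sets \<nu> = sets borel" and "finite_measure \<nu>"
    and int: "\<And>i. i \<le> 4 \<Longrightarrow> integrable \<nu> (\<lambda>x. \<bar>e \<bullet> x\<bar> ^ i)"
  shows "log_deriv4 e (cpp_cf \<alpha> \<nu> 1) u = fourier_moment \<nu> e 4 u"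
proof -
  interpret finite_measure \<nu> by fact
  let ?\<phi> = "cpp_cf \<alpha> \<nu> 1" and ?a = "fourier_moment \<nu> e"
  \<comment> \<open>\<open>b\<close> is the first derivative of the exponent; the next ones are
    \<open>?a 2\<close>, \<open>?a 3\<close> and \<open>?a 4\<close>.\<close>
  define b where "b u = \<i> * complex_of_real (e \<bullet> \<alpha>) + ?a 1 u" for u
  have a_deriv: "((\<lambda>s. ?a j (u + s *\<^sub>R e)) has_vector_derivative ?a (Suc j) u) (at 0)" if "Suc j \<le> 4" for j u
    using that by (intro fourier_moment_has_derivative sets int) auto
  have b_deriv: "((\<lambda>s. b (u + s *\<^sub>R e)) has_vector_derivative ?a 2 u) (at 0)" for u
    unfolding b_def using a_deriv[of 1 u] by (auto intro!: derivative_eq_intros simp: numeral_2_eq_2)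
  have [measurable]: "(\<lambda>x. v \<bullet> x) \<in> borel_measurable \<nu>" for v
    unfolding measurable_cong_sets[OF sets refl]
    by (intro borel_measurable_continuous_onI continuous_intros)
  have int_iexp: "integrable \<nu> (\<lambda>x. iexp (v \<bullet> x))" for v
    by (rule integrable_const_bound[of _ 1]) auto
  have phi_eq: "?\<phi> v = exp (\<i> * complex_of_real (v \<bullet> \<alpha>) + (?a 0 v - measure \<nu> (space \<nu>)))" for v
    using int_iexp[of v] by (simp add: cpp_cf_def fourier_moment_def scaleR_conv_of_real)
  have phi_deriv: "((\<lambda>s. ?\<phi> (u + s *\<^sub>R e)) has_vector_derivative b u * ?\<phi> u) (at 0)" for u
  proof -
    have "((\<lambda>s. \<i> * complex_of_real ((u + s *\<^sub>R e) \<bullet> \<alpha>) + (?a 0 (u + s *\<^sub>R e) - measure \<nu> (space \<nu>))) has_vector_derivative b u) (at 0)"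
      unfolding b_def using a_deriv[of 0 u]
      by (auto intro!: derivative_eq_intros simp: inner_add_left)
    then have "((exp \<circ> (\<lambda>s. \<i> * complex_of_real ((u + s *\<^sub>R e) \<bullet> \<alpha>) + (?a 0 (u + s *\<^sub>R e) - measure \<nu> (space \<nu>)))) has_vector_derivative b u * ?\<phi> u) (at 0)"
      by (rule field_vector_diff_chain_at) (auto simp: phi_eq intro!: derivative_eq_intros)
    then show ?thesis by (simp add: comp_def phi_eq)
  qed
  \<comment> \<open>The derivatives of the exponential are \<open>?\<phi>\<close> times the complete
    Bell polynomials in \<open>b\<close>, \<open>?a 2\<close>, \<open>?a 3\<close>,
    \<open>?a 4\<close>.\<close>
  have d1: "(partial e ^^ 1) ?\<phi> = (\<lambda>u. b u * ?\<phi> u)"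
    by (auto simp: fun_eq_iff intro!: partial_eqI phi_deriv)
  have d2: "(partial e ^^ 2) ?\<phi> = (\<lambda>u. (?a 2 u + b u ^ 2) * ?\<phi> u)"
  proof -
    have "(partial e ^^ 2) ?\<phi> = partial e (\<lambda>u. b u * ?\<phi> u)"
      using d1 by (simp add: numeral_2_eq_2)
    also have "\<dots> = (\<lambda>u. (?a 2 u + b u ^ 2) * ?\<phi> u)"
      by (rule ext, rule partial_eqI, rule has_vector_derivative_eq_rhs[OF has_vector_derivative_mult[OF b_deriv phi_deriv]])
         (simp add: algebra_simps power2_eq_square)
    finally show ?thesis .
  qed
  have d3: "(partial e ^^ 3) ?\<phi> = (\<lambda>u. (?a 3 u + 3 * b u * ?a 2 u + b u ^ 3) * ?\<phi> u)"
  proof -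
    have "(partial e ^^ 3) ?\<phi> = partial e (\<lambda>u. (?a 2 u + b u * b u) * ?\<phi> u)"
      using d2 by (simp add: numeral_3_eq_3 numeral_2_eq_2)
    also have "\<dots> = (\<lambda>u. (?a 3 u + 3 * b u * ?a 2 u + b u ^ 3) * ?\<phi> u)"
      by (rule ext, rule partial_eqI, rule has_vector_derivative_eq_rhs[OF has_vector_derivative_mult[OF has_vector_derivative_add[OF a_deriv has_vector_derivative_mult[OF b_deriv b_deriv]] phi_deriv]])
         (simp_all add: algebra_simps power2_eq_square power3_eq_cube numeral_3_eq_3[symmetric])
    finally show ?thesis .
  qed
  have d4: "(partial e ^^ 4) ?\<phi> = (\<lambda>u. (?a 4 u + 4 * b u * ?a 3 u + 3 * ?a 2 u ^ 2 + 6 * b u ^ 2 * ?a 2 u + b u ^ 4) * ?\<phi> u)"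
  proof -
    have "(partial e ^^ 4) ?\<phi> = partial e (\<lambda>u. (?a 3 u + 3 * (b u * ?a 2 u) + b u * (b u * b u)) * ?\<phi> u)"
      using d3 by (simp add: eval_nat_numeral mult.assoc)
    also have "\<dots> = (\<lambda>u. (?a 4 u + 4 * b u * ?a 3 u + 3 * ?a 2 u ^ 2 + 6 * b u ^ 2 * ?a 2 u + b u ^ 4) * ?\<phi> u)"
    proof (rule ext, rule partial_eqI)
      fix u
      have a2: "((\<lambda>s. ?a 2 (u + s *\<^sub>R e)) has_vector_derivative ?a 3 u) (at 0)"
        and a3: "((\<lambda>s. ?a 3 (u + s *\<^sub>R e)) has_vector_derivative ?a 4 u) (at 0)"
        using a_deriv[of 2 u] a_deriv[of 3 u] by (simp_all add: eval_nat_numeral)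
      note bb = has_vector_derivative_mult[OF b_deriv[of u] has_vector_derivative_mult[OF b_deriv[of u] b_deriv[of u]]]
      note ba = has_vector_derivative_mult_right[OF has_vector_derivative_mult[OF b_deriv[of u] a2], of 3]
      show "((\<lambda>s. (?a 3 (u + s *\<^sub>R e) + 3 * (b (u + s *\<^sub>R e) * ?a 2 (u + s *\<^sub>R e)) + b (u + s *\<^sub>R e) * (b (u + s *\<^sub>R e) * b (u + s *\<^sub>R e))) * ?\<phi> (u + s *\<^sub>R e))
        has_vector_derivative (?a 4 u + 4 * b u * ?a 3 u + 3 * ?a 2 u ^ 2 + 6 * b u ^ 2 * ?a 2 u + b u ^ 4) * ?\<phi> u) (at 0)"
        by (rule has_vector_derivative_eq_rhs[OF has_vector_derivative_mult[OF has_vector_derivative_add[OF has_vector_derivative_add[OF a3 ba] bb] phi_deriv]])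
           (simp add: algebra_simps power2_eq_square power4_eq_xxxx)
    qed
    finally show ?thesis .
  qed
  have nz: "?\<phi> u \<noteq> 0" by (simp add: phi_eq)
  have r: "x * y / y = x" "x * y * (z * y) / y\<^sup>2 = x * z" "(x * y)\<^sup>2 * (z * y) / y ^ 3 = x\<^sup>2 * z" if "y \<noteq> 0" for x y z :: complex
    using that by (auto simp: power2_eq_square power3_eq_cube)
  show ?thesis
    unfolding log_deriv4_def Let_def d1 d2 d3 d4 r[OF nz]
    by (simp add: algebra_simps power2_eq_square power3_eq_cube power4_eq_xxxx)
qed

text \<open>A product rule for errors measured in multiples of a common unit \<open>d\<close>, which
  keeps the constants of nested products explicit.\<close>

lemma norm_mult_diff_le:
  fixes x y x' y' :: "'a :: real_normed_algebra"
  assumes "norm (x - x') \<le> a * d" "norm (y - y') \<le> b * d" "norm x' \<le> A" "norm y \<le> B" "0 \<le> A" "0 \<le> B"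
  shows "norm (x * y - x' * y') \<le> (a * B + A * b) * d"
proof -
  have "x * y - x' * y' = (x - x') * y + x' * (y - y')"
    by (simp add: algebra_simps)
  then have "norm (x * y - x' * y') \<le> norm ((x - x') * y) + norm (x' * (y - y'))"
    by (metis norm_triangle_ineq)
  also have "\<dots> \<le> norm (x - x') * norm y + norm x' * norm (y - y')"
    by (intro add_mono norm_mult_ineq)
  also have "\<dots> \<le> (a * d) * B + A * (b * d)"
    using assms by (intro add_mono mult_mono) (auto intro: order_trans[OF norm_ge_zero])
  finally show ?thesis by (simp add: algebra_simps)
qed

text \<open>\<open>log_deriv4\<close> is a polynomial of degree four in the quotients of the
  derivatives by the function. These are bounded by \<open>m / c\<close>, and corresponding ones
  differ by at most \<open>m / c\<^sup>2\<close> times the sum of the differences. Replacing one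
  factor of a monomial at a time leaves at most the third power of \<open>m / c\<close>.\<close>

lemma log_deriv4_perturbation:
  assumes c: "0 < c" "c \<le> 1" and m: "1 \<le> m"
    and low: "c \<le> cmod (f u)" "c \<le> cmod (g u)"
    and up: "\<And>j. j \<le> 4 \<Longrightarrow> cmod ((partial e ^^ j) f u) \<le> m" "\<And>j. j \<le> 4 \<Longrightarrow> cmod ((partial e ^^ j) g u) \<le> m"
  shows "cmod (log_deriv4 e f u - log_deriv4 e g u)
    \<le> 75 * m ^ 4 / c ^ 5 * (\<Sum>j\<le>4. cmod ((partial e ^^ j) f u - (partial e ^^ j) g u))"
proof -
  define p where "p j = (partial e ^^ j) f u" for j
  define q where "q j = (partial e ^^ j) g u" for j
  define S where "S = (\<Sum>j\<le>4. cmod (p j - q j))"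
  define E where "E = m / c\<^sup>2 * S"
  define \<rho> where "\<rho> = m / c"
  define r where "r j = p j / p 0" for j
  define t where "t j = q j / q 0" for j
  have p0: "p 0 = f u" "q 0 = g u" by (auto simp: p_def q_def)
  have S: "0 \<le> S" unfolding S_def by (intro sum_nonneg) auto
  have E: "0 \<le> E" unfolding E_def using S c m by simp
  have \<rho>: "1 \<le> \<rho>" unfolding \<rho>_def using c m by (simp add: field_simps)
  have nz: "p 0 \<noteq> 0" "q 0 \<noteq> 0" using low c by (auto simp: p0)
  have r_le: "cmod (r j) \<le> \<rho>" "cmod (t j) \<le> \<rho>" if "j \<le> 4" for j
    unfolding r_def t_def \<rho>_def norm_divide using up[OF that] low c m
    by (auto simp: p0 p_def q_def intro!: frac_le)
  have diff: "cmod (r j - t j) \<le> 1 * E" if "1 \<le> j" "j \<le> 4" for j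
  proof -
    \<comment> \<open>Separates the error of the numerator from that of the denominator.\<close>
    have "r j - t j = (p j - q j) / p 0 + q j * (q 0 - p 0) / (p 0 * q 0)"
      using nz by (simp add: r_def t_def field_simps)
    then have "cmod (r j - t j) \<le> cmod ((p j - q j) / p 0) + cmod (q j * (q 0 - p 0) / (p 0 * q 0))"
      by (metis norm_triangle_ineq)
    also have "\<dots> = cmod (p j - q j) / cmod (p 0) + cmod (q j) * cmod (q 0 - p 0) / (cmod (p 0) * cmod (q 0))"
      by (simp add: norm_divide norm_mult)
    also have "\<dots> \<le> cmod (p j - q j) / c + m * cmod (q 0 - p 0) / (c * c)"
      using up(2)[OF that(2)] low c m
      by (intro add_mono frac_le mult_mono) (auto simp: p0 q_def)
    also have "cmod (p j - q j) / c \<le> m / c\<^sup>2 * cmod (p j - q j)"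
    proof -
      have "1 / c \<le> m / c\<^sup>2"
        using c m by (simp add: power2_eq_square divide_simps mult_le_one order_trans[of c 1 m])
      from mult_right_mono[OF this norm_ge_zero[of "p j - q j"]] show ?thesis by simp
    qed
    also have "m / c\<^sup>2 * cmod (p j - q j) + m * cmod (q 0 - p 0) / (c * c) = m / c\<^sup>2 * (cmod (p j - q j) + cmod (p 0 - q 0))"
      by (simp add: power2_eq_square norm_minus_commute algebra_simps)
    also have "\<dots> \<le> m / c\<^sup>2 * S"
    proof (rule mult_left_mono)
      have "cmod (p j - q j) + cmod (p 0 - q 0) = (\<Sum>i\<in>{j, 0}. cmod (p i - q i))"
        using that by simp
      also have "\<dots> \<le> S"
        unfolding S_def using that by (intro sum_mono2) auto
      finally show "cmod (p j - q j) + cmod (p 0 - q 0) \<le> S" .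
    qed (use c m in auto)
    finally show ?thesis by (simp add: E_def)
  qed
  have R: "log_deriv4 e f u = r 4 - 4 * (r 1 * r 3) - 3 * (r 2 * r 2) + 12 * ((r 1 * r 1) * r 2) - 6 * ((r 1 * r 1) * (r 1 * r 1))"
    unfolding log_deriv4_def Let_def p_def[symmetric] p0[symmetric] r_def using nz
    by (simp add: power2_eq_square power3_eq_cube power4_eq_xxxx mult.assoc)
  have T: "log_deriv4 e g u = t 4 - 4 * (t 1 * t 3) - 3 * (t 2 * t 2) + 12 * ((t 1 * t 1) * t 2) - 6 * ((t 1 * t 1) * (t 1 * t 1))"
    unfolding log_deriv4_def Let_def q_def[symmetric] p0[symmetric] t_def using nz
    by (simp add: power2_eq_square power3_eq_cube power4_eq_xxxx mult.assoc)
  have sq: "cmod (r 1 * r 1) \<le> \<rho> * \<rho>" "cmod (t 1 * t 1) \<le> \<rho> * \<rho>"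
    unfolding norm_mult using \<rho> by (intro mult_mono r_le; simp)+
  have 13: "cmod (r 1 * r 3 - t 1 * t 3) \<le> (1 * \<rho> + \<rho> * 1) * E"
    using \<rho> by (intro norm_mult_diff_le diff r_le) auto
  have 22: "cmod (r 2 * r 2 - t 2 * t 2) \<le> (1 * \<rho> + \<rho> * 1) * E"
    using \<rho> by (intro norm_mult_diff_le diff r_le) auto
  have 11: "cmod (r 1 * r 1 - t 1 * t 1) \<le> (1 * \<rho> + \<rho> * 1) * E"
    using \<rho> by (intro norm_mult_diff_le diff r_le) auto
  have 112: "cmod ((r 1 * r 1) * r 2 - (t 1 * t 1) * t 2) \<le> ((1 * \<rho> + \<rho> * 1) * \<rho> + (\<rho> * \<rho>) * 1) * E"
    using \<rho> by (intro norm_mult_diff_le 11 diff r_le sq) auto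
  have 1111: "cmod ((r 1 * r 1) * (r 1 * r 1) - (t 1 * t 1) * (t 1 * t 1))
      \<le> ((1 * \<rho> + \<rho> * 1) * (\<rho> * \<rho>) + (\<rho> * \<rho>) * (1 * \<rho> + \<rho> * 1)) * E"
    using \<rho> by (intro norm_mult_diff_le 11 sq) auto
  have diff_eq: "log_deriv4 e f u - log_deriv4 e g u = (r 4 - t 4) - 4 * (r 1 * r 3 - t 1 * t 3) - 3 * (r 2 * r 2 - t 2 * t 2)
      + 12 * ((r 1 * r 1) * r 2 - (t 1 * t 1) * t 2) - 6 * ((r 1 * r 1) * (r 1 * r 1) - (t 1 * t 1) * (t 1 * t 1))"
    unfolding R T by (simp add: algebra_simps)
  have "cmod (log_deriv4 e f u - log_deriv4 e g u) \<le> cmod (r 4 - t 4) + 4 * cmod (r 1 * r 3 - t 1 * t 3) + 3 * cmod (r 2 * r 2 - t 2 * t 2)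
      + 12 * cmod ((r 1 * r 1) * r 2 - (t 1 * t 1) * t 2) + 6 * cmod ((r 1 * r 1) * (r 1 * r 1) - (t 1 * t 1) * (t 1 * t 1))"
  proof -
    have tri: "cmod (x1 - 4 * x2 - 3 * x3 + 12 * x4 - 6 * x5) \<le> cmod x1 + 4 * cmod x2 + 3 * cmod x3 + 12 * cmod x4 + 6 * cmod x5"
      for x1 x2 x3 x4 x5 :: complex
      using norm_triangle_ineq4[of "x1 - 4 * x2 - 3 * x3 + 12 * x4" "6 * x5"] norm_triangle_ineq[of "x1 - 4 * x2 - 3 * x3" "12 * x4"]
        norm_triangle_ineq4[of "x1 - 4 * x2" "3 * x3"] norm_triangle_ineq4[of "x1" "4 * x2"]
      by (simp add: norm_mult)
    show ?thesis unfolding diff_eq by (rule tri)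
  qed
  \<comment> \<open>Each monomial contributes its coefficient times its number of factors: 1, 4 * 2,
    3 * 2, 12 * 3 and 6 * 4, which add up to 75.\<close>
  also have "\<dots> \<le> (1 + 8 * \<rho> + 6 * \<rho> + 36 * \<rho>\<^sup>2 + 24 * \<rho> ^ 3) * E"
  proof -
    have eqs: "(1 * \<rho> + \<rho> * 1) * E = 2 * \<rho> * E" "((1 * \<rho> + \<rho> * 1) * \<rho> + (\<rho> * \<rho>) * 1) * E = 3 * \<rho>\<^sup>2 * E"
      "((1 * \<rho> + \<rho> * 1) * (\<rho> * \<rho>) + (\<rho> * \<rho>) * (1 * \<rho> + \<rho> * 1)) * E = 4 * \<rho> ^ 3 * E"
      by (simp_all add: power2_eq_square power3_eq_cube algebra_simps)
    have "(1 + 8 * \<rho> + 6 * \<rho> + 36 * \<rho>\<^sup>2 + 24 * \<rho> ^ 3) * E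
        = 1 * E + 4 * (2 * \<rho> * E) + 3 * (2 * \<rho> * E) + 12 * (3 * \<rho>\<^sup>2 * E) + 6 * (4 * \<rho> ^ 3 * E)"
      by (simp add: distrib_right)
    then show ?thesis
      using diff[of 4] 13 22 112 1111 unfolding eqs by linarith
  qed
  also have "\<dots> \<le> (75 * \<rho> ^ 3) * E"
  proof (rule mult_right_mono[OF _ E])
    have "1 \<le> \<rho> ^ 3" "\<rho> ^ 1 \<le> \<rho> ^ 3" "\<rho>\<^sup>2 \<le> \<rho> ^ 3"
      using \<rho> power_increasing[of 1 3 \<rho>] power_increasing[of 2 3 \<rho>] by auto
    then show "1 + 8 * \<rho> + 6 * \<rho> + 36 * \<rho>\<^sup>2 + 24 * \<rho> ^ 3 \<le> 75 * \<rho> ^ 3" by simp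
  qed
  also have "\<dots> = 75 * m ^ 4 / c ^ 5 * S"
    by (simp add: \<rho>_def E_def power_divide eval_nat_numeral)
  finally show ?thesis by (simp add: S_def p_def q_def)
qed

section \<open>Error of the smoothed tail integral\<close>

text \<open>The decay shared by the transform of the weight and, by assumption, by that of the
  quartic measure. Its square is integrable over the plane; the function itself is integrable only
  over boxes, with logarithmic growth.\<close>

definition freq_weight :: "plane \<Rightarrow> real" where
  "freq_weight u = 1 / ((1 + \<bar>fst u\<bar>) * (1 + \<bar>snd u\<bar>))"

lemma freq_weight_measurable [measurable]: "freq_weight \<in> borel_measurable borel"
  unfolding freq_weight_def[abs_def] by measurable

lemma freq_weight_bounds: "0 < freq_weight u" "freq_weight u \<le> 1"
proof -
  have "1 \<le> (1 + \<bar>fst u\<bar>) * (1 + \<bar>snd u\<bar>)" by (intro mult_ge1_I) auto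
  then show "0 < freq_weight u" "freq_weight u \<le> 1" by (auto simp: freq_weight_def)
qed

lemma freq_weight_minus [simp]: "freq_weight (- u) = freq_weight u"
  by (simp add: freq_weight_def)

section \<open>Integrals of the decay profile\<close>

lemma nn_integral_abs:
  fixes f :: "real \<Rightarrow> ennreal"
  assumes [measurable]: "f \<in> borel_measurable borel"
  shows "(\<integral>\<^sup>+v. f \<bar>v\<bar> \<partial>lborel) = 2 * (\<integral>\<^sup>+v. f v * indicator {0..} v \<partial>lborel)"
proof -
  have "(\<integral>\<^sup>+v. f \<bar>v\<bar> \<partial>lborel) = (\<integral>\<^sup>+v. f v * indicator {0..} v + f (- v) * indicator {0..} (- v) \<partial>lborel)"
    by (rule nn_integral_cong_AE) (use AE_lborel_singleton[of 0] in \<open>auto simp: indicator_def elim!: eventually_mono\<close>)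
  also have "\<dots> = (\<integral>\<^sup>+v. f v * indicator {0..} v \<partial>lborel) + (\<integral>\<^sup>+v. f (- v) * indicator {0..} (- v) \<partial>lborel)"
    by (rule nn_integral_add) auto
  also have "(\<integral>\<^sup>+v. f (- v) * indicator {0..} (- v) \<partial>lborel) = (\<integral>\<^sup>+v. f v * indicator {0..} v \<partial>lborel)"
    using nn_integral_real_affine[of "\<lambda>v. f v * indicator {0..} v" "-1" 0] by simp
  finally show ?thesis by (simp add: mult_2)
qed

lemma nn_integral_inverse_square_abs:
  assumes "0 \<le> R"
  shows "(\<integral>\<^sup>+v. ennreal (indicator {R..} \<bar>v\<bar> * (1 / (1 + \<bar>v\<bar>)\<^sup>2)) \<partial>lborel) = ennreal (2 / (1 + R))"
proof -
  have "(\<integral>\<^sup>+v. ennreal (indicator {R..} v * (1 / (1 + v)\<^sup>2)) * indicator {0..} v \<partial>lborel)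
    = (\<integral>\<^sup>+v. ennreal (1 / (1 + v)\<^sup>2) * indicator {R..} v \<partial>lborel)"
    by (intro nn_integral_cong) (use assms in \<open>auto simp: indicator_def\<close>)
  also have "\<dots> = ennreal (0 - (- (1 / (1 + R))))"
    by (rule nn_integral_FTC_atLeast[where F = "\<lambda>v. - (1 / (1 + v))"])
       (use assms in \<open>auto intro!: derivative_eq_intros simp: power2_eq_square\<close>, real_asymp)
  finally have "(\<integral>\<^sup>+v. ennreal (indicator {R..} v * (1 / (1 + v)\<^sup>2)) * indicator {0..} v \<partial>lborel) = ennreal (1 / (1 + R))"
    by simp
  then show ?thesis
    using nn_integral_abs[of "\<lambda>v. ennreal (indicator {R..} v * (1 / (1 + v)\<^sup>2))"] assms
    by (simp add: ennreal_mult'[symmetric] flip: ennreal_numeral)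
qed

lemma nn_integral_inverse_abs:
  assumes "0 \<le> R"
  shows "(\<integral>\<^sup>+v. ennreal (indicator {..R} \<bar>v\<bar> * (1 / (1 + \<bar>v\<bar>))) \<partial>lborel) = ennreal (2 * ln (1 + R))"
proof -
  have "(\<integral>\<^sup>+v. ennreal (indicator {..R} v * (1 / (1 + v))) * indicator {0..} v \<partial>lborel)
    = (\<integral>\<^sup>+v. ennreal (1 / (1 + v)) * indicator {0..R} v \<partial>lborel)"
    by (intro nn_integral_cong) (auto simp: indicator_def)
  also have "\<dots> = ennreal (ln (1 + R) - ln (1 + 0))"
    by (rule nn_integral_FTC_Icc[where F = "\<lambda>v. ln (1 + v)"])
       (use assms in \<open>auto intro!: derivative_eq_intros\<close>)
  finally have "(\<integral>\<^sup>+v. ennreal (indicator {..R} v * (1 / (1 + v))) * indicator {0..} v \<partial>lborel) = ennreal (ln (1 + R))"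
    by simp
  then show ?thesis
    using nn_integral_abs[of "\<lambda>v. ennreal (indicator {..R} v * (1 / (1 + v)))"] assms
    by (simp add: ennreal_mult'[symmetric] flip: ennreal_numeral)
qed

text \<open>For bandwidth 1 / sqrt n this is the factor of order (ln n)^2 in the stochastic
  error.\<close>

lemma nn_integral_freq_weight_box:
  assumes "0 < h"
  shows "(\<integral>\<^sup>+u. ennreal (indicator (freq_box h) u * freq_weight u) \<partial>lborel) = ennreal ((2 * ln (1 + 1 / h))\<^sup>2)"
proof -
  let ?f = "\<lambda>v :: real. ennreal (indicator {..1 / h} \<bar>v\<bar> * (1 / (1 + \<bar>v\<bar>)))"
  have "(\<integral>\<^sup>+u. ennreal (indicator (freq_box h) u * freq_weight u) \<partial>lborel) = (\<integral>\<^sup>+u. ?f (fst u) * ?f (snd u) \<partial>lborel)"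
    by (intro nn_integral_cong)
       (auto simp: freq_box_def freq_weight_def indicator_def abs_le_iff mem_Times_iff ennreal_mult[symmetric])
  also have "\<dots> = (\<integral>\<^sup>+v. ?f v \<partial>lborel) * (\<integral>\<^sup>+v. ?f v \<partial>lborel)"
    by (rule nn_integral_lborel_plane_mult) auto
  also have "\<dots> = ennreal ((2 * ln (1 + 1 / h))\<^sup>2)"
    using assms by (subst (1 2) nn_integral_inverse_abs) (auto simp: power2_eq_square ennreal_mult[symmetric])
  finally show ?thesis .
qed

lemma nn_integral_freq_weight_square: "(\<integral>\<^sup>+u. ennreal ((freq_weight u)\<^sup>2) \<partial>lborel) = 4"
proof -
  let ?f = "\<lambda>v :: real. ennreal (indicator {0..} \<bar>v\<bar> * (1 / (1 + \<bar>v\<bar>)\<^sup>2))"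
  have "(\<integral>\<^sup>+u. ennreal ((freq_weight u)\<^sup>2) \<partial>lborel) = (\<integral>\<^sup>+u. ?f (fst u) * ?f (snd u) \<partial>lborel)"
    by (intro nn_integral_cong) (simp add: freq_weight_def ennreal_mult[symmetric] power_mult_distrib power_divide)
  also have "\<dots> = (\<integral>\<^sup>+v. ?f v \<partial>lborel) * (\<integral>\<^sup>+v. ?f v \<partial>lborel)"
    by (rule nn_integral_lborel_plane_mult) auto
  also have "\<dots> = 4"
    by (subst (1 2) nn_integral_inverse_square_abs) auto
  finally show ?thesis .
qed

text \<open>The kernel error, the minimum of 2 and L h |u|, is split between the coordinates. In the
  coordinate that carries it, frequencies up to 1 / h contribute order h ln (1 / h) and the others
  order h; the other coordinate contributes a factor 2.\<close>

lemma nn_integral_bias_weight: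
  assumes h: "0 < h" and L: "0 \<le> L"
  shows "(\<integral>\<^sup>+u. ennreal ((freq_weight u)\<^sup>2 * min 2 (L * h * norm u)) \<partial>lborel)
    \<le> ennreal (8 * h * (L * ln (1 + 1 / h) + 2))"
proof -
  let ?p = "\<lambda>v :: real. ennreal (indicator {0..} \<bar>v\<bar> * (1 / (1 + \<bar>v\<bar>)\<^sup>2))"
  let ?q = "\<lambda>v :: real. ennreal (1 / (1 + \<bar>v\<bar>)\<^sup>2 * min 2 (L * h * \<bar>v\<bar>))"
  have p: "(\<integral>\<^sup>+v. ?p v \<partial>lborel) = 2"
    by (subst nn_integral_inverse_square_abs) auto
  \<comment> \<open>Up to 1 / h one power of 1 + |v| is spent on the linear bound; beyond, the
    constant bound 2 is used.\<close>
  have q_le: "?q v \<le> ennreal (L * h) * ennreal (indicator {..1/h} \<bar>v\<bar> * (1 / (1 + \<bar>v\<bar>)))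
      + 2 * ennreal (indicator {1/h..} \<bar>v\<bar> * (1 / (1 + \<bar>v\<bar>)\<^sup>2))" for v
  proof (cases "\<bar>v\<bar> \<le> 1 / h")
    case True
    have "1 / (1 + \<bar>v\<bar>)\<^sup>2 * min 2 (L * h * \<bar>v\<bar>) \<le> 1 / (1 + \<bar>v\<bar>)\<^sup>2 * (L * h * (1 + \<bar>v\<bar>))"
      using h L by (intro mult_left_mono order_trans[OF min.cobounded2]) auto
    also have "\<dots> = L * h * (1 / (1 + \<bar>v\<bar>))"
    proof -
      have cancel: "1 / s\<^sup>2 * (k * s) = k * (1 / s)" if "s \<noteq> 0" for s k :: real
        using that by (simp add: power2_eq_square)
      show ?thesis by (rule cancel) (use abs_ge_zero[of v] in linarith)
    qed
    finally have "?q v \<le> ennreal (L * h * (1 / (1 + \<bar>v\<bar>)))" by (rule ennreal_leI)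
    also have "\<dots> = ennreal (L * h) * ennreal (indicator {..1/h} \<bar>v\<bar> * (1 / (1 + \<bar>v\<bar>)))"
      using True h L by (simp add: ennreal_mult[symmetric])
    finally show ?thesis by (rule order_trans) simp
  next
    case False
    have "1 / (1 + \<bar>v\<bar>)\<^sup>2 * min 2 (L * h * \<bar>v\<bar>) \<le> 1 / (1 + \<bar>v\<bar>)\<^sup>2 * 2"
      by (intro mult_left_mono) auto
    then have "?q v \<le> ennreal (2 * (1 / (1 + \<bar>v\<bar>)\<^sup>2))" by (intro ennreal_leI) simp
    also have "\<dots> = 2 * ennreal (indicator {1/h..} \<bar>v\<bar> * (1 / (1 + \<bar>v\<bar>)\<^sup>2))"
      using False by (simp add: ennreal_mult'[symmetric] flip: ennreal_numeral)
    finally show ?thesis by (rule order_trans) simp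
  qed
  have "(\<integral>\<^sup>+v. ?q v \<partial>lborel) \<le> (\<integral>\<^sup>+v. ennreal (L * h) * ennreal (indicator {..1/h} \<bar>v\<bar> * (1 / (1 + \<bar>v\<bar>)))
      + 2 * ennreal (indicator {1/h..} \<bar>v\<bar> * (1 / (1 + \<bar>v\<bar>)\<^sup>2)) \<partial>lborel)"
    by (intro nn_integral_mono q_le)
  also have "\<dots> = ennreal (L * h) * ennreal (2 * ln (1 + 1 / h)) + 2 * ennreal (2 / (1 + 1 / h))"
  proof -
    have "0 \<le> 1 / h" using h by simp
    note i = nn_integral_inverse_abs[OF this] nn_integral_inverse_square_abs[OF this]
    show ?thesis
      by (subst nn_integral_add, measurable) (subst (1 2) nn_integral_cmult, measurable, simp only: i)
  qed
  also have "\<dots> = ennreal (L * h * (2 * ln (1 + 1 / h)) + 2 * (2 / (1 + 1 / h)))"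
  proof -
    have "0 \<le> ln (1 + 1 / h)" using h by simp
    then have "ennreal (L * h * (2 * ln (1 + 1 / h)) + 2 * (2 / (1 + 1 / h))) =
        ennreal (L * h * (2 * ln (1 + 1 / h))) + ennreal (2 * (2 / (1 + 1 / h)))"
      using h L by (intro ennreal_plus) auto
    also have "ennreal (L * h * (2 * ln (1 + 1 / h))) = ennreal (L * h) * ennreal (2 * ln (1 + 1 / h))"
      using h L by (intro ennreal_mult') auto
    also have "ennreal (2 * (2 / (1 + 1 / h))) = 2 * ennreal (2 / (1 + 1 / h))"
      using ennreal_mult'[of 2 "2 / (1 + 1 / h)"] by simp
    finally show ?thesis ..
  qed
  also have "\<dots> \<le> ennreal (2 * h * (L * ln (1 + 1 / h) + 2))"
  proof (rule ennreal_leI)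
    have "2 / (1 + 1 / h) \<le> 2 * h" using h by (simp add: field_simps)
    then show "L * h * (2 * ln (1 + 1 / h)) + 2 * (2 / (1 + 1 / h)) \<le> 2 * h * (L * ln (1 + 1 / h) + 2)"
      by (simp add: algebra_simps)
  qed
  finally have q: "(\<integral>\<^sup>+v. ?q v \<partial>lborel) \<le> ennreal (2 * h * (L * ln (1 + 1 / h) + 2))" .
  have le: "ennreal ((freq_weight u)\<^sup>2 * min 2 (L * h * norm u)) \<le> ?q (fst u) * ?p (snd u) + ?p (fst u) * ?q (snd u)" for u
  proof -
    have "norm u \<le> \<bar>fst u\<bar> + \<bar>snd u\<bar>"
      using sqrt_sum_squares_le_sum_abs[of "fst u" "snd u"] by (simp add: norm_prod_def)
    then have "L * h * norm u \<le> L * h * \<bar>fst u\<bar> + L * h * \<bar>snd u\<bar>"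
      using mult_left_mono[of "norm u" "\<bar>fst u\<bar> + \<bar>snd u\<bar>" "L * h"] h L by (simp add: distrib_left)
    moreover have "0 \<le> L * h * \<bar>fst u\<bar>" "0 \<le> L * h * \<bar>snd u\<bar>" using h L by auto
    ultimately have "min 2 (L * h * norm u) \<le> min 2 (L * h * \<bar>fst u\<bar>) + min 2 (L * h * \<bar>snd u\<bar>)"
      by (auto simp: min_def)
    then have "(freq_weight u)\<^sup>2 * min 2 (L * h * norm u) \<le> (freq_weight u)\<^sup>2 * (min 2 (L * h * \<bar>fst u\<bar>) + min 2 (L * h * \<bar>snd u\<bar>))"
      by (intro mult_left_mono) auto
    also have "\<dots> = (1 / (1 + \<bar>fst u\<bar>)\<^sup>2 * min 2 (L * h * \<bar>fst u\<bar>)) * (1 / (1 + \<bar>snd u\<bar>)\<^sup>2)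
        + (1 / (1 + \<bar>fst u\<bar>)\<^sup>2) * (1 / (1 + \<bar>snd u\<bar>)\<^sup>2 * min 2 (L * h * \<bar>snd u\<bar>))"
    proof -
      have "(freq_weight u)\<^sup>2 = (1 / (1 + \<bar>fst u\<bar>)\<^sup>2) * (1 / (1 + \<bar>snd u\<bar>)\<^sup>2)"
        by (simp add: freq_weight_def power_mult_distrib power_divide)
      then show ?thesis by (simp only: distrib_left mult_ac)
    qed
    finally show ?thesis
      using h L by (simp add: ennreal_mult[symmetric] ennreal_plus[symmetric] del: ennreal_plus)
  qed
  have "(\<integral>\<^sup>+u. ennreal ((freq_weight u)\<^sup>2 * min 2 (L * h * norm u)) \<partial>lborel)
      \<le> (\<integral>\<^sup>+u. ?q (fst u) * ?p (snd u) + ?p (fst u) * ?q (snd u) \<partial>lborel)"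
    by (intro nn_integral_mono le)
  also have "\<dots> = (\<integral>\<^sup>+u. ?q (fst u) * ?p (snd u) \<partial>lborel) + (\<integral>\<^sup>+u. ?p (fst u) * ?q (snd u) \<partial>lborel)"
    by (rule nn_integral_add) auto
  also have "(\<integral>\<^sup>+u. ?q (fst u) * ?p (snd u) \<partial>(lborel :: plane measure)) = (\<integral>\<^sup>+v. ?q v \<partial>lborel) * 2"
    by (subst nn_integral_lborel_plane_mult) (auto simp: p[simplified])
  also have "(\<integral>\<^sup>+u. ?p (fst u) * ?q (snd u) \<partial>(lborel :: plane measure)) = 2 * (\<integral>\<^sup>+v. ?q v \<partial>lborel)"
    by (subst nn_integral_lborel_plane_mult) (auto simp: p[simplified])
  also have "(\<integral>\<^sup>+v. ?q v \<partial>lborel) * 2 + 2 * (\<integral>\<^sup>+v. ?q v \<partial>lborel) = 4 * (\<integral>\<^sup>+v. ?q v \<partial>lborel)"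
  proof -
    have "x * 2 + 2 * x = 4 * x" for x :: ennreal
      using distrib_right[of 2 2 x] by (simp add: mult.commute)
    then show ?thesis .
  qed
  also have "\<dots> \<le> 4 * ennreal (2 * h * (L * ln (1 + 1 / h) + 2))"
    by (intro mult_left_mono q) auto
  also have "\<dots> = ennreal (8 * h * (L * ln (1 + 1 / h) + 2))"
    using h L by (simp add: ennreal_mult'[symmetric] algebra_simps flip: ennreal_numeral)
  finally show ?thesis .
qed

section \<open>The smoothed tail integral on the frequency side\<close>

lemma inv_fourier_eq_lborel:
  assumes [measurable]: "f \<in> borel_measurable borel"
  shows "inv_fourier f x = 1 / (2 * pi)\<^sup>2 * (LINT u|lborel. iexp (- (u \<bullet> x)) * f u)"
  unfolding inv_fourier_def by (subst integral_completion) auto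

text \<open>With both factors integrable, Fubini's theorem moves the transform to the weight; the
  inverse transform of \<open>H\<close> itself need not be integrable.\<close>

lemma integral_inv_fourier:
  fixes g :: "plane \<Rightarrow> real" and H :: "plane \<Rightarrow> complex"
  assumes g: "integrable lborel g" and H: "integrable lborel H"
  shows "(LINT y|lebesgue. complex_of_real (g y) * inv_fourier H y)
    = 1 / (2 * pi)\<^sup>2 * (LINT u|lborel. fourier (\<lambda>y. complex_of_real (g y)) (- u) * H u)"
proof -
  have [measurable]: "g \<in> borel_measurable borel" "H \<in> borel_measurable borel" using g H by auto
  have inv: "inv_fourier H = (\<lambda>x. 1 / (2 * pi)\<^sup>2 * (LINT u|lborel. iexp (- (u \<bullet> x)) * H u))"
    by (rule ext, rule inv_fourier_eq_lborel) measurable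
  have "(LINT y|lebesgue. complex_of_real (g y) * inv_fourier H y) = (LINT y|lborel. complex_of_real (g y) * inv_fourier H y)"
    unfolding inv by (rule integral_completion) measurable
  also have "\<dots> = (LINT y|lborel. 1 / (2 * pi)\<^sup>2 * (LINT u|lborel. (complex_of_real (g y) * iexp (- (u \<bullet> y))) * H u))"
    by (simp add: inv mult_ac flip: integral_mult_right_zero)
  also have "\<dots> = 1 / (2 * pi)\<^sup>2 * (LINT y|lborel. LINT u|lborel. (complex_of_real (g y) * iexp (- (u \<bullet> y))) * H u)"
    by (rule integral_mult_right_zero)
  also have "(LINT y|lborel. LINT u|lborel. (complex_of_real (g y) * iexp (- (u \<bullet> y))) * H u)
      = (LINT u|lborel. LINT y|lborel. (complex_of_real (g y) * iexp (- (u \<bullet> y))) * H u)"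
  proof (rule lborel_pair.Fubini_integral[symmetric])
    show "integrable (lborel \<Otimes>\<^sub>M lborel) (\<lambda>(y, u). (complex_of_real (g y) * iexp (- (u \<bullet> y))) * H u)"
    proof (rule lborel_pair.Fubini_integrable)
      show "integrable lborel (\<lambda>y. LINT u|lborel. norm (case (y, u) of (y, u) \<Rightarrow> (complex_of_real (g y) * iexp (- (u \<bullet> y))) * H u))"
        using integrable_mult_left[OF integrable_abs[OF g], of "LINT u|lborel. cmod (H u)"] by (simp add: norm_mult)
      show "AE y in lborel. integrable lborel (\<lambda>u. case (y, u) of (y, u) \<Rightarrow> (complex_of_real (g y) * iexp (- (u \<bullet> y))) * H u)"
      proof (rule AE_I2)
        fix y
        show "integrable lborel (\<lambda>u. case (y, u) of (y, u) \<Rightarrow> (complex_of_real (g y) * iexp (- (u \<bullet> y))) * H u)"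
          by (rule Bochner_Integration.integrable_bound[OF integrable_mult_right[OF H, of "complex_of_real (g y)"]])
             (auto simp: norm_mult)
      qed
    qed measurable
  qed
  also have "\<dots> = (LINT u|lborel. fourier (\<lambda>y. complex_of_real (g y)) (- u) * H u)"
    by (subst fourier_eq_lborel) (auto simp: mult_ac simp flip: integral_mult_left_zero)
  finally show ?thesis .
qed

text \<open>\<open>K\<close> is only Lebesgue measurable, so the substitution takes place in the
  completed measure.\<close>

lemma fourier_scaled_kernel:
  fixes K :: "plane \<Rightarrow> real"
  assumes K [measurable]: "K \<in> borel_measurable lebesgue" and h: "0 < h"
  shows "fourier (\<lambda>z. complex_of_real (scaled_kernel K h z)) u = fourier (\<lambda>z. complex_of_real (K z)) (h *\<^sub>R u)"
proof -
  let ?T = "\<lambda>x :: plane. 0 + (\<Sum>j\<in>Basis. ((1 / h) * (x \<bullet> j)) *\<^sub>R j)"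
  have T: "?T = (\<lambda>x. (1 / h) *\<^sub>R x)"
    by (rule ext) (simp only: scaleR_scaleR[symmetric] scaleR_sum_right[symmetric] euclidean_representation add_0)
  have T_meas [measurable]: "(\<lambda>x :: plane. (1 / h) *\<^sub>R x) \<in> lebesgue \<rightarrow>\<^sub>M lebesgue"
    using lebesgue_affine_measurable[of "\<lambda>_ :: plane. 1 / h" 0] h unfolding T by simp
  have leb: "(lebesgue :: plane measure) = density (distr lebesgue lebesgue (\<lambda>x. (1 / h) *\<^sub>R x)) (\<lambda>_. ennreal ((1 / h)\<^sup>2))"
    using lebesgue_affine_euclidean[of "\<lambda>_ :: plane. 1 / h" 0] h unfolding T by (simp add: power2_eq_square)
  have [measurable]: "(\<lambda>x. iexp (v \<bullet> x)) \<in> borel_measurable lebesgue" for v :: plane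
    by (rule measurable_completion) measurable
  let ?G = "\<lambda>x. iexp ((h *\<^sub>R u) \<bullet> x) * complex_of_real (K x)"
  have G_meas: "?G \<in> borel_measurable lebesgue" by (intro borel_measurable_times) measurable
  have "fourier (\<lambda>z. complex_of_real (K z)) (h *\<^sub>R u) = (LINT x|lebesgue. ?G x)"
    by (simp add: fourier_def)
  also have "\<dots> = (LINT x|density (distr lebesgue lebesgue (\<lambda>x. (1 / h) *\<^sub>R x)) (\<lambda>_. ennreal ((1 / h)\<^sup>2)). ?G x)"
    by (subst leb) simp
  also have "\<dots> = (LINT x|distr lebesgue lebesgue (\<lambda>x. (1 / h) *\<^sub>R x). (1 / h)\<^sup>2 *\<^sub>R ?G x)"
    by (rule integral_density) (use G_meas in auto)
  also have "\<dots> = (LINT x|lebesgue. (1 / h)\<^sup>2 *\<^sub>R ?G ((1 / h) *\<^sub>R x))"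
    by (rule integral_distr[OF T_meas]) (intro borel_measurable_scaleR borel_measurable_const G_meas)
  also have "\<dots> = fourier (\<lambda>z. complex_of_real (scaled_kernel K h z)) u"
    unfolding fourier_def scaled_kernel_def using h
    by (intro Bochner_Integration.integral_cong refl) (simp add: scaleR_conv_of_real power_divide)
  finally show ?thesis ..
qed

text \<open>Everything is read off from \<open>k u = ?F (h *\<^sub>R u)\<close>. Since
  \<open>K\<close> is a probability density, \<open>?F\<close> is bounded by 1 and equals 1 at 0,
  where the Lipschitz bound is anchored.\<close>

lemma scaled_kernel_fourier_facts:
  fixes K :: "plane \<Rightarrow> real"
  assumes K_nonneg: "\<And>x. 0 \<le> K x" and K_L1: "integrable lebesgue K" and K_int: "(LINT x|lebesgue. K x) = 1"
    and K_supp: "closure {u. fourier (\<lambda>x. complex_of_real (K x)) u \<noteq> 0} \<subseteq> {-1..1} \<times> {-1..1}"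
    and K_lipschitz: "L-lipschitz_on UNIV (fourier (\<lambda>x. complex_of_real (K x)))"
    and h: "0 < h"
  defines "k \<equiv> fourier (\<lambda>z. complex_of_real (scaled_kernel K h z))"
  shows scaled_kernel_fourier_measurable: "k \<in> borel_measurable borel"
    and scaled_kernel_fourier_support: "u \<notin> freq_box h \<Longrightarrow> k u = 0"
    and scaled_kernel_fourier_le_1: "cmod (k u) \<le> 1"
    and scaled_kernel_fourier_approx: "cmod (k u - 1) \<le> min 2 (L * h * norm u)"
proof -
  let ?F = "fourier (\<lambda>x. complex_of_real (K x))"
  have k: "k = (\<lambda>u. ?F (h *\<^sub>R u))"
    unfolding k_def using fourier_scaled_kernel[OF borel_measurable_integrable[OF K_L1] h] by auto
  have "continuous_on UNIV ?F" using K_lipschitz by (rule lipschitz_on_continuous_on)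
  then have [measurable]: "?F \<in> borel_measurable borel" by (rule borel_measurable_continuous_onI)
  show "k \<in> borel_measurable borel" unfolding k by measurable
  show "k u = 0" if "u \<notin> freq_box h"
  proof (rule ccontr)
    assume "k u \<noteq> 0"
    then have "h *\<^sub>R u \<in> closure {u. ?F u \<noteq> 0}" unfolding k by (intro closure_subset[THEN subsetD]) simp
    then have "h *\<^sub>R u \<in> {-1..1} \<times> {-1..1}" using K_supp by auto
    then have "u \<in> freq_box h" using h by (simp add: freq_box_def mem_Times_iff field_simps)
    then show False using that by simp
  qed
  have F_le: "cmod (?F v) \<le> 1" for v
  proof -
    have "cmod (?F v) \<le> (LINT x|lebesgue. K x)"
      unfolding fourier_def by (rule order_trans[OF integral_norm_bound]) (simp add: norm_mult K_nonneg)
    then show ?thesis by (simp add: K_int)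
  qed
  then show le1: "cmod (k u) \<le> 1" by (simp add: k)
  have F0: "?F 0 = 1" using K_int by (simp add: fourier_def)
  have "cmod (k u - 1) \<le> L * norm (h *\<^sub>R u)"
    using lipschitz_onD[OF K_lipschitz, of "h *\<^sub>R u" 0] by (simp add: k F0 dist_norm)
  moreover have "cmod (k u - 1) \<le> 2"
    using norm_triangle_ineq4[of "k u" 1] le1 by simp
  ultimately show "cmod (k u - 1) \<le> min 2 (L * h * norm u)" using h by (simp add: mult.assoc)
qed

text \<open>Off the two boundary lines a point is interior either to the quadrant, where the
  denominator is positive, or to its complement. Both lines are null sets for the jump
  measure.\<close>

lemma weight_isCont:
  assumes "0 \<le> a" "0 \<le> b" "fst x \<noteq> a" "snd x \<noteq> b"
  shows "isCont (weight a b) x"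
proof (cases "a < fst x \<and> b < snd x")
  case True
  have op: "open ({a<..} \<times> {b<..} :: plane set)" by (intro open_Times) auto
  have "isCont (\<lambda>x :: plane. 1 / (fst x ^ 4 + snd x ^ 4)) x"
    using True assms by (intro continuous_intros) (auto simp: add_nonneg_eq_0_iff)
  moreover have "\<forall>\<^sub>F y in nhds x. weight a b y = 1 / (fst y ^ 4 + snd y ^ 4)"
    using eventually_nhds_in_open[OF op, of x] True
    by (auto elim!: eventually_mono simp: mem_Times_iff weight_def indicator_def)
  ultimately show ?thesis by (subst isCont_cong) auto
next
  case False
  have op: "open (({..<a} \<times> UNIV) \<union> (UNIV \<times> {..<b}) :: plane set)" by (intro open_Un open_Times) auto
  have "isCont (\<lambda>x :: plane. 0 :: real) x" by simp
  moreover have "\<forall>\<^sub>F y in nhds x. weight a b y = 0"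
    using eventually_nhds_in_open[OF op, of x] False assms(3,4)
    by (auto elim!: eventually_mono simp: mem_Times_iff weight_def indicator_def)
  ultimately show ?thesis by (subst isCont_cong) auto
qed

lemma weight_bounds:
  assumes "0 \<le> a" "0 \<le> b" "0 < a ^ 4 + b ^ 4"
  shows "0 \<le> weight a b x" "weight a b x \<le> 1 / (a ^ 4 + b ^ 4)"
proof -
  show "0 \<le> weight a b x" by (simp add: weight_def)
  show "weight a b x \<le> 1 / (a ^ 4 + b ^ 4)"
  proof (cases "a \<le> fst x \<and> b \<le> snd x")
    case True
    have "a ^ 4 + b ^ 4 \<le> fst x ^ 4 + snd x ^ 4"
      using True assms by (intro add_mono power_mono) auto
    then show ?thesis using True assms by (simp add: weight_def mem_Times_iff frac_le)
  next
    case False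
    then show ?thesis using assms by (auto simp: weight_def mem_Times_iff)
  qed
qed

lemma norm_divide_2pi_le: "cmod (complex_of_real (1 / (2 * pi)\<^sup>2) * z) \<le> cmod z"
proof -
  have "1 \<le> (2 * pi)\<^sup>2" using pi_gt3 by (intro one_le_power) simp
  then have "1 / (2 * pi)\<^sup>2 \<le> 1" by simp
  then show ?thesis unfolding norm_mult norm_of_real by (intro mult_left_le_one_le) auto
qed

definition quartic_measure :: "plane measure \<Rightarrow> plane measure" where
  "quartic_measure \<nu> = density \<nu> (\<lambda>x. ennreal (fst x ^ 4 + snd x ^ 4))"

context jump_measure
begin

lemma sets_quartic [measurable_cong, simp]: "sets (quartic_measure \<nu>) = sets borel"
  by (simp add: quartic_measure_def sets_nu)

text \<open>The density cancels the denominator of the weight, which turns the tail into an integral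
  accessible to Parseval's identity.\<close>

lemma integral_weight_quartic:
  assumes "0 \<le> a" "0 \<le> b" "0 < a ^ 4 + b ^ 4"
  shows "(LINT x|quartic_measure \<nu>. weight a b x) = tail \<nu> a b"
proof -
  have [measurable]: "weight a b \<in> borel_measurable \<nu>"
    unfolding measurable_cong_sets[OF sets_nu refl] by measurable
  have "(LINT x|quartic_measure \<nu>. weight a b x) = (LINT x|\<nu>. (fst x ^ 4 + snd x ^ 4) *\<^sub>R weight a b x)"
    unfolding quartic_measure_def by (rule integral_density) auto
  also have "\<dots> = (LINT x|\<nu>. indicator ({a..} \<times> {b..}) x)"
  proof (intro Bochner_Integration.integral_cong refl)
    fix x :: plane
    show "(fst x ^ 4 + snd x ^ 4) *\<^sub>R weight a b x = indicator ({a..} \<times> {b..}) x"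
    proof (cases "a \<le> fst x \<and> b \<le> snd x")
      case True
      have "a ^ 4 + b ^ 4 \<le> fst x ^ 4 + snd x ^ 4"
        using True assms by (intro add_mono power_mono) auto
      then show ?thesis using assms by (simp add: weight_def)
    qed (auto simp: weight_def indicator_def mem_Times_iff)
  qed
  also have "\<dots> = tail \<nu> a b" by (simp add: tail_def)
  finally show ?thesis .
qed

text \<open>Both transforms decay like \<open>freq_weight\<close>, so that its integrable square
  dominates their product.\<close>

lemma tail_parseval:
  assumes fin: "finite_measure (quartic_measure \<nu>)"
    and decay: "\<And>u. cmod (fourier_measure (quartic_measure \<nu>) u) \<le> c * freq_weight u"
    and ab: "0 \<le> a" "0 \<le> b" "0 < a ^ 4 + b ^ 4"
  shows "integrable lborel (\<lambda>u. fourier (\<lambda>y. complex_of_real (weight a b y)) (- u) * fourier_measure (quartic_measure \<nu>) u)" (is ?int)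
    and "complex_of_real (tail \<nu> a b) = 1 / (2 * pi)\<^sup>2 *
      (LINT u|lborel. fourier (\<lambda>y. complex_of_real (weight a b y)) (- u) * fourier_measure (quartic_measure \<nu>) u)" (is ?eq)
proof -
  interpret \<mu>: finite_measure "quartic_measure \<nu>" by fact
  let ?A = "36 * (1 + 1 / (a ^ 4 + b ^ 4))"
  have c: "0 \<le> c" using order_trans[OF norm_ge_zero decay[of 0]] by (simp add: freq_weight_def)
  have A: "0 \<le> ?A" using ab by simp
  have g_le: "cmod (fourier (\<lambda>y. complex_of_real (weight a b y)) u) \<le> ?A * freq_weight u" for u
    using fourier_weight_bound[OF ab, of u] by (simp add: freq_weight_def)
  have [measurable]: "(\<lambda>u. fourier (\<lambda>y. complex_of_real (weight a b y)) (- u)) \<in> borel_measurable borel"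
    by (subst fourier_eq_lborel) measurable
  have [measurable]: "fourier_measure (quartic_measure \<nu>) \<in> borel_measurable borel"
    unfolding fourier_measure_def[abs_def] by measurable
  show int: ?int
  proof (rule Bochner_Integration.integrable_bound)
    show "integrable lborel (\<lambda>u. ?A * c * (freq_weight u)\<^sup>2)"
      by (intro integrable_mult_right integrableI_nonneg) (auto simp: nn_integral_freq_weight_square)
    have le: "cmod (fourier (\<lambda>y. complex_of_real (weight a b y)) (- u) * fourier_measure (quartic_measure \<nu>) u)
        \<le> (?A * freq_weight u) * (c * freq_weight u)" for u
      unfolding norm_mult using g_le[of "- u"] decay[of u] A freq_weight_bounds[of u]
      by (intro mult_mono) (auto intro: mult_nonneg_nonneg less_imp_le)
    show "AE u in lborel. norm (fourier (\<lambda>y. complex_of_real (weight a b y)) (- u) * fourier_measure (quartic_measure \<nu>) u)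
        \<le> norm (?A * c * (freq_weight u)\<^sup>2)"
    proof (rule AE_I2)
      fix u
      have "(?A * freq_weight u) * (c * freq_weight u) = ?A * c * (freq_weight u)\<^sup>2"
        by (simp only: power2_eq_square mult_ac)
      also have "\<dots> \<le> norm (?A * c * (freq_weight u)\<^sup>2)"
        unfolding real_norm_def by (rule abs_ge_self)
      finally show "norm (fourier (\<lambda>y. complex_of_real (weight a b y)) (- u) * fourier_measure (quartic_measure \<nu>) u)
          \<le> norm (?A * c * (freq_weight u)\<^sup>2)"
        using le[of u] by (rule order_trans[rotated])
    qed
  qed measurable
  have "AE x in quartic_measure \<nu>. fst x \<noteq> a \<and> snd x \<noteq> b"
    unfolding quartic_measure_def using AE_fst_neq[OF ab(1)] AE_snd_neq[OF ab(2)]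
    by (subst AE_density) (auto elim: eventually_elim2)
  then have cont: "AE x in quartic_measure \<nu>. isCont (weight a b) x"
  proof eventually_elim
    case (elim x)
    then show ?case by (intro weight_isCont ab) auto
  qed
  have "(LINT u|lborel. fourier (\<lambda>y. complex_of_real (weight a b y)) (- u) * fourier_measure (quartic_measure \<nu>) u)
     = complex_of_real ((2 * pi)\<^sup>2 * (LINT x|quartic_measure \<nu>. weight a b x))"
    by (rule parseval_measure[OF sets_quartic fin integrable_weight[OF ab] _ cont int, of "1 / (a ^ 4 + b ^ 4)"])
       (use weight_bounds[OF ab] in \<open>auto simp: abs_of_nonneg\<close>)
  then show ?eq
    by (simp add: integral_weight_quartic[OF ab])
qed

text \<open>By Parseval's identity the difference is the integral for the exact tail with
  \<open>k u - 1\<close> as an additional factor.\<close>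

lemma kernel_bias:
  assumes fin: "finite_measure (quartic_measure \<nu>)"
    and decay: "\<And>u. cmod (fourier_measure (quartic_measure \<nu>) u) \<le> c * freq_weight u"
    and ab: "0 \<le> a" "0 \<le> b" "0 < a ^ 4 + b ^ 4"
    and k [measurable]: "k \<in> borel_measurable borel"
    and k_approx: "\<And>u. cmod (k u - 1) \<le> min 2 (L * h * norm u)"
    and h: "0 < h" and L: "0 \<le> L"
  shows "cmod (1 / (2 * pi)\<^sup>2 * (LINT u|lborel. fourier (\<lambda>y. complex_of_real (weight a b y)) (- u) * (fourier_measure (quartic_measure \<nu>) u * k u)) - tail \<nu> a b)
    \<le> 36 * (1 + 1 / (a ^ 4 + b ^ 4)) * c * (8 * h * (L * ln (1 + 1 / h) + 2))"
proof -
  interpret \<mu>: finite_measure "quartic_measure \<nu>" by fact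
  let ?A = "36 * (1 + 1 / (a ^ 4 + b ^ 4))"
  let ?g = "\<lambda>u. fourier (\<lambda>y. complex_of_real (weight a b y)) (- u)"
  let ?\<mu> = "fourier_measure (quartic_measure \<nu>)"
  note int = tail_parseval(1)[OF fin decay ab]
  have c: "0 \<le> c" using order_trans[OF norm_ge_zero decay[of 0]] by (simp add: freq_weight_def)
  have A: "0 \<le> ?A" using ab by simp
  have g_le: "cmod (?g u) \<le> ?A * freq_weight u" for u
    using fourier_weight_bound[OF ab, of "- u"] by (simp add: freq_weight_def)
  \<comment> \<open>Follows from |k - 1| <= 2 and serves the integrability of the smoothed
    product.\<close>
  have "cmod (k u) \<le> 3" for u
  proof -
    have "cmod (k u) \<le> cmod (k u - 1) + cmod 1"
      using norm_triangle_ineq[of "k u - 1" 1] by simp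
    then show ?thesis using k_approx[of u] by simp
  qed
  have int_k: "integrable lborel (\<lambda>u. ?g u * (?\<mu> u * k u))"
  proof (rule Bochner_Integration.integrable_bound[OF integrable_mult_right[OF integrable_norm[OF int], of 3]])
    show "(\<lambda>u. ?g u * (?\<mu> u * k u)) \<in> borel_measurable lborel"
      using borel_measurable_times[OF borel_measurable_integrable[OF int], of k] by (simp add: mult.assoc)
    show "AE u in lborel. norm (?g u * (?\<mu> u * k u)) \<le> norm (3 * norm (?g u * ?\<mu> u))"
    proof (rule AE_I2)
      fix u
      have "norm (?g u * (?\<mu> u * k u)) = norm (?g u * ?\<mu> u) * cmod (k u)" by (simp add: norm_mult)
      also have "\<dots> \<le> norm (?g u * ?\<mu> u) * 3" using \<open>cmod (k u) \<le> 3\<close> by (intro mult_left_mono) auto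
      finally show "norm (?g u * (?\<mu> u * k u)) \<le> norm (3 * norm (?g u * ?\<mu> u))" by simp
    qed
  qed
  have "1 / (2 * pi)\<^sup>2 * (LINT u|lborel. ?g u * (?\<mu> u * k u)) - tail \<nu> a b
      = 1 / (2 * pi)\<^sup>2 * ((LINT u|lborel. ?g u * (?\<mu> u * k u)) - (LINT u|lborel. ?g u * ?\<mu> u))"
    unfolding tail_parseval(2)[OF fin decay ab] by (simp only: right_diff_distrib)
  also have "(LINT u|lborel. ?g u * (?\<mu> u * k u)) - (LINT u|lborel. ?g u * ?\<mu> u) = (LINT u|lborel. ?g u * (?\<mu> u * k u) - ?g u * ?\<mu> u)"
    by (rule Bochner_Integration.integral_diff[symmetric, OF int_k int])
  finally have eq: "1 / (2 * pi)\<^sup>2 * (LINT u|lborel. ?g u * (?\<mu> u * k u)) - tail \<nu> a b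
      = 1 / (2 * pi)\<^sup>2 * (LINT u|lborel. ?g u * (?\<mu> u * k u) - ?g u * ?\<mu> u)" .
  have pt: "norm (?g u * (?\<mu> u * k u) - ?g u * ?\<mu> u) \<le> ?A * c * ((freq_weight u)\<^sup>2 * min 2 (L * h * norm u))" for u
  proof -
    have "?g u * (?\<mu> u * k u) - ?g u * ?\<mu> u = ?g u * ?\<mu> u * (k u - 1)" by (simp add: algebra_simps)
    then have "norm (?g u * (?\<mu> u * k u) - ?g u * ?\<mu> u) = cmod (?g u) * cmod (?\<mu> u) * cmod (k u - 1)"
      by (simp add: norm_mult)
    also have "\<dots> \<le> (?A * freq_weight u) * (c * freq_weight u) * min 2 (L * h * norm u)"
      using g_le[of u] decay[of u] k_approx[of u] A c freq_weight_bounds[of u]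
      by (intro mult_mono) (auto intro: mult_nonneg_nonneg less_imp_le)
    also have "\<dots> = ?A * c * ((freq_weight u)\<^sup>2 * min 2 (L * h * norm u))"
      by (simp only: power2_eq_square mult_ac)
    finally show ?thesis .
  qed
  let ?w = "\<lambda>u. (freq_weight u)\<^sup>2 * min 2 (L * h * norm u)"
  have w_nonneg: "0 \<le> ?w u" for u using h L by simp
  have w_int: "integrable lborel ?w"
    by (rule integrableI_nonneg) (use w_nonneg in \<open>auto intro: le_less_trans[OF nn_integral_bias_weight[OF h L]]\<close>)
  have w_le: "(LINT u|lborel. ?w u) \<le> 8 * h * (L * ln (1 + 1 / h) + 2)"
  proof -
    have "ennreal (LINT u|lborel. ?w u) \<le> ennreal (8 * h * (L * ln (1 + 1 / h) + 2))"
      using nn_integral_bias_weight[OF h L] w_nonneg by (simp add: nn_integral_eq_integral[OF w_int])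
    then show ?thesis using h L by (subst (asm) ennreal_le_iff) auto
  qed
  have "norm (LINT u|lborel. ?g u * (?\<mu> u * k u) - ?g u * ?\<mu> u) \<le> (LINT u|lborel. ?A * c * ?w u)"
    by (rule integral_norm_bound_integral'[OF integrable_mult_right[OF w_int] pt])
  also have "\<dots> = ?A * c * (LINT u|lborel. ?w u)" by (rule integral_mult_right_zero)
  also have "\<dots> \<le> ?A * c * (8 * h * (L * ln (1 + 1 / h) + 2))"
    using A c by (intro mult_left_mono[OF w_le]) auto
  finally have "norm (LINT u|lborel. ?g u * (?\<mu> u * k u) - ?g u * ?\<mu> u) \<le> ?A * c * (8 * h * (L * ln (1 + 1 / h) + 2))" .
  then show ?thesis unfolding eq by (rule order_trans[OF norm_divide_2pi_le])
qed

end

lemma freq_box_sets [measurable]: "freq_box h \<in> sets (borel :: plane measure)"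
  unfolding freq_box_def by (intro borel_closed closed_Times) auto

lemma emeasure_freq_box: "emeasure lborel (freq_box h) < \<infinity>"
proof -
  have "freq_box h = cbox (- (1 / h), - (1 / h)) (1 / h, 1 / h)"
    by (auto simp: freq_box_def cbox_Pair_eq)
  then show ?thesis by (simp add: emeasure_lborel_cbox_eq)
qed

lemma integrable_on_freq_box:
  fixes f :: "plane \<Rightarrow> complex"
  assumes [measurable]: "f \<in> borel_measurable borel" and le: "\<And>u. u \<in> freq_box h \<Longrightarrow> cmod (f u) \<le> B"
  shows "integrable lborel (\<lambda>u. if u \<in> freq_box h then f u else 0)"
proof (rule Bochner_Integration.integrable_bound)
  show "integrable lborel (\<lambda>u. B * indicator (freq_box h) u)"
    by (intro integrable_mult_right integrable_real_indicator) (use emeasure_freq_box in auto)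
  show "AE u in lborel. norm (if u \<in> freq_box h then f u else 0) \<le> norm (B * indicator (freq_box h) u)"
    using le by (intro AE_I2) (auto intro: order_trans[OF _ abs_ge_self])
qed measurable

text \<open>Provides the limit at infinity that the inversion operation presupposes. The inverse
  transform of \<open>H\<close> is bounded, the weight at 1 dominates, and every fixed point
  eventually lies outside the receding quadrant.\<close>

lemma weight_integral_tendsto_0:
  fixes H :: "plane \<Rightarrow> complex"
  assumes H: "integrable lborel H"
  shows "((\<lambda>x. LINT y|lebesgue. complex_of_real (weight x 0 y) * inv_fourier H y) \<longlongrightarrow> 0) at_top"
    and "((\<lambda>x. LINT y|lebesgue. complex_of_real (weight 0 x y) * inv_fourier H y) \<longlongrightarrow> 0) at_top"
proof -
  have [measurable]: "H \<in> borel_measurable borel" using H by auto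
  have inv: "inv_fourier H = (\<lambda>x. 1 / (2 * pi)\<^sup>2 * (LINT u|lborel. iexp (- (u \<bullet> x)) * H u))"
    by (rule ext, rule inv_fourier_eq_lborel) measurable
  have meas [measurable]: "inv_fourier H \<in> borel_measurable borel" unfolding inv by measurable
  define B where "B = (LINT u|lborel. cmod (H u))"
  have inv_le: "cmod (inv_fourier H y) \<le> B" for y
  proof -
    have "cmod (inv_fourier H y) \<le> cmod (LINT u|lborel. iexp (- (u \<bullet> y)) * H u)"
      unfolding inv by (rule norm_divide_2pi_le)
    also have "\<dots> \<le> B" unfolding B_def by (rule order_trans[OF integral_norm_bound]) (simp add: norm_mult)
    finally show ?thesis .
  qed
  have B: "0 \<le> B" using order_trans[OF norm_ge_zero inv_le[of 0]] .
  have lim: "((\<lambda>x. LINT y|lebesgue. complex_of_real (w x y) * inv_fourier H y) \<longlongrightarrow> 0) at_top"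
    if w_meas [measurable]: "\<And>x. w x \<in> borel_measurable borel"
      and w_int: "integrable lborel (w 1)" and w_nonneg: "\<And>x y. 0 \<le> w x y"
      and w_anti: "\<And>x y. 1 \<le> x \<Longrightarrow> w x y \<le> w 1 y"
      and w_zero: "\<And>x y. norm y < x \<Longrightarrow> w x y = 0" for w :: "real \<Rightarrow> plane \<Rightarrow> real"
  proof -
    have "((\<lambda>x. LINT y|lborel. complex_of_real (w x y) * inv_fourier H y) \<longlongrightarrow> (LINT y|(lborel :: plane measure). (0 :: complex))) at_top"
    proof (rule integral_dominated_convergence_at_top[where w = "\<lambda>y. w 1 y * B"])
      show "integrable lborel (\<lambda>y. w 1 y * B)" using w_int by simp
      show "AE y in lborel. ((\<lambda>x. complex_of_real (w x y) * inv_fourier H y) \<longlongrightarrow> 0) at_top"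
      proof (rule AE_I2)
        fix y :: plane
        have "\<forall>\<^sub>F x in at_top. complex_of_real (w x y) * inv_fourier H y = 0"
          using eventually_gt_at_top[of "norm y"] by eventually_elim (simp add: w_zero)
        then show "((\<lambda>x. complex_of_real (w x y) * inv_fourier H y) \<longlongrightarrow> 0) at_top"
          by (simp add: tendsto_eventually)
      qed
      show "\<forall>\<^sub>F x in at_top. AE y in lborel. norm (complex_of_real (w x y) * inv_fourier H y) \<le> w 1 y * B"
        using eventually_ge_at_top[of 1]
        by eventually_elim (auto simp: norm_mult w_nonneg intro!: mult_mono w_anti inv_le)
    qed measurable
    moreover have "(LINT y|lborel. complex_of_real (w x y) * inv_fourier H y) = (LINT y|lebesgue. complex_of_real (w x y) * inv_fourier H y)" for x
      by (rule integral_completion[symmetric]) measurable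
    ultimately show ?thesis by simp
  qed
  have coord: "\<bar>fst y\<bar> \<le> norm y" "\<bar>snd y\<bar> \<le> norm y" for y :: plane
    using norm_fst_le[of "fst y" "snd y"] norm_snd_le[of "snd y" "fst y"] by auto
  show "((\<lambda>x. LINT y|lebesgue. complex_of_real (weight x 0 y) * inv_fourier H y) \<longlongrightarrow> 0) at_top"
  proof (rule lim)
    show "weight x 0 y = 0" if "norm y < x" for x y
      using coord[of y] that by (auto simp: weight_def indicator_def mem_Times_iff)
    show "integrable lborel (weight 1 0)" by (rule integrable_weight) auto
  qed (auto simp: weight_def indicator_def mem_Times_iff)
  show "((\<lambda>x. LINT y|lebesgue. complex_of_real (weight 0 x y) * inv_fourier H y) \<longlongrightarrow> 0) at_top"
  proof (rule lim)
    show "weight 0 x y = 0" if "norm y < x" for x y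
      using coord[of y] that by (auto simp: weight_def indicator_def mem_Times_iff)
    show "integrable lborel (weight 0 1)" by (rule integrable_weight) auto
  qed (auto simp: weight_def indicator_def mem_Times_iff)
qed

context jump_measure
begin

text \<open>The transform of the quartic measure is inserted on the frequency box. Its difference
  from \<open>H\<close>, damped by the decay of the transform of the weight, is the stochastic part;
  what remains is \<open>kernel_bias\<close>.\<close>

lemma estimation_error:
  fixes H k :: "plane \<Rightarrow> complex"
  assumes fin: "finite_measure (quartic_measure \<nu>)"
    and decay: "\<And>u. cmod (fourier_measure (quartic_measure \<nu>) u) \<le> c * freq_weight u"
    and ab: "0 \<le> a" "0 \<le> b" "0 < a ^ 4 + b ^ 4"
    and k [measurable]: "k \<in> borel_measurable borel"
    and k_approx: "\<And>u. cmod (k u - 1) \<le> min 2 (L * h * norm u)"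
    and k_le: "\<And>u. cmod (k u) \<le> 1" and k_supp: "\<And>u. u \<notin> freq_box h \<Longrightarrow> k u = 0"
    and h: "0 < h" and L: "0 \<le> L"
    and H [measurable]: "H \<in> borel_measurable borel" and H_le: "\<And>u. u \<in> freq_box h \<Longrightarrow> cmod (H u) \<le> B"
    and E: "0 \<le> E" "(\<integral>\<^sup>+u. ennreal (indicator (freq_box h) u * freq_weight u * cmod (H u - fourier_measure (quartic_measure \<nu>) u)) \<partial>lborel) \<le> ennreal E"
  shows "cmod ((LINT y|lebesgue. complex_of_real (weight a b y) *
        inv_fourier (\<lambda>u. if u \<in> freq_box h then H u * k u else 0) y) - tail \<nu> a b)
    \<le> 36 * (1 + 1 / (a ^ 4 + b ^ 4)) * (E + c * (8 * h * (L * ln (1 + 1 / h) + 2)))"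
proof -
  interpret \<mu>: finite_measure "quartic_measure \<nu>" by fact
  let ?A = "36 * (1 + 1 / (a ^ 4 + b ^ 4))"
  let ?g = "\<lambda>u. fourier (\<lambda>y. complex_of_real (weight a b y)) (- u)"
  let ?\<mu> = "fourier_measure (quartic_measure \<nu>)"
  let ?N = "LINT y|lebesgue. complex_of_real (weight a b y) * inv_fourier (\<lambda>u. if u \<in> freq_box h then H u * k u else 0) y"
  have A: "0 \<le> ?A" using ab by simp
  have c: "0 \<le> c" using order_trans[OF norm_ge_zero decay[of 0]] by (simp add: freq_weight_def)
  have g_le: "cmod (?g u) \<le> ?A * freq_weight u" for u
    using fourier_weight_bound[OF ab, of "- u"] by (simp add: freq_weight_def)
  have [measurable]: "?g \<in> borel_measurable borel"
    by (subst fourier_eq_lborel) measurable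
  have [measurable]: "?\<mu> \<in> borel_measurable borel"
    unfolding fourier_measure_def[abs_def] by measurable
  have B: "0 \<le> B" using order_trans[OF norm_ge_zero H_le[of 0]] h by (simp add: freq_box_def mem_Times_iff)
  have mu_le: "cmod (?\<mu> u) \<le> c" for u
    using order_trans[OF decay[of u] mult_left_mono[OF freq_weight_bounds(2) c]] by simp
  have g_le': "cmod (?g u) \<le> ?A" for u
    using order_trans[OF g_le[of u] mult_left_mono[OF freq_weight_bounds(2) A]] by simp
  let ?b = "\<lambda>f u. if u \<in> freq_box h then f u else (0 :: complex)"
  have Hk_le: "cmod (H u * k u) \<le> B" if "u \<in> freq_box h" for u
    using mult_mono[OF H_le[OF that] k_le[of u] B norm_ge_zero] by (simp add: norm_mult)
  have \<mu>k_le: "cmod (?\<mu> u * k u) \<le> c" for u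
    using mult_mono[OF mu_le k_le[of u] c norm_ge_zero] by (simp add: norm_mult)
  have gH_le: "cmod (?g u * (H u * k u)) \<le> ?A * B" if "u \<in> freq_box h" for u
    using mult_mono[OF g_le' Hk_le[OF that] A norm_ge_zero] by (simp only: norm_mult)
  have g\<mu>_le: "cmod (?g u * (?\<mu> u * k u)) \<le> ?A * c" for u
    using mult_mono[OF g_le' \<mu>k_le A norm_ge_zero] by (simp only: norm_mult)
  have int_Hk: "integrable lborel (?b (\<lambda>u. H u * k u))"
    by (rule integrable_on_freq_box[OF _ Hk_le]) measurable
  have int_gH: "integrable lborel (?b (\<lambda>u. ?g u * (H u * k u)))"
    by (rule integrable_on_freq_box[OF _ gH_le]) measurable
  have int_g\<mu>: "integrable lborel (?b (\<lambda>u. ?g u * (?\<mu> u * k u)))"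
    by (rule integrable_on_freq_box[OF _ g\<mu>_le]) measurable
  have "?N = 1 / (2 * pi)\<^sup>2 * (LINT u|lborel. ?g u * ?b (\<lambda>u. H u * k u) u)"
    by (rule integral_inv_fourier[OF integrable_weight[OF ab] int_Hk])
  also have "(\<lambda>u. ?g u * ?b (\<lambda>u. H u * k u) u) = ?b (\<lambda>u. ?g u * (H u * k u))" by auto
  finally have N_eq: "?N = 1 / (2 * pi)\<^sup>2 * (LINT u|lborel. ?b (\<lambda>u. ?g u * (H u * k u)) u)" .
  \<comment> \<open>As \<open>k\<close> vanishes outside the box, cutting off the true integrand
    there changes nothing.\<close>
  have \<mu>_eq: "(\<lambda>u. ?g u * (?\<mu> u * k u)) = ?b (\<lambda>u. ?g u * (?\<mu> u * k u))"
    using k_supp by auto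
  define I where "I = (LINT u|lborel. ?g u * (?\<mu> u * k u))"
  have split: "?N - tail \<nu> a b = complex_of_real (1 / (2 * pi)\<^sup>2) * ((LINT u|lborel. ?b (\<lambda>u. ?g u * (H u * k u)) u) - I) + (complex_of_real (1 / (2 * pi)\<^sup>2) * I - tail \<nu> a b)"
    unfolding N_eq by (simp only: right_diff_distrib add_diff_eq diff_add_cancel)
  have bias: "cmod (complex_of_real (1 / (2 * pi)\<^sup>2) * I - tail \<nu> a b) \<le> ?A * c * (8 * h * (L * ln (1 + 1 / h) + 2))"
    unfolding I_def by (rule kernel_bias[OF fin decay ab k k_approx h L])
  have stoch: "cmod (complex_of_real (1 / (2 * pi)\<^sup>2) * ((LINT u|lborel. ?b (\<lambda>u. ?g u * (H u * k u)) u) - I)) \<le> ?A * E"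
  proof (rule order_trans[OF norm_divide_2pi_le])
    let ?w = "\<lambda>u. indicator (freq_box h) u * freq_weight u * cmod (H u - ?\<mu> u)"
    have w_nonneg: "0 \<le> ?w u" for u using freq_weight_bounds(1)[of u] by simp
    have w_int: "integrable lborel ?w"
      by (rule integrableI_nonneg) (use w_nonneg in \<open>auto intro: le_less_trans[OF E(2)]\<close>)
    have w_le: "(LINT u|lborel. ?w u) \<le> E"
    proof -
      have "ennreal (LINT u|lborel. ?w u) \<le> ennreal E"
        using E(2) w_nonneg by (simp add: nn_integral_eq_integral[OF w_int])
      then show ?thesis using E(1) by (subst (asm) ennreal_le_iff) auto
    qed
    have "(LINT u|lborel. ?b (\<lambda>u. ?g u * (H u * k u)) u) - I = (LINT u|lborel. ?b (\<lambda>u. ?g u * (H u * k u)) u - ?b (\<lambda>u. ?g u * (?\<mu> u * k u)) u)"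
      unfolding I_def \<mu>_eq by (rule Bochner_Integration.integral_diff[symmetric, OF int_gH int_g\<mu>])
    then have "cmod ((LINT u|lborel. ?b (\<lambda>u. ?g u * (H u * k u)) u) - I) = cmod (LINT u|lborel. ?b (\<lambda>u. ?g u * (H u * k u)) u - ?b (\<lambda>u. ?g u * (?\<mu> u * k u)) u)"
      by (simp only:)
    also have "\<dots> \<le> (LINT u|lborel. ?A * ?w u)"
    proof (rule integral_norm_bound_integral'[OF integrable_mult_right[OF w_int]])
      fix u
      show "norm (?b (\<lambda>u. ?g u * (H u * k u)) u - ?b (\<lambda>u. ?g u * (?\<mu> u * k u)) u) \<le> ?A * ?w u"
      proof (cases "u \<in> freq_box h")
        case True
        have "?g u * (H u * k u) - ?g u * (?\<mu> u * k u) = ?g u * ((H u - ?\<mu> u) * k u)" by (simp add: algebra_simps)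
        then have "norm (?g u * (H u * k u) - ?g u * (?\<mu> u * k u)) = cmod (?g u) * (cmod (H u - ?\<mu> u) * cmod (k u))"
          by (simp add: norm_mult)
        also have "\<dots> \<le> (?A * freq_weight u) * (cmod (H u - ?\<mu> u) * 1)"
          using A freq_weight_bounds(1)[of u] by (intro mult_mono g_le k_le order_refl) (auto intro: mult_nonneg_nonneg less_imp_le)
        finally show ?thesis using True by (simp add: mult_ac)
      qed (use A in simp)
    qed
    also have "\<dots> = ?A * (LINT u|lborel. ?w u)" by (rule integral_mult_right_zero)
    also have "\<dots> \<le> ?A * E" by (intro mult_left_mono w_le A)
    finally show "cmod ((LINT u|lborel. ?b (\<lambda>u. ?g u * (H u * k u)) u) - I) \<le> ?A * E" .
  qed
  have "cmod (?N - tail \<nu> a b) \<le> ?A * E + ?A * c * (8 * h * (L * ln (1 + 1 / h) + 2))"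
    unfolding split by (rule order_trans[OF norm_triangle_ineq add_mono[OF stoch bias]])
  then show ?thesis by (simp only: distrib_left mult.assoc)
qed

end

section \<open>Moments of compound Poisson laws\<close>

lemma power_one_plus_le:
  fixes x :: real
  assumes "0 \<le> x"
  shows "(1 + x) ^ p \<le> 2 ^ p * (1 + x ^ p)"
proof -
  have "(1 + x) ^ p \<le> (2 * max 1 x) ^ p" using assms by (intro power_mono) auto
  also have "\<dots> = 2 ^ p * max 1 x ^ p" by (rule power_mult_distrib)
  also have "max 1 x ^ p \<le> 1 + x ^ p" using assms by (auto simp: max_def)
  finally show ?thesis by simp
qed

text \<open>The law of a random walk with steps of law \<open>J\<close> after \<open>n\<close>
  steps; the drift is its starting point.\<close>

fun compound_sum :: "real measure \<Rightarrow> real \<Rightarrow> nat \<Rightarrow> real measure" where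
  "compound_sum J \<beta> 0 = return borel \<beta>"
| "compound_sum J \<beta> (Suc n) = convolution J (compound_sum J \<beta> n)"

context real_distribution
begin

lemma sets_compound_sum [measurable_cong, simp]: "sets (compound_sum M \<beta> n) = sets borel"
  by (cases n) auto

lemma space_compound_sum [simp]: "space (compound_sum M \<beta> n) = UNIV"
  using sets_eq_imp_space_eq[OF sets_compound_sum] by simp

lemma prob_space_compound_sum: "prob_space (compound_sum M \<beta> n)"
proof (induction n)
  case 0
  then show ?case by (simp add: prob_space_return)
next
  case (Suc n)
  interpret N: prob_space "compound_sum M \<beta> n" by fact
  interpret pair_prob_space M "compound_sum M \<beta> n" ..
  show ?case unfolding compound_sum.simps convolution_def
    by (rule prob_space_distr) measurable
qed

lemma char_compound_sum: "char (compound_sum M \<beta> n) t = iexp (t * \<beta>) * char M t ^ n"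
proof (induction n)
  case 0
  then show ?case by (simp add: char_def integral_return)
next
  case (Suc n)
  interpret N: prob_space "compound_sum M \<beta> n" by (rule prob_space_compound_sum)
  interpret pair_prob_space M "compound_sum M \<beta> n" ..
  have int: "integrable (M \<Otimes>\<^sub>M compound_sum M \<beta> n) (\<lambda>(x, y). iexp (t * (x + y)))"
    by (rule P.integrable_const_bound[of _ 1]) (auto simp: split_beta)
  have "char (compound_sum M \<beta> (Suc n)) t = (LINT z|(M \<Otimes>\<^sub>M compound_sum M \<beta> n). iexp (t * (case z of (x, y) \<Rightarrow> x + y)))"
    unfolding char_def compound_sum.simps convolution_def by (rule integral_distr) measurable
  also have "\<dots> = (LINT z|(M \<Otimes>\<^sub>M compound_sum M \<beta> n). (case z of (x, y) \<Rightarrow> iexp (t * (x + y))))"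
    by (intro Bochner_Integration.integral_cong refl) auto
  also have "\<dots> = (LINT x|M. LINT y|compound_sum M \<beta> n. iexp (t * (x + y)))"
    by (rule integral_fst[OF int, symmetric])
  also have "\<dots> = (LINT x|M. iexp (t * x) * char (compound_sum M \<beta> n) t)"
    unfolding char_def by (simp add: distrib_left exp_add)
  also have "\<dots> = char M t * char (compound_sum M \<beta> n) t"
    unfolding char_def by simp
  finally show ?case by (simp add: Suc.IH mult_ac)
qed

text \<open>The weight 1 + |x| is submultiplicative under addition, so its moments grow at most
  geometrically in the number of summands.\<close>

lemma nn_integral_compound_sum_le:
  "(\<integral>\<^sup>+x. ennreal ((1 + \<bar>x\<bar>) ^ p) \<partial>compound_sum M \<beta> n) \<le> ennreal ((1 + \<bar>\<beta>\<bar>) ^ p) * (\<integral>\<^sup>+x. ennreal ((1 + \<bar>x\<bar>) ^ p) \<partial>M) ^ n"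
proof (induction n)
  case 0
  then show ?case by (simp add: nn_integral_return)
next
  case (Suc n)
  interpret N: prob_space "compound_sum M \<beta> n" by (rule prob_space_compound_sum)
  let ?W = "\<lambda>x :: real. ennreal ((1 + \<bar>x\<bar>) ^ p)"
  have "(\<integral>\<^sup>+x. ?W x \<partial>compound_sum M \<beta> (Suc n)) = (\<integral>\<^sup>+x. \<integral>\<^sup>+y. ?W (x + y) \<partial>compound_sum M \<beta> n \<partial>M)"
    unfolding compound_sum.simps
    by (rule nn_integral_convolution) (auto simp: finite_measure_axioms N.finite_measure_axioms)
  also have "\<dots> \<le> (\<integral>\<^sup>+x. \<integral>\<^sup>+y. ?W x * ?W y \<partial>compound_sum M \<beta> n \<partial>M)"
  proof (intro nn_integral_mono)
    fix x y :: real
    have "1 + \<bar>x + y\<bar> \<le> (1 + \<bar>x\<bar>) * (1 + \<bar>y\<bar>)"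
      using abs_triangle_ineq[of x y] mult_nonneg_nonneg[OF abs_ge_zero[of x] abs_ge_zero[of y]]
      by (simp only: distrib_left distrib_right mult_1 mult_1_right)
    then have "(1 + \<bar>x + y\<bar>) ^ p \<le> (1 + \<bar>x\<bar>) ^ p * (1 + \<bar>y\<bar>) ^ p"
      unfolding power_mult_distrib[symmetric] by (intro power_mono) auto
    then show "?W (x + y) \<le> ?W x * ?W y"
      by (simp add: ennreal_mult[symmetric] ennreal_leI)
  qed
  also have "\<dots> = (\<integral>\<^sup>+x. ?W x \<partial>M) * (\<integral>\<^sup>+y. ?W y \<partial>compound_sum M \<beta> n)"
    by (simp add: nn_integral_cmult nn_integral_multc)
  also have "\<dots> \<le> (\<integral>\<^sup>+x. ?W x \<partial>M) * (ennreal ((1 + \<bar>\<beta>\<bar>) ^ p) * (\<integral>\<^sup>+x. ?W x \<partial>M) ^ n)"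
    by (intro mult_left_mono Suc.IH) auto
  finally show ?case by (simp add: mult_ac)
qed

end

section \<open>Poisson mixtures of random walks\<close>

text \<open>An explicit law with the characteristic function that the model prescribes for
  one-dimensional projections.\<close>

definition compound_poisson_law :: "real measure \<Rightarrow> real \<Rightarrow> real \<Rightarrow> real measure" where
  "compound_poisson_law J \<Lambda> \<beta> = measure_pmf (poisson_pmf \<Lambda>) \<bind> compound_sum J \<beta>"

context real_distribution
begin

lemma compound_sum_measurable: "compound_sum M \<beta> \<in> measurable (measure_pmf q) (subprob_algebra borel)"
  using prob_space_compound_sum
  by (auto simp: space_subprob_algebra intro: prob_space_imp_subprob_space)

lemma real_distribution_compound_poisson_law:
  "real_distribution (compound_poisson_law M \<Lambda> \<beta>)"
proof -
  have "prob_space (compound_poisson_law M \<Lambda> \<beta>)"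
    unfolding compound_poisson_law_def
    by (rule measure_pmf.prob_space_bind[OF _ compound_sum_measurable]) (use prob_space_compound_sum in auto)
  moreover have "sets (compound_poisson_law M \<Lambda> \<beta>) = sets borel"
    unfolding compound_poisson_law_def by (rule sets_bind) auto
  ultimately show ?thesis
    by (auto simp: real_distribution_def real_distribution_axioms_def intro: sets_eq_imp_space_eq)
qed

lemma char_compound_poisson_law:
  assumes "0 < \<Lambda>"
  shows "char (compound_poisson_law M \<Lambda> \<beta>) t = exp (\<i> * complex_of_real (t * \<beta>) + complex_of_real \<Lambda> * (char M t - 1))"
proof -
  let ?c = "char M t" and ?f = "\<lambda>k. complex_of_real (\<Lambda> ^ k / fact k * exp (- \<Lambda>)) * (iexp (t * \<beta>) * char M t ^ k)"
  have "char (compound_poisson_law M \<Lambda> \<beta>) t = (LINT k|measure_pmf (poisson_pmf \<Lambda>). char (compound_sum M \<beta> k) t)"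
  proof -
    interpret L: real_distribution "compound_poisson_law M \<Lambda> \<beta>" by (rule real_distribution_compound_poisson_law)
    \<comment> \<open>Integration against the mixture is carried out for bounded real integrands and
      then applied to the real and the imaginary part.\<close>
    have real_part: "(LINT x|compound_poisson_law M \<Lambda> \<beta>. f x) = (LINT k|measure_pmf (poisson_pmf \<Lambda>). LINT x|compound_sum M \<beta> k. f x)"
      if [measurable]: "f \<in> borel_measurable borel" and "\<And>x. \<bar>f x\<bar> \<le> 1" for f :: "real \<Rightarrow> real"
      unfolding compound_poisson_law_def
      by (rule integral_bind[where K = borel and B = 1 and B' = 1, OF _ _ compound_sum_measurable])
         (use that prob_space_compound_sum in \<open>auto intro!: AE_I2 prob_space.emeasure_le_1 measure_pmf.finite_measure_axioms\<close>)
    have L_int: "integrable (compound_poisson_law M \<Lambda> \<beta>) (\<lambda>x. iexp (t * x))"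
      by (rule L.integrable_const_bound[of _ 1]) auto
    have k_int: "integrable (compound_sum M \<beta> k) (\<lambda>x. iexp (t * x))" for k
      by (rule finite_measure.integrable_const_bound[of _ _ 1])
         (use prob_space_compound_sum[THEN prob_space.finite_measure] in auto)
    have c_int: "integrable (measure_pmf (poisson_pmf \<Lambda>)) (\<lambda>k. char (compound_sum M \<beta> k) t)"
    proof (rule measure_pmf.integrable_const_bound[of _ 1])
      show "AE k in measure_pmf (poisson_pmf \<Lambda>). norm (char (compound_sum M \<beta> k) t) \<le> 1"
        by (intro AE_I2) (simp add: char_compound_sum norm_mult norm_power cmod_char_le_1 power_le_one)
    qed simp
    have "Re (char (compound_poisson_law M \<Lambda> \<beta>) t) = Re (LINT k|measure_pmf (poisson_pmf \<Lambda>). char (compound_sum M \<beta> k) t)"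
      using real_part[of "\<lambda>x. Re (iexp (t * x))"] L_int k_int c_int
      unfolding char_def by (simp only: integral_Re[symmetric] complex_Re_le_cmod abs_Re_le_cmod[THEN order_trans] norm_exp_i_times) (auto simp: Re_exp)
    moreover have "Im (char (compound_poisson_law M \<Lambda> \<beta>) t) = Im (LINT k|measure_pmf (poisson_pmf \<Lambda>). char (compound_sum M \<beta> k) t)"
      using real_part[of "\<lambda>x. Im (iexp (t * x))"] L_int k_int c_int
      unfolding char_def by (simp only: integral_Im[symmetric]) (auto simp: Im_exp)
    ultimately show ?thesis by (rule complex_eqI)
  qed
  also have "\<dots> = (LINT k|measure_pmf (poisson_pmf \<Lambda>). iexp (t * \<beta>) * ?c ^ k)"
    by (simp add: char_compound_sum)
  also have "\<dots> = (LINT k|count_space UNIV. pmf (poisson_pmf \<Lambda>) k *\<^sub>R (iexp (t * \<beta>) * ?c ^ k))"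
    unfolding measure_pmf_eq_density by (rule integral_density) auto
  also have "\<dots> = (LINT k|count_space UNIV. ?f k)"
    using assms by (intro Bochner_Integration.integral_cong refl) (simp add: scaleR_conv_of_real)
  finally have eq: "char (compound_poisson_law M \<Lambda> \<beta>) t = (LINT k|count_space UNIV. ?f k)" .
  have "(\<lambda>k. (complex_of_real \<Lambda> * ?c) ^ k /\<^sub>R fact k) sums exp (complex_of_real \<Lambda> * ?c)"
    by (rule exp_converges)
  from sums_mult[OF this, of "complex_of_real (exp (- \<Lambda>)) * iexp (t * \<beta>)"]
  have "(\<lambda>k. complex_of_real (exp (- \<Lambda>)) * iexp (t * \<beta>) * ((complex_of_real \<Lambda> * ?c) ^ k /\<^sub>R fact k)) sums
      (complex_of_real (exp (- \<Lambda>)) * iexp (t * \<beta>) * exp (complex_of_real \<Lambda> * ?c))" .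
  moreover have "(\<lambda>k. complex_of_real (exp (- \<Lambda>)) * iexp (t * \<beta>) * ((complex_of_real \<Lambda> * ?c) ^ k /\<^sub>R fact k)) = ?f"
    by (simp add: fun_eq_iff scaleR_conv_of_real power_mult_distrib divide_inverse mult_ac)
  moreover have "complex_of_real (exp (- \<Lambda>)) * iexp (t * \<beta>) * exp (complex_of_real \<Lambda> * ?c) =
      exp (\<i> * complex_of_real (t * \<beta>) + complex_of_real \<Lambda> * (?c - 1))"
    by (simp add: exp_add exp_diff exp_minus exp_of_real right_diff_distrib divide_inverse mult_ac flip: of_real_minus)
  ultimately have sums: "?f sums exp (\<i> * complex_of_real (t * \<beta>) + complex_of_real \<Lambda> * (?c - 1))" by simp
  \<comment> \<open>Absolute summability identifies the sum of the exponential series with the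
    integral over the counting measure.\<close>
  have "summable (\<lambda>k. norm (?f k))"
  proof (rule summable_comparison_test')
    have "summable (\<lambda>k. inverse (fact k) * \<Lambda> ^ k :: real)" by (rule summable_exp)
    then show "summable (\<lambda>k. inverse (fact k) * \<Lambda> ^ k * exp (- \<Lambda>))" by (rule summable_mult2)
    have "cmod ?c \<le> 1" by (rule cmod_char_le_1)
    then have "cmod ?c ^ k \<le> 1" for k by (rule power_le_one[OF norm_ge_zero])
    then show "norm (norm (?f k)) \<le> inverse (fact k) * \<Lambda> ^ k * exp (- \<Lambda>)" for k
      using assms by (simp add: norm_mult norm_power norm_divide norm_inverse norm_fact divide_inverse mult_ac mult_left_le_one_le mult_left_le)
  qed
  then have "integrable (count_space UNIV) ?f" by (simp add: integrable_count_space_nat_iff)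
  then have "?f sums (LINT k|count_space UNIV. ?f k)" by (rule sums_integral_count_space_nat)
  then show ?thesis unfolding eq using sums by (rule sums_unique2)
qed

text \<open>Geometric growth with ratio C is summable against Poisson weights: the series is that of
  exp (\<Lambda> C).\<close>

lemma nn_integral_compound_poisson_law_finite:
  assumes "0 < \<Lambda>" and fin: "(\<integral>\<^sup>+x. ennreal ((1 + \<bar>x\<bar>) ^ p) \<partial>M) < \<infinity>"
  shows "(\<integral>\<^sup>+x. ennreal ((1 + \<bar>x\<bar>) ^ p) \<partial>compound_poisson_law M \<Lambda> \<beta>) < \<infinity>"
proof -
  obtain C where C: "(\<integral>\<^sup>+x. ennreal ((1 + \<bar>x\<bar>) ^ p) \<partial>M) = ennreal C" "0 \<le> C"
    using fin by (cases "\<integral>\<^sup>+x. ennreal ((1 + \<bar>x\<bar>) ^ p) \<partial>M") auto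
  let ?b = "(1 + \<bar>\<beta>\<bar>) ^ p"
  have "(\<integral>\<^sup>+x. ennreal ((1 + \<bar>x\<bar>) ^ p) \<partial>compound_poisson_law M \<Lambda> \<beta>)
     = (\<integral>\<^sup>+k. \<integral>\<^sup>+x. ennreal ((1 + \<bar>x\<bar>) ^ p) \<partial>compound_sum M \<beta> k \<partial>measure_pmf (poisson_pmf \<Lambda>))"
    unfolding compound_poisson_law_def by (rule nn_integral_bind[OF _ compound_sum_measurable]) measurable
  also have "\<dots> \<le> (\<integral>\<^sup>+k. ennreal ?b * ennreal C ^ k \<partial>measure_pmf (poisson_pmf \<Lambda>))"
    unfolding C(1)[symmetric] by (intro nn_integral_mono nn_integral_compound_sum_le)
  also have "\<dots> = (\<integral>\<^sup>+k. ennreal (pmf (poisson_pmf \<Lambda>) k) * (ennreal ?b * ennreal C ^ k) \<partial>count_space UNIV)"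
    by (rule nn_integral_measure_pmf)
  also have "\<dots> = (\<integral>\<^sup>+k. ennreal (exp (- \<Lambda>) * ?b * (inverse (fact k) * (\<Lambda> * C) ^ k)) \<partial>count_space UNIV)"
    using assms C by (intro nn_integral_cong)
      (simp add: ennreal_power ennreal_mult[symmetric] power_mult_distrib divide_inverse mult_ac)
  also have "\<dots> = (\<Sum>k. ennreal (exp (- \<Lambda>) * ?b * (inverse (fact k) * (\<Lambda> * C) ^ k)))"
    by (rule nn_integral_count_space_nat)
  also have "\<dots> = ennreal (\<Sum>k. exp (- \<Lambda>) * ?b * (inverse (fact k) * (\<Lambda> * C) ^ k))"
    using assms C by (intro suminf_ennreal_eq summable_sums summable_mult summable_exp mult_nonneg_nonneg) auto
  also have "\<dots> < \<infinity>" by simp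
  finally show ?thesis .
qed

text \<open>Uniqueness of characteristic functions identifies \<open>Q\<close> with the explicit
  mixture, whose moments can be bounded. The weight (1 + |x|)^p takes the place of |x|^p because it
  is submultiplicative.\<close>

lemma compound_poisson_moment:
  assumes Q: "real_distribution Q" and \<Lambda>: "0 < \<Lambda>"
    and char: "\<And>t. char Q t = exp (\<i> * complex_of_real (t * \<beta>) + complex_of_real \<Lambda> * (char M t - 1))"
    and mom: "integrable M (\<lambda>x. \<bar>x\<bar> ^ p)"
  shows "integrable Q (\<lambda>x. \<bar>x\<bar> ^ p)"
proof -
  have "Q = compound_poisson_law M \<Lambda> \<beta>"
    by (rule Levy_uniqueness[OF Q real_distribution_compound_poisson_law])
       (simp add: fun_eq_iff char char_compound_poisson_law[OF \<Lambda>])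
  moreover have "(\<integral>\<^sup>+x. ennreal ((1 + \<bar>x\<bar>) ^ p) \<partial>M) < \<infinity>"
  proof -
    have "integrable M (\<lambda>x. 2 ^ p * (1 + \<bar>x\<bar> ^ p))" using mom by simp
    then have "integrable M (\<lambda>x. (1 + \<bar>x\<bar>) ^ p)"
      by (rule Bochner_Integration.integrable_bound) (auto intro!: order_trans[OF power_one_plus_le])
    then show ?thesis by (simp add: integrable_iff_bounded)
  qed
  ultimately have "(\<integral>\<^sup>+x. ennreal ((1 + \<bar>x\<bar>) ^ p) \<partial>Q) < \<infinity>"
    using nn_integral_compound_poisson_law_finite[OF \<Lambda>] by simp
  then have fin: "(\<integral>\<^sup>+x. ennreal (\<bar>x\<bar> ^ p) \<partial>Q) < \<infinity>"
    by (rule le_less_trans[rotated]) (auto intro!: nn_integral_mono ennreal_leI power_mono)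
  interpret Q: real_distribution Q by fact
  show ?thesis by (rule integrableI_nonneg) (use fin in auto)
qed

end

section \<open>Empirical moments\<close>

text \<open>Bienayme's identity for centred variables: the new summand is independent of the partial
  sum, so the cross term has mean 0.\<close>

lemma (in prob_space) indep_vars_sum_square_expectation:
  fixes Y :: "nat \<Rightarrow> 'a \<Rightarrow> real"
  assumes indep: "indep_vars (\<lambda>_. borel) Y {..<n}"
    and int2: "\<And>i. i < n \<Longrightarrow> integrable M (\<lambda>\<omega>. (Y i \<omega>)\<^sup>2)"
    and mean: "\<And>i. i < n \<Longrightarrow> expectation (Y i) = 0"
  shows "integrable M (\<lambda>\<omega>. (\<Sum>i<n. Y i \<omega>)\<^sup>2) \<and>
    expectation (\<lambda>\<omega>. (\<Sum>i<n. Y i \<omega>)\<^sup>2) = (\<Sum>i<n. expectation (\<lambda>\<omega>. (Y i \<omega>)\<^sup>2))"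
  using assms
proof (induction n)
  case (Suc n)
  have indep_n: "indep_vars (\<lambda>_. borel) Y {..<n}"
    using indep_vars_subset[OF Suc.prems(1)] by auto
  have rv [measurable]: "Y i \<in> borel_measurable M" if "i < Suc n" for i
    using Suc.prems(1) that unfolding indep_vars_def by auto
  have int1: "integrable M (Y i)" if "i < Suc n" for i
    using square_integrable_imp_integrable[OF rv[OF that] Suc.prems(2)[OF that]] .
  have IH: "integrable M (\<lambda>\<omega>. (\<Sum>i<n. Y i \<omega>)\<^sup>2)"
      "expectation (\<lambda>\<omega>. (\<Sum>i<n. Y i \<omega>)\<^sup>2) = (\<Sum>i<n. expectation (\<lambda>\<omega>. (Y i \<omega>)\<^sup>2))"
    using Suc.IH[OF indep_n] Suc.prems by auto
  let ?S = "\<lambda>\<omega>. \<Sum>i<n. Y i \<omega>"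
  have indS: "indep_var borel (Y n) borel ?S"
    by (rule indep_vars_sum) (use Suc.prems(1) in \<open>auto simp: lessThan_Suc\<close>)
  have intS: "integrable M ?S" using int1 by (intro Bochner_Integration.integrable_sum) auto
  have prod: "integrable M (\<lambda>\<omega>. Y n \<omega> * ?S \<omega>)" "expectation (\<lambda>\<omega>. Y n \<omega> * ?S \<omega>) = expectation (Y n) * expectation ?S"
    using indep_var_integrable[OF indS int1 intS] indep_var_lebesgue_integral[OF indS int1 intS] by auto
  have eq: "(\<Sum>i<Suc n. Y i \<omega>)\<^sup>2 = (?S \<omega>)\<^sup>2 + 2 * (Y n \<omega> * ?S \<omega>) + (Y n \<omega>)\<^sup>2" for \<omega>
    by (simp add: power2_eq_square algebra_simps)
  show ?case unfolding eq using IH prod Suc.prems(2,3)[of n] by simp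
qed simp

locale iid_sample = prob_space M for M :: "'w measure" +
  fixes Z :: "nat \<Rightarrow> 'w \<Rightarrow> real \<times> real" and Q :: "(real \<times> real) measure"
  assumes indep: "\<And>n. indep_vars (\<lambda>_. borel) Z {..<n}"
    and law: "\<And>i. distr M borel (Z i) = Q"
begin

lemma Z_measurable [measurable]: "Z i \<in> borel_measurable M"
  using indep[of "Suc i"] unfolding indep_vars_def by auto

lemma sets_Q [simp, measurable_cong]: "sets Q = sets borel"
  using law[of 0] by auto

sublocale Q: prob_space Q
  using prob_space_distr[OF Z_measurable[of 0]] by (simp add: law)

lemma expectation_Z:
  fixes f :: "real \<times> real \<Rightarrow> 'b :: {banach, second_countable_topology}"
  assumes "f \<in> borel_measurable borel"
  shows "expectation (\<lambda>\<omega>. f (Z i \<omega>)) = (LINT z|Q. f z)"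
  using integral_distr[OF Z_measurable assms, of i] by (simp add: law)

lemma integrable_Z_iff:
  fixes f :: "real \<times> real \<Rightarrow> 'b :: {banach, second_countable_topology}"
  assumes "f \<in> borel_measurable borel"
  shows "integrable M (\<lambda>\<omega>. f (Z i \<omega>)) \<longleftrightarrow> integrable Q f"
  using integrable_distr_eq[OF Z_measurable assms, of i] by (simp add: law)

text \<open>The variance is bounded by the raw second moment, which for the integrands below has a
  bound independent of the frequency.\<close>

lemma sample_variance_real:
  fixes f :: "real \<times> real \<Rightarrow> real"
  assumes [measurable]: "f \<in> borel_measurable borel" and int: "integrable Q (\<lambda>z. (f z)\<^sup>2)"
  shows "integrable M (\<lambda>\<omega>. ((\<Sum>i<n. f (Z i \<omega>)) - n * (LINT z|Q. f z))\<^sup>2)"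
    and "expectation (\<lambda>\<omega>. ((\<Sum>i<n. f (Z i \<omega>)) - n * (LINT z|Q. f z))\<^sup>2) \<le> n * (LINT z|Q. (f z)\<^sup>2)"
proof -
  let ?m = "LINT z|Q. f z"
  have int_f: "integrable Q f"
    by (rule Q.square_integrable_imp_integrable[OF _ int]) simp
  let ?Y = "\<lambda>i \<omega>. f (Z i \<omega>) - ?m"
  have sq: "(f z - ?m)\<^sup>2 = (f z)\<^sup>2 - 2 * ?m * f z + ?m\<^sup>2" for z
    by (simp add: power2_eq_square algebra_simps)
  have int2: "integrable Q (\<lambda>z. (f z - ?m)\<^sup>2)"
    unfolding sq using int int_f by simp
  have var: "(LINT z|Q. (f z - ?m)\<^sup>2) \<le> (LINT z|Q. (f z)\<^sup>2)"
    unfolding sq using int int_f by (simp add: Q.prob_space power2_eq_square)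
  have "indep_vars (\<lambda>_. borel) (\<lambda>i. (\<lambda>z. f z - ?m) \<circ> Z i) {..<n}"
    by (rule indep_vars_compose[OF indep]) measurable
  then have ind: "indep_vars (\<lambda>_. borel) ?Y {..<n}" by (simp add: comp_def)
  have "integrable M (\<lambda>\<omega>. (?Y i \<omega>)\<^sup>2)" for i
    using int2 integrable_Z_iff[of "\<lambda>z. (f z - ?m)\<^sup>2" i] by simp
  moreover have "expectation (?Y i) = 0" for i
    using int_f integrable_Z_iff[of f i] expectation_Z[of f i] by (simp add: prob_space)
  ultimately have S: "integrable M (\<lambda>\<omega>. (\<Sum>i<n. ?Y i \<omega>)\<^sup>2) \<and>
      expectation (\<lambda>\<omega>. (\<Sum>i<n. ?Y i \<omega>)\<^sup>2) = (\<Sum>i<n. expectation (\<lambda>\<omega>. (?Y i \<omega>)\<^sup>2))"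
    by (intro indep_vars_sum_square_expectation ind) auto
  have eq: "(\<Sum>i<n. ?Y i \<omega>) = (\<Sum>i<n. f (Z i \<omega>)) - n * ?m" for \<omega>
    by (simp add: sum_subtractf)
  have E: "expectation (\<lambda>\<omega>. (?Y i \<omega>)\<^sup>2) = (LINT z|Q. (f z - ?m)\<^sup>2)" for i
    using expectation_Z[of "\<lambda>z. (f z - ?m)\<^sup>2" i] by simp
  show "integrable M (\<lambda>\<omega>. ((\<Sum>i<n. f (Z i \<omega>)) - n * ?m)\<^sup>2)"
    using S unfolding eq by simp
  show "expectation (\<lambda>\<omega>. ((\<Sum>i<n. f (Z i \<omega>)) - n * ?m)\<^sup>2) \<le> n * (LINT z|Q. (f z)\<^sup>2)"
    using S var unfolding eq E by (simp add: mult_left_mono)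
qed

text \<open>The inequality \<open>d \<le> s d\<^sup>2 + 1 / s\<close> with \<open>s = sqrt n\<close> replaces the Cauchy-Schwarz inequality.\<close>
lemma sample_mean_deviation:
  fixes f :: "real \<times> real \<Rightarrow> complex"
  assumes [measurable]: "f \<in> borel_measurable borel" and int: "integrable Q (\<lambda>z. (cmod (f z))\<^sup>2)"
    and n: "0 < n"
  shows "(\<integral>\<^sup>+\<omega>. ennreal (cmod ((\<Sum>i<n. f (Z i \<omega>)) / of_nat n - (LINT z|Q. f z))) \<partial>M)
    \<le> ennreal (((LINT z|Q. (cmod (f z))\<^sup>2) + 1) / sqrt n)"
proof -
  let ?m = "LINT z|Q. f z"
  let ?D = "\<lambda>\<omega>. (\<Sum>i<n. f (Z i \<omega>)) / of_nat n - ?m"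
  let ?R = "\<lambda>\<omega>. ((\<Sum>i<n. Re (f (Z i \<omega>))) - n * (LINT z|Q. Re (f z)))\<^sup>2"
  let ?I = "\<lambda>\<omega>. ((\<Sum>i<n. Im (f (Z i \<omega>))) - n * (LINT z|Q. Im (f z)))\<^sup>2"
  have int_re: "integrable Q (\<lambda>z. (Re (f z))\<^sup>2)" and int_im: "integrable Q (\<lambda>z. (Im (f z))\<^sup>2)"
    by (rule Bochner_Integration.integrable_bound[OF int]; simp add: cmod_power2)+
  have int_f: "integrable Q f"
  proof -
    have "integrable Q (\<lambda>z. cmod (f z))" by (rule Q.square_integrable_imp_integrable[OF _ int]) simp
    then show ?thesis by (simp add: integrable_norm_iff)
  qed
  note R = sample_variance_real[OF _ int_re, of n] and I = sample_variance_real[OF _ int_im, of n]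
  have D2: "(cmod (?D \<omega>))\<^sup>2 = (?R \<omega> + ?I \<omega>) / (real n)\<^sup>2" for \<omega>
  proof -
    have "?D \<omega> = ((\<Sum>i<n. f (Z i \<omega>)) - of_nat n * ?m) / of_nat n"
      using n by (simp add: field_simps)
    then have "(cmod (?D \<omega>))\<^sup>2 = (cmod ((\<Sum>i<n. f (Z i \<omega>)) - of_nat n * ?m))\<^sup>2 / (real n)\<^sup>2"
      by (simp add: norm_divide power_divide)
    then show ?thesis using int_f by (simp add: cmod_power2)
  qed
  have le: "cmod (?D \<omega>) \<le> ((?R \<omega> + ?I \<omega>) / n + 1) / sqrt n" for \<omega>
  proof -
    let ?s = "sqrt n" and ?d = "cmod (?D \<omega>)"
    have s: "0 < ?s" "?s * ?s = n" using n by auto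
    have "0 \<le> (?s * ?d - 1)\<^sup>2 + 1 * (?s * ?d)\<^sup>2" by simp
    then have "?s * ?d \<le> (?s * ?d)\<^sup>2 + 1"
      by (simp add: power2_eq_square algebra_simps)
    also have "(?s * ?d)\<^sup>2 = (?R \<omega> + ?I \<omega>) / n"
      using n unfolding power_mult_distrib D2 by (simp add: power2_eq_square[of "real n"])
    finally show ?thesis using s by (simp add: pos_le_divide_eq mult.commute)
  qed
  have "(\<integral>\<^sup>+\<omega>. ennreal (cmod (?D \<omega>)) \<partial>M) \<le> (\<integral>\<^sup>+\<omega>. ennreal (((?R \<omega> + ?I \<omega>) / n + 1) / sqrt n) \<partial>M)"
    by (intro nn_integral_mono ennreal_leI le)
  also have "\<dots> = ennreal (expectation (\<lambda>\<omega>. ((?R \<omega> + ?I \<omega>) / n + 1) / sqrt n))"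
    using R(1) I(1) by (intro nn_integral_eq_integral) auto
  also have "expectation (\<lambda>\<omega>. ((?R \<omega> + ?I \<omega>) / n + 1) / sqrt n) = ((expectation ?R + expectation ?I) / n + 1) / sqrt n"
    using R(1) I(1) by (simp add: prob_space)
  also have "ennreal \<dots> \<le> ennreal (((LINT z|Q. (cmod (f z))\<^sup>2) + 1) / sqrt n)"
  proof (intro ennreal_leI divide_right_mono add_right_mono)
    have "(LINT z|Q. (cmod (f z))\<^sup>2) = (LINT z|Q. (Re (f z))\<^sup>2) + (LINT z|Q. (Im (f z))\<^sup>2)"
      using int_re int_im by (simp add: cmod_power2)
    then have "expectation ?R + expectation ?I \<le> n * (LINT z|Q. (cmod (f z))\<^sup>2)"
      using R(2) I(2) by (simp add: distrib_left)
    then show "(expectation ?R + expectation ?I) / n \<le> (LINT z|Q. (cmod (f z))\<^sup>2)"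
      using n by (simp add: divide_le_eq mult.commute)
  qed simp
  finally show ?thesis .
qed

end

lemma power_inner_le:
  fixes z :: "'a :: real_inner"
  assumes "norm e \<le> 1" "j \<le> p"
  shows "\<bar>e \<bullet> z\<bar> ^ j \<le> (1 + norm z) ^ p"
proof -
  have "\<bar>e \<bullet> z\<bar> \<le> norm e * norm z" by (rule Cauchy_Schwarz_ineq2)
  also have "\<dots> \<le> 1 * norm z" using assms by (intro mult_right_mono) auto
  finally have "\<bar>e \<bullet> z\<bar> ^ j \<le> (1 + norm z) ^ j" by (intro power_mono) auto
  also have "\<dots> \<le> (1 + norm z) ^ p" using assms by (intro power_increasing) auto
  finally show ?thesis .
qed

context iid_sample
begin

text \<open>The \<open>j\<close>-th derivative in direction \<open>e\<close> of the empirical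
  characteristic function, written in the increments.\<close>

definition sample_moment :: "plane \<Rightarrow> nat \<Rightarrow> nat \<Rightarrow> plane \<Rightarrow> 'w \<Rightarrow> complex" where
  "sample_moment e j n u \<omega> =
    (\<Sum>i<n. (\<i> * complex_of_real (e \<bullet> Z i \<omega>)) ^ j * iexp (u \<bullet> Z i \<omega>)) / of_nat n"

text \<open>Not a number of observations but an empirical moment: it dominates the sample moments up
  to order four and is a Lipschitz constant of the empirical characteristic function.\<close>

definition sample_size :: "nat \<Rightarrow> 'w \<Rightarrow> real" where
  "sample_size n \<omega> = (\<Sum>i<n. (1 + norm (Z i \<omega>)) ^ 4) / n"

lemma sample_size_measurable [measurable]: "sample_size n \<in> borel_measurable M"
  unfolding sample_size_def by measurable

lemma sample_moment_le:
  assumes "norm e \<le> 1" "j \<le> 4"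
  shows "cmod (sample_moment e j n u \<omega>) \<le> sample_size n \<omega>"
proof -
  have "cmod (\<Sum>i<n. (\<i> * complex_of_real (e \<bullet> Z i \<omega>)) ^ j * iexp (u \<bullet> Z i \<omega>)) \<le> (\<Sum>i<n. (1 + norm (Z i \<omega>)) ^ 4)"
    by (rule order_trans[OF norm_sum sum_mono]) (use power_inner_le[OF assms] in \<open>simp add: norm_mult norm_power\<close>)
  then show ?thesis by (simp add: sample_moment_def sample_size_def norm_divide divide_right_mono)
qed

end

text \<open>Order eight, because the variances involve squares of terms of order four.\<close>

locale iid_sample_8 = iid_sample M Z Q for M :: "'w measure" and Z Q +
  assumes moment8: "integrable Q (\<lambda>z. (1 + norm z) ^ 8)"
begin

definition B8 :: real where "B8 = (LINT z|Q. (1 + norm z) ^ 8)"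

lemma B8_ge_1: "1 \<le> B8"
proof -
  have "(LINT z|Q. 1) \<le> B8" unfolding B8_def
    by (rule integral_mono) (use moment8 in \<open>auto intro: one_le_power\<close>)
  then show ?thesis by (simp add: Q.prob_space)
qed

lemma integrable_Q_bounded_by:
  fixes f :: "plane \<Rightarrow> 'b :: {banach, second_countable_topology}"
  assumes "f \<in> borel_measurable borel" "\<And>z. norm (f z) \<le> (1 + norm z) ^ 8"
  shows "integrable Q f"
  by (rule Bochner_Integration.integrable_bound[OF moment8]) (use assms in auto)

lemma integral_Q_bounded_by:
  fixes f :: "plane \<Rightarrow> 'b :: {banach, second_countable_topology}"
  assumes "\<And>z. norm (f z) \<le> (1 + norm z) ^ 8"
  shows "norm (LINT z|Q. f z) \<le> B8"
  unfolding B8_def by (rule integral_norm_bound_integral'[OF moment8 assms])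

lemma fourier_moment_le:
  assumes "norm e \<le> 1" "j \<le> 8"
  shows "cmod (fourier_moment Q e j u) \<le> B8"
  unfolding fourier_moment_def
  by (rule integral_Q_bounded_by) (use power_inner_le[OF assms] in \<open>simp add: norm_mult norm_power\<close>)

lemma nn_integral_sample_size_le:
  assumes n: "0 < n"
  shows "(\<integral>\<^sup>+\<omega>. ennreal (sample_size n \<omega>) \<partial>M) \<le> ennreal B8"
proof -
  have int: "integrable Q (\<lambda>z. (1 + norm z) ^ 4)"
    by (rule integrable_Q_bounded_by) (auto intro: power_increasing)
  have int_Z: "integrable M (\<lambda>\<omega>. (1 + norm (Z i \<omega>)) ^ 4)" for i
    using int integrable_Z_iff[of "\<lambda>z. (1 + norm z) ^ 4" i] by simp
  have "(\<integral>\<^sup>+\<omega>. ennreal (sample_size n \<omega>) \<partial>M) = ennreal (expectation (sample_size n))"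
    unfolding sample_size_def using int_Z by (intro nn_integral_eq_integral) (auto intro!: AE_I2 divide_nonneg_nonneg sum_nonneg)
  also have "expectation (sample_size n) = (LINT z|Q. (1 + norm z) ^ 4)"
    unfolding sample_size_def using int_Z n expectation_Z[of "\<lambda>z. (1 + norm z) ^ 4"] by simp
  also have "\<dots> \<le> B8"
    using integral_Q_bounded_by[of "\<lambda>z. (1 + norm z) ^ 4"] by (simp add: power_increasing abs_le_iff)
  finally show ?thesis by (simp add: ennreal_leI)
qed

text \<open>The modulus of the summands does not depend on \<open>u\<close>, which makes the
  mean-square argument uniform in the frequency.\<close>

lemma sample_moment_deviation:
  assumes e: "norm e \<le> 1" and j: "j \<le> 4" and n: "0 < n"
  shows "(\<integral>\<^sup>+\<omega>. ennreal (cmod (sample_moment e j n u \<omega> - fourier_moment Q e j u)) \<partial>M) \<le> ennreal ((B8 + 1) / sqrt n)"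
proof -
  let ?f = "\<lambda>z. (\<i> * complex_of_real (e \<bullet> z)) ^ j * iexp (u \<bullet> z)"
  have sq: "(cmod (?f z))\<^sup>2 \<le> (1 + norm z) ^ 8" for z
    using power_inner_le[OF e, of "j * 2" 8 z] j by (simp add: norm_mult norm_power power_mult)
  have "(\<integral>\<^sup>+\<omega>. ennreal (cmod (sample_moment e j n u \<omega> - fourier_moment Q e j u)) \<partial>M) \<le> ennreal (((LINT z|Q. (cmod (?f z))\<^sup>2) + 1) / sqrt n)"
    unfolding sample_moment_def fourier_moment_def
    by (rule sample_mean_deviation[OF _ _ n]) (use sq in \<open>auto intro!: integrable_Q_bounded_by\<close>)
  also have "\<dots> \<le> ennreal ((B8 + 1) / sqrt n)"
    using integral_Q_bounded_by[of "\<lambda>z. (cmod (?f z))\<^sup>2"] sq by (intro ennreal_leI divide_right_mono add_right_mono) (auto simp: abs_le_iff)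
  finally show ?thesis .
qed

text \<open>Ten terms, for two directions and the orders 0 to 4: all the quantities that enter the
  two fourth logarithmic derivatives.\<close>

definition deviation :: "nat \<Rightarrow> plane \<Rightarrow> 'w \<Rightarrow> real" where
  "deviation n u \<omega> = (\<Sum>e\<in>{(1, 0), (0, 1)}. \<Sum>j\<le>4. cmod (sample_moment e j n u \<omega> - fourier_moment Q e j u))"

lemma sample_moment_pair_measurable [measurable]:
  "(\<lambda>(u, \<omega>). sample_moment e j n u \<omega>) \<in> borel_measurable (lborel \<Otimes>\<^sub>M M)"
  unfolding sample_moment_def by measurable

lemma fourier_moment_Q_measurable [measurable]: "fourier_moment Q e j \<in> borel_measurable borel"
  unfolding fourier_moment_def[abs_def] by measurable

lemma deviation_pair_measurable [measurable]:
  "(\<lambda>(u, \<omega>). deviation n u \<omega>) \<in> borel_measurable (lborel \<Otimes>\<^sub>M M)"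
  unfolding deviation_def by measurable

text \<open>Kept in \<open>ennreal\<close> so that Tonelli's theorem applies without prior
  integrability.\<close>

definition weighted_deviation :: "real \<Rightarrow> nat \<Rightarrow> 'w \<Rightarrow> ennreal" where
  "weighted_deviation h n \<omega> = (\<integral>\<^sup>+u. ennreal (indicator (freq_box h) u * freq_weight u * deviation n u \<omega>) \<partial>lborel)"

lemma pair_sigma_finite_lborel_M: "pair_sigma_finite (lborel :: plane measure) M"
  by unfold_locales

lemma weighted_deviation_measurable [measurable]: "weighted_deviation h n \<in> borel_measurable M"
proof -
  interpret p: pair_sigma_finite "lborel :: plane measure" M by (rule pair_sigma_finite_lborel_M)
  have "(\<lambda>(u, \<omega>). ennreal (indicator (freq_box h) u * freq_weight u * deviation n u \<omega>)) \<in> borel_measurable (lborel \<Otimes>\<^sub>M M)"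
    by measurable
  from measurable_pair_swap[OF this]
  have "(\<lambda>(\<omega>, u). ennreal (indicator (freq_box h) u * freq_weight u * deviation n u \<omega>)) \<in> borel_measurable (M \<Otimes>\<^sub>M lborel)"
    by (simp add: case_prod_beta)
  then show ?thesis
    unfolding weighted_deviation_def[abs_def] by (rule lborel.borel_measurable_nn_integral)
qed

text \<open>Exchanging expectation and frequency integral leaves the pointwise rate times the
  integral of the decay profile; 10 is the number of terms in \<open>deviation\<close>.\<close>

lemma weighted_deviation_expectation:
  assumes h: "0 < h" and n: "0 < n"
  shows "(\<integral>\<^sup>+\<omega>. weighted_deviation h n \<omega> \<partial>M) \<le> ennreal (10 * (B8 + 1) / sqrt n * (2 * ln (1 + 1 / h))\<^sup>2)"
proof -
  interpret p: pair_sigma_finite "lborel :: plane measure" M by (rule pair_sigma_finite_lborel_M)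
  let ?i = "\<lambda>u. indicator (freq_box h) u * freq_weight u"
  have i_nonneg: "0 \<le> ?i u" for u using freq_weight_bounds(1)[of u] by (simp add: less_imp_le)
  have dev: "(\<integral>\<^sup>+\<omega>. ennreal (deviation n u \<omega>) \<partial>M) \<le> ennreal (10 * (B8 + 1) / sqrt n)" for u
  proof -
    have [measurable]: "sample_moment e j n u \<in> borel_measurable M" for e j
      unfolding sample_moment_def[abs_def] by measurable
    have "(\<integral>\<^sup>+\<omega>. ennreal (deviation n u \<omega>) \<partial>M) = (\<Sum>e\<in>{(1, 0), (0, 1)}. \<Sum>j\<le>4. (\<integral>\<^sup>+\<omega>. ennreal (cmod (sample_moment e j n u \<omega> - fourier_moment Q e j u)) \<partial>M))"
      unfolding deviation_def
      by (subst nn_integral_sum[symmetric], measurable)+ (simp only: sum_ennreal[symmetric] sum_nonneg norm_ge_zero nn_integral_sum[symmetric])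
    also have "\<dots> \<le> (\<Sum>e\<in>{(1, 0), (0, 1) :: plane}. \<Sum>j\<le>4::nat. ennreal ((B8 + 1) / sqrt n))"
      by (intro sum_mono sample_moment_deviation n) auto
    also have "\<dots> = ennreal (10 * (B8 + 1) / sqrt n)"
      using B8_ge_1 by (simp add: ennreal_plus[symmetric] ennreal_mult'[symmetric] field_simps del: ennreal_plus flip: ennreal_numeral)
    finally show ?thesis .
  qed
  have "(\<integral>\<^sup>+\<omega>. weighted_deviation h n \<omega> \<partial>M) = (\<integral>\<^sup>+u. \<integral>\<^sup>+\<omega>. ennreal (?i u * deviation n u \<omega>) \<partial>M \<partial>lborel)"
    unfolding weighted_deviation_def by (rule p.Fubini') measurable
  also have "\<dots> = (\<integral>\<^sup>+u. ennreal (?i u) * (\<integral>\<^sup>+\<omega>. ennreal (deviation n u \<omega>) \<partial>M) \<partial>lborel)"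
  proof (intro nn_integral_cong)
    fix u :: plane
    have [measurable]: "deviation n u \<in> borel_measurable M"
      unfolding deviation_def[abs_def] sample_moment_def by measurable
    show "(\<integral>\<^sup>+\<omega>. ennreal (?i u * deviation n u \<omega>) \<partial>M) = ennreal (?i u) * (\<integral>\<^sup>+\<omega>. ennreal (deviation n u \<omega>) \<partial>M)"
      by (subst nn_integral_cmult[symmetric]) (auto simp: ennreal_mult'[OF i_nonneg])
  qed
  also have "\<dots> \<le> (\<integral>\<^sup>+u. ennreal (?i u) * ennreal (10 * (B8 + 1) / sqrt n) \<partial>lborel)"
    by (intro nn_integral_mono mult_left_mono dev) auto
  also have "\<dots> = (\<integral>\<^sup>+u. ennreal (?i u) \<partial>lborel) * ennreal (10 * (B8 + 1) / sqrt n)"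
    by (rule nn_integral_multc) measurable
  also have "\<dots> = ennreal ((2 * ln (1 + 1 / h))\<^sup>2) * ennreal (10 * (B8 + 1) / sqrt n)"
    by (simp only: nn_integral_freq_weight_box[OF h])
  also have "\<dots> = ennreal (10 * (B8 + 1) / sqrt n * (2 * ln (1 + 1 / h))\<^sup>2)"
    by (subst ennreal_mult'[symmetric]) (auto simp: mult.commute)
  finally show ?thesis .
qed

section \<open>Uniform closeness of the empirical characteristic function\<close>

text \<open>Hoeffding's inequality for the real and the imaginary part, each at level c / 2. The
  summands lie in an interval of length 2, so the exponent is 2 (n c / 2)^2 / (4 n) = n c^2 /
  8.\<close>

lemma cf_pointwise_deviation:
  assumes c: "0 < c" and n: "0 < n"
  shows "prob {\<omega> \<in> space M. c \<le> cmod (sample_moment e 0 n u \<omega> - fourier_moment Q e 0 u)} \<le> 4 * exp (- (real n * c\<^sup>2 / 8))"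
proof -
  have one: "prob {\<omega> \<in> space M. c / 2 \<le> \<bar>(\<Sum>i<n. f (Z i \<omega>)) / n - (LINT z|Q. f z)\<bar>} \<le> 2 * exp (- (real n * c\<^sup>2 / 8))"
    if f [measurable]: "f \<in> borel_measurable borel" and f_le: "\<And>z. \<bar>f z\<bar> \<le> 1" for f :: "plane \<Rightarrow> real"
  proof -
    have "indep_vars (\<lambda>_. borel) (\<lambda>i. f \<circ> Z i) {..<n}"
      by (rule indep_vars_compose[OF indep]) measurable
    then have ind: "indep_vars (\<lambda>_. borel) (\<lambda>i \<omega>. f (Z i \<omega>)) {..<n}" by (simp add: comp_def)
    interpret H: Hoeffding_ineq M "{..<n}" "\<lambda>i \<omega>. f (Z i \<omega>)" "\<lambda>_. -1" "\<lambda>_. 1" "\<Sum>i<n. expectation (\<lambda>\<omega>. f (Z i \<omega>))"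
    proof unfold_locales
      show "AE \<omega> in M. f (Z i \<omega>) \<in> {-1..1}" for i
      proof (rule AE_I2)
        show "f (Z i \<omega>) \<in> {-1..1}" for \<omega> using f_le[of "Z i \<omega>"] by auto
      qed
    qed (use ind in auto)
    have mu: "(\<Sum>i<n. expectation (\<lambda>\<omega>. f (Z i \<omega>))) = n * (LINT z|Q. f z)"
      by (simp add: expectation_Z)
    have "prob {\<omega> \<in> space M. n * c / 2 \<le> \<bar>(\<Sum>i<n. f (Z i \<omega>)) - n * (LINT z|Q. f z)\<bar>} \<le> 2 * exp (- 2 * (n * c / 2)\<^sup>2 / (\<Sum>i<n. (1 - (- 1))\<^sup>2))"
      using H.Hoeffding_ineq_abs_ge[of "n * c / 2"] c n unfolding mu by simp
    moreover have "- 2 * (n * c / 2)\<^sup>2 / (\<Sum>i<n. (1 - (- 1))\<^sup>2) = - (real n * c\<^sup>2 / 8)"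
      using n by (simp add: power2_eq_square)
    moreover have "(n * c / 2 \<le> \<bar>s - n * m\<bar>) = (c / 2 \<le> \<bar>s / n - m\<bar>)" for s m :: real
    proof -
      have "s - n * m = n * (s / n - m)" using n by (simp add: right_diff_distrib)
      then have "\<bar>s - n * m\<bar> = n * \<bar>s / n - m\<bar>" by (simp only: abs_mult abs_of_nat)
      moreover have "n * c / 2 = n * (c / 2)" by simp
      ultimately show ?thesis using n by (simp only: mult_le_cancel_left_pos of_nat_0_less_iff)
    qed
    ultimately show ?thesis by (simp only:)
  qed
  let ?D = "\<lambda>\<omega>. sample_moment e 0 n u \<omega> - fourier_moment Q e 0 u"
  let ?R = "{\<omega> \<in> space M. c / 2 \<le> \<bar>(\<Sum>i<n. Re (iexp (u \<bullet> Z i \<omega>))) / n - (LINT z|Q. Re (iexp (u \<bullet> z)))\<bar>}"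
  let ?I = "{\<omega> \<in> space M. c / 2 \<le> \<bar>(\<Sum>i<n. Im (iexp (u \<bullet> Z i \<omega>))) / n - (LINT z|Q. Im (iexp (u \<bullet> z)))\<bar>}"
  have int: "integrable Q (\<lambda>z. iexp (u \<bullet> z))"
    by (rule Q.integrable_const_bound[of _ 1]) auto
  have Re_D: "Re (?D \<omega>) = (\<Sum>i<n. Re (iexp (u \<bullet> Z i \<omega>))) / n - (LINT z|Q. Re (iexp (u \<bullet> z)))" for \<omega>
    unfolding sample_moment_def fourier_moment_def using int by (simp add: Re_divide_of_nat)
  have Im_D: "Im (?D \<omega>) = (\<Sum>i<n. Im (iexp (u \<bullet> Z i \<omega>))) / n - (LINT z|Q. Im (iexp (u \<bullet> z)))" for \<omega>
    unfolding sample_moment_def fourier_moment_def using int by (simp add: Im_divide_of_nat)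
  have "{\<omega> \<in> space M. c \<le> cmod (?D \<omega>)} \<subseteq> ?R \<union> ?I"
  proof
    fix \<omega> assume "\<omega> \<in> {\<omega> \<in> space M. c \<le> cmod (?D \<omega>)}"
    then have "\<omega> \<in> space M" "c \<le> \<bar>Re (?D \<omega>)\<bar> + \<bar>Im (?D \<omega>)\<bar>"
      using cmod_le[of "?D \<omega>"] by auto
    moreover have "c \<le> x + y \<Longrightarrow> c / 2 \<le> x \<or> c / 2 \<le> y" for x y :: real by linarith
    ultimately show "\<omega> \<in> ?R \<union> ?I" unfolding Re_D Im_D by blast
  qed
  then have "prob {\<omega> \<in> space M. c \<le> cmod (?D \<omega>)} \<le> prob (?R \<union> ?I)"
    by (rule finite_measure_mono) measurable
  also have "\<dots> \<le> prob ?R + prob ?I" by (rule measure_Un_le) measurable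
  also have "\<dots> \<le> 2 * exp (- (real n * c\<^sup>2 / 8)) + 2 * exp (- (real n * c\<^sup>2 / 8))"
    by (intro add_mono one) (auto intro: order_trans[OF abs_Re_le_cmod] order_trans[OF abs_Im_le_cmod])
  finally show ?thesis by simp
qed

lemma norm_iexp_diff_inner_le: "cmod (iexp (u \<bullet> z) - iexp (p \<bullet> z)) \<le> norm (u - p) * norm z"
  for u p z :: plane
proof -
  have "iexp (u \<bullet> z) - iexp (p \<bullet> z) = iexp (p \<bullet> z) * (iexp ((u - p) \<bullet> z) - 1)"
    by (simp add: inner_diff_left right_diff_distrib exp_diff)
  then have "cmod (iexp (u \<bullet> z) - iexp (p \<bullet> z)) = cmod (iexp ((u - p) \<bullet> z) - 1)"
    by (simp add: norm_mult)
  also have "\<dots> \<le> \<bar>(u - p) \<bullet> z\<bar>" by (rule norm_iexp_diff_le)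
  also have "\<dots> \<le> norm (u - p) * norm z" by (rule Cauchy_Schwarz_ineq2)
  finally show ?thesis .
qed

lemma sample_cf_lipschitz:
  "cmod (sample_moment e 0 n u \<omega> - sample_moment e 0 n p \<omega>) \<le> norm (u - p) * sample_size n \<omega>"
proof -
  have "cmod (\<Sum>i<n. iexp (u \<bullet> Z i \<omega>) - iexp (p \<bullet> Z i \<omega>)) \<le> (\<Sum>i<n. norm (u - p) * (1 + norm (Z i \<omega>)) ^ 4)"
  proof (rule order_trans[OF norm_sum sum_mono])
    fix i
    have "norm (Z i \<omega>) \<le> (1 + norm (Z i \<omega>)) ^ 1" by simp
    also have "\<dots> \<le> (1 + norm (Z i \<omega>)) ^ 4" by (rule power_increasing) auto
    finally show "cmod (iexp (u \<bullet> Z i \<omega>) - iexp (p \<bullet> Z i \<omega>)) \<le> norm (u - p) * (1 + norm (Z i \<omega>)) ^ 4"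
      by (intro order_trans[OF norm_iexp_diff_inner_le] mult_left_mono) auto
  qed
  then show ?thesis
    by (simp add: sample_moment_def sample_size_def sum_subtractf sum_distrib_left norm_divide divide_right_mono flip: diff_divide_distrib)
qed

lemma cf_lipschitz: "cmod (fourier_moment Q e 0 u - fourier_moment Q e 0 p) \<le> norm (u - p) * B8"
proof -
  have int: "integrable Q (\<lambda>z. iexp (v \<bullet> z))" for v :: plane
    by (rule Q.integrable_const_bound[of _ 1]) auto
  have "cmod (LINT z|Q. iexp (u \<bullet> z) - iexp (p \<bullet> z)) \<le> (LINT z|Q. norm (u - p) * (1 + norm z) ^ 8)"
  proof (rule integral_norm_bound_integral'[OF integrable_mult_right[OF moment8]])
    fix z :: plane
    have "norm z \<le> (1 + norm z) ^ 1" by simp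
    also have "\<dots> \<le> (1 + norm z) ^ 8" by (rule power_increasing) auto
    finally show "cmod (iexp (u \<bullet> z) - iexp (p \<bullet> z)) \<le> norm (u - p) * (1 + norm z) ^ 8"
      by (intro order_trans[OF norm_iexp_diff_inner_le] mult_left_mono) auto
  qed
  then show ?thesis
    using int by (simp add: fourier_moment_def B8_def)
qed

text \<open>A grid of fixed mesh in a box of side 2 sqrt n has order n points, too few to offset an
  exponentially small probability. Between grid points the empirical function is Lipschitz with the
  random constant \<open>sample_size\<close>, whose bound therefore remains a premise outside the
  exceptional set \<open>G\<close>.\<close>

lemma cf_uniform_deviation:
  assumes c: "0 < c" and M1: "0 \<le> M1"
  obtains p where "p \<longlonglongrightarrow> 0"
    and "\<And>n. 0 < n \<Longrightarrow> \<exists>G\<in>sets M. prob G \<le> p n \<and>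
      (\<forall>\<omega>\<in>space M - G. sample_size n \<omega> \<le> M1 \<longrightarrow>
        (\<forall>u\<in>freq_box (1 / sqrt n). cmod (sample_moment e 0 n u \<omega> - fourier_moment Q e 0 u) < c))"
proof
  \<comment> \<open>Moving to a grid point within distance 2 \<eta> costs at most 2 \<eta> (M1 + B8)
    = c / 2; the other half of \<open>c\<close> is the error allowed at the grid point.\<close>
  define \<eta> where "\<eta> = c / (4 * (M1 + B8))"
  have MB: "0 < M1 + B8" using M1 B8_ge_1 by simp
  have \<eta>: "0 < \<eta>" unfolding \<eta>_def using c MB by simp
  have \<eta>_eq: "2 * \<eta> * (M1 + B8) = c / 2" 
  proof -
    have "2 * (c / (4 * x)) * x = c / 2" if "0 < x" for x using that by simp
    from this[OF MB] show ?thesis unfolding \<eta>_def .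
  qed
  \<comment> \<open>A bound for the number of grid points, times the tail bound at level c /
    2.\<close>
  let ?p = "\<lambda>n. (2 * (sqrt (real n) / \<eta> + 1) + 1)\<^sup>2 * (4 * exp (- (real n * (c / 2)\<^sup>2 / 8)))"
  show "?p \<longlonglongrightarrow> 0" using \<eta> c by real_asymp
  fix n :: nat assume n: "0 < n"
  let ?D = "\<lambda>u \<omega>. sample_moment e 0 n u \<omega> - fourier_moment Q e 0 u"
  define N where "N = \<lceil>sqrt (real n) / \<eta>\<rceil>"
  have N: "0 \<le> N" "real_of_int N \<le> sqrt (real n) / \<eta> + 1" "sqrt (real n) / \<eta> \<le> N"
  proof -
    have nn: "0 \<le> sqrt (real n) / \<eta>" using \<eta> by simp
    show "0 \<le> N" unfolding N_def zero_le_ceiling using nn by linarith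
  qed (auto simp: N_def)
  define grid where "grid = (\<lambda>(i, j). (\<eta> * real_of_int i, \<eta> * real_of_int j)) ` ({- N..N} \<times> {- N..N})"
  define bad where "bad u = {\<omega> \<in> space M. c / 2 \<le> cmod (?D u \<omega>)}" for u
  have [measurable]: "sample_moment e 0 n u \<in> borel_measurable M" for u
    unfolding sample_moment_def[abs_def] by measurable
  have bad_sets: "bad u \<in> sets M" for u unfolding bad_def by measurable
  have fin: "finite grid" unfolding grid_def by simp
  have card: "real (card grid) \<le> (2 * (sqrt (real n) / \<eta> + 1) + 1)\<^sup>2"
  proof -
    have "card grid \<le> card ({- N..N} \<times> {- N..N})" unfolding grid_def by (rule card_image_le) simp
    also have "\<dots> = (nat (2 * N + 1))\<^sup>2" by (simp add: card_cartesian_product power2_eq_square)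
    finally have "real (card grid) \<le> (real (nat (2 * N + 1)))\<^sup>2" by (metis of_nat_le_iff of_nat_power)
    also have "\<dots> \<le> (2 * (sqrt (real n) / \<eta> + 1) + 1)\<^sup>2"
      using N by (intro power_mono) auto
    finally show ?thesis .
  qed
  show "\<exists>G\<in>sets M. prob G \<le> ?p n \<and> (\<forall>\<omega>\<in>space M - G. sample_size n \<omega> \<le> M1 \<longrightarrow>
        (\<forall>u\<in>freq_box (1 / sqrt n). cmod (?D u \<omega>) < c))"
  proof (intro bexI conjI ballI impI)
    show "(\<Union>u\<in>grid. bad u) \<in> sets M" using fin bad_sets by auto
    have "prob (\<Union>u\<in>grid. bad u) \<le> (\<Sum>u\<in>grid. prob (bad u))"
      by (rule measure_UNION_le) (use fin bad_sets in auto)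
    also have "\<dots> \<le> (\<Sum>u\<in>grid. 4 * exp (- (real n * (c / 2)\<^sup>2 / 8)))"
      unfolding bad_def by (intro sum_mono cf_pointwise_deviation n) (use c in simp)
    also have "\<dots> = real (card grid) * (4 * exp (- (real n * (c / 2)\<^sup>2 / 8)))" by simp
    also have "\<dots> \<le> ?p n" by (intro mult_right_mono card) simp
    finally show "prob (\<Union>u\<in>grid. bad u) \<le> ?p n" .
    fix \<omega> u assume \<omega>: "\<omega> \<in> space M - (\<Union>u\<in>grid. bad u)" and size: "sample_size n \<omega> \<le> M1" and u: "u \<in> freq_box (1 / sqrt n)"
    \<comment> \<open>Rounding down moves each coordinate by at most \<eta>.\<close>
    define i j where "i = \<lfloor>fst u / \<eta>\<rfloor>" and "j = \<lfloor>snd u / \<eta>\<rfloor>"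
    define q :: plane where "q = (\<eta> * i, \<eta> * j)"
    have in_range: "\<lfloor>x / \<eta>\<rfloor> \<in> {- N..N}" and near: "\<bar>x - \<eta> * \<lfloor>x / \<eta>\<rfloor>\<bar> \<le> \<eta>" if "\<bar>x\<bar> \<le> sqrt n" for x
    proof -
      have "\<bar>x / \<eta>\<bar> \<le> N" using that \<eta> N(3) by (auto simp: abs_divide intro: order_trans[OF divide_right_mono])
      then have "- real_of_int N \<le> x / \<eta>" "x / \<eta> \<le> real_of_int N" by linarith+
      then show "\<lfloor>x / \<eta>\<rfloor> \<in> {- N..N}" by (simp add: le_floor_iff floor_le_iff)
      have "\<bar>x / \<eta> - \<lfloor>x / \<eta>\<rfloor>\<bar> \<le> 1" by linarith
      then have "\<eta> * \<bar>x / \<eta> - \<lfloor>x / \<eta>\<rfloor>\<bar> \<le> \<eta> * 1" using \<eta> by (intro mult_left_mono) auto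
      moreover have "\<eta> * \<bar>x / \<eta> - \<lfloor>x / \<eta>\<rfloor>\<bar> = \<bar>\<eta> * (x / \<eta> - \<lfloor>x / \<eta>\<rfloor>)\<bar>" using \<eta> by (simp add: abs_mult)
      ultimately show "\<bar>x - \<eta> * \<lfloor>x / \<eta>\<rfloor>\<bar> \<le> \<eta>" using \<eta> by (simp add: right_diff_distrib)
    qed
    have u': "\<bar>fst u\<bar> \<le> sqrt n" "\<bar>snd u\<bar> \<le> sqrt n"
      using u by (auto simp: freq_box_def mem_Times_iff abs_le_iff)
    have q_grid: "q \<in> grid"
      unfolding grid_def q_def i_def j_def using in_range[OF u'(1)] in_range[OF u'(2)] by (intro image_eqI[where x = "(\<lfloor>fst u / \<eta>\<rfloor>, \<lfloor>snd u / \<eta>\<rfloor>)"]) auto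
    have dist: "norm (u - q) \<le> 2 * \<eta>"
      using sqrt_sum_squares_le_sum_abs[of "fst (u - q)" "snd (u - q)"] near[OF u'(1)] near[OF u'(2)]
      by (simp add: norm_prod_def q_def i_def j_def)
    have "cmod (?D q \<omega>) < c / 2" using \<omega> q_grid by (auto simp: bad_def)
    moreover have "?D u \<omega> = (sample_moment e 0 n u \<omega> - sample_moment e 0 n q \<omega>) + (?D q \<omega> - (fourier_moment Q e 0 u - fourier_moment Q e 0 q))"
      by simp
    then have "cmod (?D u \<omega>) \<le> cmod (sample_moment e 0 n u \<omega> - sample_moment e 0 n q \<omega>) + (cmod (?D q \<omega>) + cmod (fourier_moment Q e 0 u - fourier_moment Q e 0 q))"
      by (metis norm_triangle_le norm_triangle_ineq4 add_left_mono)
    moreover have "cmod (sample_moment e 0 n u \<omega> - sample_moment e 0 n q \<omega>) \<le> 2 * \<eta> * M1"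
      by (rule order_trans[OF sample_cf_lipschitz mult_mono[OF dist size]]) (use \<eta> in \<open>auto simp: sample_size_def intro!: divide_nonneg_nonneg sum_nonneg\<close>)
    moreover have "cmod (fourier_moment Q e 0 u - fourier_moment Q e 0 q) \<le> 2 * \<eta> * B8"
      by (rule order_trans[OF cf_lipschitz mult_right_mono[OF dist]]) (use B8_ge_1 in simp)
    ultimately show "cmod (?D u \<omega>) < c"
      using \<eta>_eq by (simp add: distrib_left)
  qed
qed

end

section \<open>The compound Poisson sample\<close>

locale cpp_model = jump_measure \<nu> \<Lambda> for \<nu> :: "plane measure" and \<Lambda> :: real +
  fixes P :: "'w measure" and X :: "real \<Rightarrow> 'w \<Rightarrow> plane" and \<alpha> :: plane
  assumes X: "compound_poisson_with_drift P X \<alpha> \<nu>"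
    and moment8_nu: "integrable \<nu> (\<lambda>x. (1 + norm x) ^ 8)"
begin

definition Q :: "plane measure" where "Q = distr P borel (X 1)"
text \<open>Indexed from 0, whereas the sum in \<open>emp_cf\<close> starts at 1.\<close>

definition increment :: "nat \<Rightarrow> 'w \<Rightarrow> plane" where "increment i \<omega> = X (real (Suc i)) \<omega> - X (real i) \<omega>"
definition \<phi> :: "plane \<Rightarrow> complex" where "\<phi> = cpp_cf \<alpha> \<nu> 1"

lemma levy: "levy_process P X"
  using X by (simp add: compound_poisson_with_drift_def)

lemma prob_space_P: "prob_space P"
  using levy by (simp add: levy_process_def)

lemma X_measurable: "0 \<le> t \<Longrightarrow> X t \<in> borel_measurable P"
  using levy by (simp add: levy_process_def)

sublocale Q: prob_space Q
  unfolding Q_def by (rule prob_space.prob_space_distr[OF prob_space_P X_measurable]) simp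

lemma sets_Q [simp, measurable_cong]: "sets Q = sets borel"
  by (simp add: Q_def)

lemma fourier_measure_Q: "fourier_measure Q = \<phi>"
  using X by (auto simp: compound_poisson_with_drift_def Q_def \<phi>_def)

lemma integrable_nu_bounded_by:
  fixes f :: "plane \<Rightarrow> 'b :: {banach, second_countable_topology}"
  assumes "f \<in> borel_measurable borel" "\<And>x. norm (f x) \<le> (1 + norm x) ^ 8"
  shows "integrable \<nu> f"
  by (rule Bochner_Integration.integrable_bound[OF moment8_nu])
     (use assms in \<open>auto simp: measurable_cong_sets[OF sets_nu refl]\<close>)

lemma inner_nu_measurable [measurable]: "(\<lambda>x. e \<bullet> x) \<in> borel_measurable \<nu>"
  unfolding measurable_cong_sets[OF sets_nu refl]
  by (intro borel_measurable_continuous_onI continuous_intros)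

lemma inner_Q_measurable [measurable]: "(\<lambda>x. e \<bullet> x) \<in> borel_measurable Q"
  unfolding measurable_cong_sets[OF sets_Q refl]
  by (intro borel_measurable_continuous_onI continuous_intros)

lemma integrable_iexp_nu: "integrable \<nu> (\<lambda>x. iexp (u \<bullet> x))"
  by (rule integrable_const_bound[of _ 1]) auto

section \<open>Moments and independence of the increments\<close>

text \<open>The projection of the increment to direction \<open>e\<close> has a real compound
  Poisson law, with the image of the normalised \<nu> as jump law and drift
  \<open>e \<bullet> \<alpha>\<close>, so the one-dimensional moment result applies.\<close>

lemma integrable_power_inner_Q:
  assumes e: "norm e \<le> 1"
  shows "integrable Q (\<lambda>z. \<bar>e \<bullet> z\<bar> ^ 8)"
proof -
  let ?\<nu> = "density \<nu> (\<lambda>_. ennreal (1 / \<Lambda>))"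
  define J where "J = distr ?\<nu> borel (\<lambda>x. e \<bullet> x)"
  define R where "R = distr Q borel (\<lambda>x. e \<bullet> x)"
  have meas [measurable]: "(\<lambda>x. e \<bullet> x) \<in> borel_measurable ?\<nu>" by simp
  have "prob_space ?\<nu>"
  proof (rule prob_spaceI)
    have "emeasure ?\<nu> (space ?\<nu>) = ennreal (1 / \<Lambda>) * emeasure \<nu> UNIV"
      by (simp add: emeasure_density nn_integral_cmult_indicator)
    also have "\<dots> = ennreal (1 / \<Lambda> * \<Lambda>)"
      unfolding total using Lambda_pos by (subst ennreal_mult) auto
    finally show "emeasure ?\<nu> (space ?\<nu>) = 1" using Lambda_pos by simp
  qed
  then interpret N: prob_space ?\<nu> .
  interpret J: real_distribution J
    unfolding J_def by (rule N.real_distribution_distr[OF meas])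
  have R: "real_distribution R"
    unfolding R_def by (rule Q.real_distribution_distr) measurable
  have char_J: "char J t = (LINT x|\<nu>. iexp ((t *\<^sub>R e) \<bullet> x)) / \<Lambda>" for t
  proof -
    have "char J t = (LINT x|?\<nu>. iexp (t * (e \<bullet> x)))"
      unfolding char_def J_def by (rule integral_distr[OF meas]) measurable
    also have "\<dots> = (LINT x|\<nu>. (1 / \<Lambda>) *\<^sub>R iexp (t * (e \<bullet> x)))"
      using Lambda_pos by (intro integral_density) auto
    finally show ?thesis by (simp add: scaleR_conv_of_real divide_inverse mult.commute)
  qed
  have "char R t = exp (\<i> * complex_of_real (t * (e \<bullet> \<alpha>)) + complex_of_real \<Lambda> * (char J t - 1))" for t
  proof -
    have "char R t = (LINT x|Q. iexp (t * (e \<bullet> x)))"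
      unfolding char_def R_def by (rule integral_distr) measurable
    also have "\<dots> = \<phi> (t *\<^sub>R e)"
      using fun_cong[OF fourier_measure_Q, of "t *\<^sub>R e"] by (simp add: fourier_measure_def)
    also have "\<dots> = exp (\<i> * complex_of_real (t * (e \<bullet> \<alpha>)) + ((LINT x|\<nu>. iexp ((t *\<^sub>R e) \<bullet> x)) - \<Lambda>))"
      using integrable_iexp_nu[of "t *\<^sub>R e"] by (simp add: \<phi>_def cpp_cf_def scaleR_conv_of_real)
    also have "(LINT x|\<nu>. iexp ((t *\<^sub>R e) \<bullet> x)) - complex_of_real \<Lambda> = complex_of_real \<Lambda> * (char J t - 1)"
      unfolding char_J using Lambda_pos by (simp add: right_diff_distrib)
    finally show ?thesis .
  qed
  moreover have "integrable J (\<lambda>x. \<bar>x\<bar> ^ 8)"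
  proof -
    have "integrable \<nu> (\<lambda>x. \<bar>e \<bullet> x\<bar> ^ 8)"
      by (rule integrable_nu_bounded_by)
         (use power_inner_le[OF e, of 8 8] in \<open>auto intro!: borel_measurable_continuous_onI continuous_intros\<close>)
    then have "integrable ?\<nu> (\<lambda>x. \<bar>e \<bullet> x\<bar> ^ 8)"
      using Lambda_pos by (subst integrable_density) auto
    then show ?thesis unfolding J_def by (subst integrable_distr_eq[OF meas]) auto
  qed
  ultimately have "integrable R (\<lambda>x. \<bar>x\<bar> ^ 8)"
    by (rule J.compound_poisson_moment[OF R Lambda_pos])
  then show ?thesis unfolding R_def by (subst (asm) integrable_distr_eq) auto
qed

text \<open>Reduced to the coordinate directions: the norm is at most twice the larger coordinate in
  modulus.\<close>

lemma moment8_Q: "integrable Q (\<lambda>z. (1 + norm z) ^ 8)"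
proof (rule Bochner_Integration.integrable_bound)
  show "integrable Q (\<lambda>z. 2 ^ 8 * (1 + 2 ^ 8 * (\<bar>(1, 0) \<bullet> z\<bar> ^ 8 + \<bar>(0, 1) \<bullet> z\<bar> ^ 8)))"
    by (intro integrable_mult_right Bochner_Integration.integrable_add integrable_power_inner_Q) auto
  have "(1 + norm z) ^ 8 \<le> 2 ^ 8 * (1 + 2 ^ 8 * (\<bar>(1, 0) \<bullet> z\<bar> ^ 8 + \<bar>(0, 1) \<bullet> z\<bar> ^ 8))" for z :: plane
  proof -
    have "norm z \<le> \<bar>fst z\<bar> + \<bar>snd z\<bar>"
      using sqrt_sum_squares_le_sum_abs[of "fst z" "snd z"] by (simp add: norm_prod_def)
    also have "\<dots> \<le> 2 * max \<bar>fst z\<bar> \<bar>snd z\<bar>" by (simp add: max_def)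
    finally have "norm z ^ 8 \<le> (2 * max \<bar>fst z\<bar> \<bar>snd z\<bar>) ^ 8" by (intro power_mono) auto
    also have "\<dots> = 2 ^ 8 * max \<bar>fst z\<bar> \<bar>snd z\<bar> ^ 8" by (rule power_mult_distrib)
    also have "max \<bar>fst z\<bar> \<bar>snd z\<bar> ^ 8 \<le> \<bar>fst z\<bar> ^ 8 + \<bar>snd z\<bar> ^ 8" by (simp add: max_def)
    finally have "norm z ^ 8 \<le> 2 ^ 8 * (\<bar>(1, 0) \<bullet> z\<bar> ^ 8 + \<bar>(0, 1) \<bullet> z\<bar> ^ 8)" by (simp add: inner_prod_def)
    then have "2 ^ 8 * (1 + norm z ^ 8) \<le> 2 ^ 8 * (1 + 2 ^ 8 * (\<bar>(1, 0) \<bullet> z\<bar> ^ 8 + \<bar>(0, 1) \<bullet> z\<bar> ^ 8))" by simp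
    then show ?thesis by (rule order_trans[OF power_one_plus_le[OF norm_ge_zero]])
  qed
  then show "AE z in Q. norm ((1 + norm z) ^ 8) \<le> norm (2 ^ 8 * (1 + 2 ^ 8 * (\<bar>(1, 0) \<bullet> z\<bar> ^ 8 + \<bar>(0, 1) \<bullet> z\<bar> ^ 8)))"
    by (intro AE_I2) (simp add: abs_of_nonneg)
qed measurable

sublocale S: iid_sample_8 P increment Q
proof (intro iid_sample_8.intro iid_sample.intro iid_sample_axioms.intro iid_sample_8_axioms.intro prob_space_P moment8_Q)
  fix n
  show "prob_space.indep_vars P (\<lambda>_. borel) increment {..<n}"
  proof -
    have "\<forall>(s :: nat \<Rightarrow> real) m. 0 \<le> s 0 \<and> (\<forall>i<m. s i \<le> s (Suc i)) \<longrightarrow>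
        prob_space.indep_vars P (\<lambda>_. borel) (\<lambda>i \<omega>. X (s (Suc i)) \<omega> - X (s i) \<omega>) {..<m}"
      using levy unfolding levy_process_def by blast
    \<comment> \<open>The increments are taken along the integer times, that is, \<open>s\<close> is
      the embedding \<open>real\<close>.\<close>
    from this[rule_format, of real n] show ?thesis by (simp add: increment_def[abs_def])
  qed
next
  fix i
  have "distr P borel (\<lambda>\<omega>. X (real i + 1) \<omega> - X (real i) \<omega>) = distr P borel (X 1)"
    using levy unfolding levy_process_def by (metis of_nat_0_le_iff zero_le_one)
  then show "distr P borel (increment i) = Q"
    by (simp add: Q_def increment_def[abs_def] add.commute)
qed

lemma partial_emp_cf: "(partial e ^^ j) (emp_cf (\<lambda>t. X (real t) \<omega>) n) u = S.sample_moment e j n u \<omega>"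
  unfolding partial_iterate_emp_cf S.sample_moment_def
  by (simp add: sum.atLeast1_atMost_eq increment_def)

lemma partial_\<phi>:
  assumes "norm e \<le> 1" "j \<le> 8"
  shows "(partial e ^^ j) \<phi> = fourier_moment Q e j"
proof -
  have "integrable Q (\<lambda>x. \<bar>e \<bullet> x\<bar> ^ i)" if "i \<le> j" for i
    by (rule S.integrable_Q_bounded_by)
       (use power_inner_le[OF assms(1)] assms(2) that in \<open>auto intro!: borel_measurable_continuous_onI continuous_intros\<close>)
  then show ?thesis
    unfolding fourier_measure_Q[symmetric] by (intro partial_iterate_fourier_measure) auto
qed

text \<open>The modulus is the exponential of the integral of cos (u \<bullet> x) - 1, which is at
  least -2 times the total mass. Here finite intensity keeps the denominators away from 0.\<close>

lemma norm_\<phi>_ge: "exp (- 2 * \<Lambda>) \<le> cmod (\<phi> u)"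
proof -
  have int: "integrable \<nu> (\<lambda>x. iexp (u \<bullet> x) - 1)" using integrable_iexp_nu by simp
  have "- 2 * \<Lambda> = (LINT x|\<nu>. - 2)" by simp
  also have "\<dots> \<le> (LINT x|\<nu>. Re (iexp (u \<bullet> x) - 1))"
  proof (rule integral_mono)
    show "- 2 \<le> Re (iexp (u \<bullet> x) - 1)" for x
      using abs_Re_le_cmod[of "iexp (u \<bullet> x)"] by (simp del: Re_exp add: abs_le_iff)
  qed (use int in \<open>auto simp del: Re_exp simp flip: minus_complex.sel\<close>)
  also have "\<dots> = Re (LINT x|\<nu>. (iexp (u \<bullet> x) - 1))" using int by (rule integral_Re)
  finally show ?thesis by (simp add: \<phi>_def cpp_cf_def)
qed

lemma integrable_quartic: "integrable \<nu> (\<lambda>x. fst x ^ 4 + snd x ^ 4)"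
proof (rule Bochner_Integration.integrable_add)
  have "\<bar>(1, 0) \<bullet> x\<bar> ^ 4 \<le> (1 + norm x) ^ 8" "\<bar>(0, 1) \<bullet> x\<bar> ^ 4 \<le> (1 + norm x) ^ 8" for x :: plane
    by (rule power_inner_le; simp)+
  then show "integrable \<nu> (\<lambda>x. fst x ^ 4)" "integrable \<nu> (\<lambda>x. snd x ^ 4)"
    by (auto intro!: integrable_nu_bounded_by simp: inner_prod_def power_abs)
qed

lemma finite_quartic: "finite_measure (quartic_measure \<nu>)"
proof (rule finite_measureI)
  have "emeasure (quartic_measure \<nu>) (space (quartic_measure \<nu>)) = (\<integral>\<^sup>+x. ennreal (fst x ^ 4 + snd x ^ 4) \<partial>\<nu>)"
    by (simp add: quartic_measure_def emeasure_density)
  also have "\<dots> = ennreal (LINT x|\<nu>. fst x ^ 4 + snd x ^ 4)"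
    by (rule nn_integral_eq_integral[OF integrable_quartic]) simp
  finally show "emeasure (quartic_measure \<nu>) (space (quartic_measure \<nu>)) \<noteq> \<infinity>" by simp
qed

text \<open>Identifies the target of the estimated logarithmic derivatives. As i^4 = 1, the fourth
  derivatives of the exponent are transforms of positive measures.\<close>

lemma fourier_quartic: "fourier_measure (quartic_measure \<nu>) u = log_deriv4 (1, 0) \<phi> u + log_deriv4 (0, 1) \<phi> u"
proof -
  have int_e: "integrable \<nu> (\<lambda>x. \<bar>e \<bullet> x\<bar> ^ i)" if "norm e \<le> 1" "i \<le> 4" for e i
    by (rule integrable_nu_bounded_by)
       (use power_inner_le[OF that(1), of i 8] that(2) in \<open>auto intro!: borel_measurable_continuous_onI continuous_intros\<close>)
  have ld: "log_deriv4 e \<phi> u = (LINT x|\<nu>. complex_of_real ((e \<bullet> x) ^ 4) * iexp (u \<bullet> x))" if "norm e \<le> 1" for e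
    unfolding \<phi>_def using log_deriv4_cpp_cf[OF sets_nu finite_measure_axioms int_e[OF that], of \<alpha> u]
    by (simp add: fourier_moment_def power_mult_distrib)
  have int4: "integrable \<nu> (\<lambda>x. complex_of_real ((e \<bullet> x) ^ 4) * iexp (u \<bullet> x))" if "norm e \<le> 1" for e
    by (rule Bochner_Integration.integrable_bound[OF int_e[OF that, of 4]]) (auto simp: norm_mult norm_power power_abs)
  have "fourier_measure (quartic_measure \<nu>) u = (LINT x|\<nu>. (fst x ^ 4 + snd x ^ 4) *\<^sub>R iexp (u \<bullet> x))"
    unfolding fourier_measure_def quartic_measure_def by (rule integral_density) auto
  also have "\<dots> = (LINT x|\<nu>. complex_of_real (((1, 0) \<bullet> x) ^ 4) * iexp (u \<bullet> x) + complex_of_real (((0, 1) \<bullet> x) ^ 4) * iexp (u \<bullet> x))"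
    by (intro Bochner_Integration.integral_cong refl) (simp add: inner_prod_def scaleR_conv_of_real distrib_right)
  also have "\<dots> = log_deriv4 (1, 0) \<phi> u + log_deriv4 (0, 1) \<phi> u"
    using int4[of "(1, 0)"] int4[of "(0, 1)"] ld[of "(1, 0)"] ld[of "(0, 1)"] by simp
  finally show ?thesis .
qed

end

section \<open>Rate arithmetic and tail probabilities\<close>

definition log_rate :: "nat \<Rightarrow> real" where "log_rate n = ln (real n) ^ 10 / sqrt (real n)"

lemma log_rate_pos: "2 \<le> n \<Longrightarrow> 0 < log_rate n"
  by (simp add: log_rate_def)

text \<open>Four logarithms come from the cutoff and two from the frequency box; since
  \<open>l\<close> is at least 1, the resulting exponent 6 may be raised to 10.\<close>

lemma error_bound_le_log_rate:
  assumes n: "2 \<le> n" and E: "0 \<le> E" and c: "0 \<le> c" and L: "0 \<le> L"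
  shows "36 * (1 + ln (real n) ^ 4) * (E / sqrt n * (2 * ln (1 + sqrt n))\<^sup>2 + c * (8 * (1 / sqrt n) * (L * ln (1 + sqrt n) + 2)))
    \<le> (72 * 1024 * (4 * E + 8 * c * (L + 2))) * log_rate n"
proof -
  \<comment> \<open>The factor 2 gives \<open>1 \<le> l\<close> already for n = 2 and makes ln (1 +
    sqrt n) <= ln (n^2) = l. Its tenth power is the 1024 in the claim.\<close>
  define l where "l = 2 * ln (real n)"
  define s where "s = sqrt (real n)"
  define k where "k = ln (1 + s)"
  have s: "0 < s" using n by (simp add: s_def)
  have l: "1 \<le> l"
  proof -
    have "2 / 3 \<le> ln (2 :: real)" by (rule ln2_ge_two_thirds)
    also have "\<dots> \<le> ln (real n)" using n by simp
    finally show ?thesis by (simp add: l_def)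
  qed
  have k: "0 \<le> k" "k \<le> l"
  proof -
    show "0 \<le> k" using s by (simp add: k_def)
    have "s \<le> real n"
      unfolding s_def using n by (intro real_le_lsqrt) (auto simp: self_le_power)
    moreover have "1 + real n \<le> real n * real n"
    proof -
      have "2 * real n \<le> real n * real n" using n by (intro mult_right_mono) auto
      then show ?thesis using n by linarith
    qed
    ultimately have "k \<le> ln (real n * real n)" unfolding k_def using s n by (intro ln_mono) auto
    also have "\<dots> = l" using n by (simp add: l_def ln_mult)
    finally show "k \<le> l" .
  qed
  have l2: "l \<le> l\<^sup>2" "1 \<le> l\<^sup>2" using l power_increasing[of 1 2 l] power_increasing[of 0 2 l] by auto
  have k2: "k\<^sup>2 \<le> l\<^sup>2" using k by (intro power_mono) auto
  have 1: "1 + ln (real n) ^ 4 \<le> 2 * l ^ 4"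
  proof -
    have "ln (real n) ^ 4 \<le> l ^ 4" using n by (intro power_mono) (auto simp: l_def)
    moreover have "1 \<le> l ^ 4" using l by (rule one_le_power)
    ultimately show ?thesis by simp
  qed
  have 2: "E / s * (2 * k)\<^sup>2 + c * (8 * (1 / s) * (L * k + 2)) \<le> (4 * E + 8 * c * (L + 2)) * l\<^sup>2 / s"
  proof -
    have "E * (2 * k)\<^sup>2 \<le> 4 * E * l\<^sup>2"
      using mult_left_mono[OF k2, of "4 * E"] E by (simp add: power_mult_distrib)
    moreover have "L * k + 2 \<le> (L + 2) * l\<^sup>2"
      using mult_left_mono[of k "l\<^sup>2" L] k l2 L by (simp add: distrib_right)
    then have "8 * c * (L * k + 2) \<le> 8 * c * ((L + 2) * l\<^sup>2)"
      using c by (intro mult_left_mono) auto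
    ultimately have "(E * (2 * k)\<^sup>2 + 8 * c * (L * k + 2)) / s \<le> (4 * E * l\<^sup>2 + 8 * c * ((L + 2) * l\<^sup>2)) / s"
      using s by (intro divide_right_mono add_mono) auto
    moreover have "E / s * (2 * k)\<^sup>2 + c * (8 * (1 / s) * (L * k + 2)) = (E * (2 * k)\<^sup>2 + 8 * c * (L * k + 2)) / s"
    proof -
      have "E / s * x + c * (8 * (1 / s) * y) = (E * x + 8 * c * y) / s" for x y by (simp add: add_divide_distrib)
      then show ?thesis .
    qed
    moreover have "(4 * E + 8 * c * (L + 2)) * l\<^sup>2 / s = (4 * E * l\<^sup>2 + 8 * c * ((L + 2) * l\<^sup>2)) / s"
      by (simp only: distrib_right mult.assoc)
    ultimately show ?thesis by (simp only:)
  qed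
  have "36 * (1 + ln (real n) ^ 4) * (E / s * (2 * k)\<^sup>2 + c * (8 * (1 / s) * (L * k + 2)))
      \<le> 36 * (2 * l ^ 4) * ((4 * E + 8 * c * (L + 2)) * l\<^sup>2 / s)"
    using 1 2 E c L k s l by (intro mult_mono) auto
  also have "\<dots> = (72 * (4 * E + 8 * c * (L + 2))) * (l ^ 6 / s)"
  proof -
    have l6: "l ^ 6 = l ^ 4 * l\<^sup>2" by (simp flip: power_add)
    have "36 * (2 * x) * (z * y / s) = (72 * z) * ((x * y) / s)" for x y z by simp
    then show ?thesis unfolding l6 .
  qed
  also have "\<dots> \<le> (72 * (4 * E + 8 * c * (L + 2))) * (l ^ 10 / s)"
    using l s E c L by (intro mult_left_mono divide_right_mono power_increasing) auto
  also have "l ^ 10 / s = 1024 * log_rate n"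
    by (simp add: l_def s_def log_rate_def power_mult_distrib)
  finally show ?thesis unfolding k_def s_def by (simp only: mult_ac)
qed

lemma (in prob_space) emeasure_ge_le_Markov:
  assumes [measurable]: "u \<in> borel_measurable M" and int: "(\<integral>\<^sup>+\<omega>. u \<omega> \<partial>M) \<le> ennreal B"
    and K: "0 < K" and B: "0 \<le> B" and le: "B \<le> K * d"
  shows "emeasure M {\<omega> \<in> space M. ennreal K \<le> u \<omega>} \<le> ennreal d"
proof -
  have eq: "ennreal K \<le> x \<longleftrightarrow> 1 \<le> ennreal (1 / K) * x" for x
  proof
    assume "ennreal K \<le> x"
    then have "ennreal (1 / K) * ennreal K \<le> ennreal (1 / K) * x" by (intro mult_left_mono) auto
    then show "1 \<le> ennreal (1 / K) * x" using K by (simp add: ennreal_mult[symmetric])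
  next
    assume "1 \<le> ennreal (1 / K) * x"
    then have "ennreal K * 1 \<le> ennreal K * (ennreal (1 / K) * x)" by (intro mult_left_mono) auto
    then show "ennreal K \<le> x" using K by (simp add: ennreal_mult[symmetric] flip: mult.assoc)
  qed
  have "emeasure M {\<omega> \<in> space M. ennreal K \<le> u \<omega>} \<le> ennreal (1 / K) * (\<integral>\<^sup>+\<omega>. u \<omega> * indicator (space M) \<omega> \<partial>M)"
    unfolding eq by (rule nn_integral_Markov_inequality) measurable
  also have "(\<integral>\<^sup>+\<omega>. u \<omega> * indicator (space M) \<omega> \<partial>M) = (\<integral>\<^sup>+\<omega>. u \<omega> \<partial>M)"
    by (intro nn_integral_cong) simp
  also have "ennreal (1 / K) * \<dots> \<le> ennreal (1 / K) * ennreal B"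
    by (intro mult_left_mono int) auto
  also have "\<dots> = ennreal (B / K)" using K B by (simp add: ennreal_mult[symmetric])
  also have "\<dots> \<le> ennreal d" using K le by (intro ennreal_leI) (simp add: divide_le_eq mult.commute)
  finally show ?thesis .
qed

locale copula_model = cpp_model \<nu> \<Lambda> P X \<alpha>
  for \<nu> :: "plane measure" and \<Lambda> :: real and P :: "'w measure" and X :: "real \<Rightarrow> 'w \<Rightarrow> plane" and \<alpha> :: plane +
  fixes K :: "plane \<Rightarrow> real" and L c :: real
  assumes K_nonneg: "\<And>x. 0 \<le> K x" and K_L1: "integrable lebesgue K" and K_int: "(LINT x|lebesgue. K x) = 1"
    and K_supp: "closure {u. fourier (\<lambda>x. complex_of_real (K x)) u \<noteq> 0} \<subseteq> {-1..1} \<times> {-1..1}"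
    and K_lipschitz: "L-lipschitz_on UNIV (fourier (\<lambda>x. complex_of_real (K x)))"
    and decay: "\<And>u. cmod (fourier_measure (quartic_measure \<nu>) u) \<le> c * freq_weight u"
begin

lemma L_nonneg: "0 \<le> L" using K_lipschitz by (rule lipschitz_on_nonneg)

lemma c_nonneg: "0 \<le> c" using order_trans[OF norm_ge_zero decay[of 0]] by (simp add: freq_weight_def)

lemma fourier_quartic_le: "cmod (fourier_measure (quartic_measure \<nu>) u) \<le> c"
  using order_trans[OF decay[of u] mult_left_mono[OF freq_weight_bounds(2) c_nonneg]] by simp

abbreviation N_est :: "nat \<Rightarrow> 'w \<Rightarrow> real \<Rightarrow> real \<Rightarrow> complex" where
  "N_est n \<omega> \<equiv> N_hat \<phi> K (1 / sqrt (real n)) (\<lambda>t. X (real t) \<omega>) n"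

text \<open>The event on which the estimator is not set to 0.\<close>

definition cf_event :: "nat \<Rightarrow> 'w \<Rightarrow> bool" where
  "cf_event n \<omega> \<longleftrightarrow> (\<forall>u\<in>freq_box (1 / sqrt (real n)). cmod (emp_cf (\<lambda>t. X (real t) \<omega>) n u) > 1 / 2 * cmod (\<phi> u))"

text \<open>The constant of \<open>log_deriv4_perturbation\<close> for derivatives bounded by
  \<open>M1 + S.B8\<close> and denominators of modulus at least
  \<open>exp (- 2 * \<Lambda>) / 2\<close>.\<close>

definition log_deriv_const :: "real \<Rightarrow> real" where
  "log_deriv_const M1 = 75 * (M1 + S.B8) ^ 4 / (exp (- 2 * \<Lambda>) / 2) ^ 5"

definition log_deriv_hat :: "nat \<Rightarrow> 'w \<Rightarrow> plane \<Rightarrow> complex" where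
  "log_deriv_hat n \<omega> u = log_deriv4 (1, 0) (emp_cf (\<lambda>t. X (real t) \<omega>) n) u + log_deriv4 (0, 1) (emp_cf (\<lambda>t. X (real t) \<omega>) n) u"

lemma log_deriv_const_nonneg: "0 \<le> M1 \<Longrightarrow> 0 \<le> log_deriv_const M1"
  using S.B8_ge_1 by (simp add: log_deriv_const_def)

lemma log_deriv_hat_measurable [measurable]: "log_deriv_hat n \<omega> \<in> borel_measurable borel"
proof -
  have 0: "emp_cf (\<lambda>t. X (real t) \<omega>) n u = S.sample_moment 0 0 n u \<omega>" for u
    using partial_emp_cf[of 0 0 \<omega> n u] by simp
  have [measurable]: "(\<lambda>u. S.sample_moment e j n u \<omega>) \<in> borel_measurable borel" for e j
    unfolding S.sample_moment_def by measurable
  show ?thesis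
    unfolding log_deriv_hat_def[abs_def] log_deriv4_def Let_def partial_emp_cf 0 by measurable
qed

text \<open>On \<open>cf_event\<close> the empirical characteristic function exceeds half of \<phi>
  in modulus, which gives both denominators the lower bound \<open>?c\<close>; the bound on
  \<open>sample_size\<close> controls the numerators.\<close>

lemma log_deriv_hat_error:
  assumes A: "cf_event n \<omega>" and size: "S.sample_size n \<omega> \<le> M1" and M1: "0 \<le> M1"
    and u: "u \<in> freq_box (1 / sqrt (real n))"
  shows "cmod (log_deriv_hat n \<omega> u - fourier_measure (quartic_measure \<nu>) u) \<le> log_deriv_const M1 * S.deviation n u \<omega>"
proof -
  let ?f = "emp_cf (\<lambda>t. X (real t) \<omega>) n" and ?c = "exp (- 2 * \<Lambda>) / 2" and ?m = "M1 + S.B8"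
  have c: "0 < ?c" "?c \<le> 1"
  proof -
    have "exp (- 2 * \<Lambda>) \<le> 1" using Lambda_pos by simp
    then show "?c \<le> 1" by linarith
  qed simp
  have low: "?c \<le> cmod (\<phi> u)" "?c \<le> cmod (?f u)"
  proof -
    show "?c \<le> cmod (\<phi> u)" using norm_\<phi>_ge[of u] c by linarith
    have "1 / 2 * cmod (\<phi> u) < cmod (?f u)" using A u by (simp add: cf_event_def)
    then show "?c \<le> cmod (?f u)" using norm_\<phi>_ge[of u] by linarith
  qed
  have one: "cmod (log_deriv4 e ?f u - log_deriv4 e \<phi> u)
      \<le> log_deriv_const M1 * (\<Sum>j\<le>4. cmod (S.sample_moment e j n u \<omega> - fourier_moment Q e j u))" if e: "norm e \<le> 1" for e
  proof -
    have "cmod (log_deriv4 e ?f u - log_deriv4 e \<phi> u)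
        \<le> log_deriv_const M1 * (\<Sum>j\<le>4. cmod ((partial e ^^ j) ?f u - (partial e ^^ j) \<phi> u))"
      unfolding log_deriv_const_def
    proof (rule log_deriv4_perturbation)
      show "0 < ?c" "?c \<le> 1" "?c \<le> cmod (?f u)" "?c \<le> cmod (\<phi> u)" by (fact c low)+
      show "1 \<le> ?m" using M1 S.B8_ge_1 by simp
      show "cmod ((partial e ^^ j) ?f u) \<le> ?m" if "j \<le> 4" for j
        using S.sample_moment_le[OF e that, of n u \<omega>] size S.B8_ge_1 by (simp add: partial_emp_cf)
      show "cmod ((partial e ^^ j) \<phi> u) \<le> ?m" if "j \<le> 4" for j
        using S.fourier_moment_le[OF e, of j u] that M1 by (simp add: partial_\<phi>[OF e])
    qed
    also have "(\<Sum>j\<le>4. cmod ((partial e ^^ j) ?f u - (partial e ^^ j) \<phi> u)) = (\<Sum>j\<le>4. cmod (S.sample_moment e j n u \<omega> - fourier_moment Q e j u))"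
      by (intro sum.cong refl) (simp add: partial_emp_cf partial_\<phi>[OF e])
    finally show ?thesis .
  qed
  have "log_deriv_hat n \<omega> u - fourier_measure (quartic_measure \<nu>) u =
      (log_deriv4 (1, 0) ?f u - log_deriv4 (1, 0) \<phi> u) + (log_deriv4 (0, 1) ?f u - log_deriv4 (0, 1) \<phi> u)"
    unfolding fourier_quartic log_deriv_hat_def by simp
  then have "cmod (log_deriv_hat n \<omega> u - fourier_measure (quartic_measure \<nu>) u) \<le>
      cmod (log_deriv4 (1, 0) ?f u - log_deriv4 (1, 0) \<phi> u) + cmod (log_deriv4 (0, 1) ?f u - log_deriv4 (0, 1) \<phi> u)"
    by (metis norm_triangle_ineq)
  also have "\<dots> \<le> log_deriv_const M1 * S.deviation n u \<omega>"
    using one[of "(1, 0)"] one[of "(0, 1)"] by (simp add: S.deviation_def distrib_left)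
  finally show ?thesis .
qed

text \<open>A bound that may depend on the sample, obtained with \<open>sample_size\<close> itself
  as \<open>M1\<close>. It secures integrability over the box.\<close>

lemma log_deriv_hat_bounded:
  assumes A: "cf_event n \<omega>"
  obtains B where "\<And>u. u \<in> freq_box (1 / sqrt (real n)) \<Longrightarrow> cmod (log_deriv_hat n \<omega> u) \<le> B"
proof
  fix u assume u: "u \<in> freq_box (1 / sqrt (real n))"
  let ?s = "S.sample_size n \<omega>"
  have s: "0 \<le> ?s" unfolding S.sample_size_def by (intro divide_nonneg_nonneg sum_nonneg) auto
  have moment_le: "cmod (S.sample_moment e j n u \<omega> - fourier_moment Q e j u) \<le> ?s + S.B8" if "norm e \<le> 1" "j \<le> 4" for e j
    using norm_triangle_ineq4[of "S.sample_moment e j n u \<omega>" "fourier_moment Q e j u"]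
      S.sample_moment_le[OF that, of n u \<omega>] S.fourier_moment_le[OF that(1), of j u] that(2) by simp
  have "S.deviation n u \<omega> \<le> (\<Sum>e\<in>{(1, 0), (0, 1) :: plane}. \<Sum>j\<le>4::nat. ?s + S.B8)"
    unfolding S.deviation_def by (intro sum_mono moment_le) auto
  then have "log_deriv_const ?s * S.deviation n u \<omega> \<le> log_deriv_const ?s * (\<Sum>e\<in>{(1, 0), (0, 1) :: plane}. \<Sum>j\<le>4::nat. ?s + S.B8)"
    by (intro mult_left_mono log_deriv_const_nonneg s)
  then show "cmod (log_deriv_hat n \<omega> u) \<le> c + log_deriv_const ?s * (\<Sum>e\<in>{(1, 0), (0, 1) :: plane}. \<Sum>j\<le>4::nat. ?s + S.B8)"
    using log_deriv_hat_error[OF A order_refl s u] fourier_quartic_le[of u]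
      norm_triangle_ineq[of "fourier_measure (quartic_measure \<nu>) u" "log_deriv_hat n \<omega> u - fourier_measure (quartic_measure \<nu>) u"]
    by simp
qed

lemma N_est_eq:
  "N_est n \<omega> a b = (if cf_event n \<omega> then
     (LINT y|lebesgue. complex_of_real (weight a b y) * inv_fourier (\<lambda>u. if u \<in> freq_box (1 / sqrt (real n))
        then log_deriv_hat n \<omega> u * fourier (\<lambda>z. complex_of_real (scaled_kernel K (1 / sqrt (real n)) z)) u else 0) y) else 0)"
  unfolding N_hat_def cf_event_def log_deriv_hat_def ..

section \<open>Error of the estimated tail integral and the good event\<close>

text \<open>If one argument is at least 1 / ln n, then 1 / (a^4 + b^4) <= (ln n)^4. For a fixed
  sample a single bound thus serves all such arguments.\<close>

lemma N_est_error:
  assumes n: "2 \<le> n" and A: "cf_event n \<omega>" and size: "S.sample_size n \<omega> \<le> M1" and M1: "0 \<le> M1"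
    and W: "S.weighted_deviation (1 / sqrt (real n)) n \<omega> \<le> ennreal W" "0 \<le> W"
    and ab: "0 \<le> a" "0 \<le> b" "1 / ln (real n) \<le> a \<or> 1 / ln (real n) \<le> b"
  shows "cmod (N_est n \<omega> a b - tail \<nu> a b)
    \<le> 36 * (1 + ln (real n) ^ 4) * (log_deriv_const M1 * W + c * (8 * (1 / sqrt n) * (L * ln (1 + sqrt n) + 2)))"
proof -
  let ?h = "1 / sqrt (real n)" and ?\<delta> = "1 / ln (real n)"
  let ?k = "fourier (\<lambda>z. complex_of_real (scaled_kernel K ?h z))"
  have h: "0 < ?h" using n by simp
  have \<delta>: "0 < ?\<delta>" using n by simp
  have D: "?\<delta> ^ 4 \<le> a ^ 4 + b ^ 4"
  proof -
    have "?\<delta> ^ 4 \<le> a ^ 4 \<or> ?\<delta> ^ 4 \<le> b ^ 4" using ab(3) \<delta> by (auto intro: power_mono)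
    moreover have "0 \<le> a ^ 4" "0 \<le> b ^ 4" by auto
    ultimately show ?thesis by linarith
  qed
  have D_pos: "0 < a ^ 4 + b ^ 4" using D zero_less_power[OF \<delta>, of 4] by linarith
  have inv_D: "1 / (a ^ 4 + b ^ 4) \<le> ln (real n) ^ 4"
  proof -
    have "1 / (a ^ 4 + b ^ 4) \<le> 1 / ?\<delta> ^ 4" using D \<delta> by (intro divide_left_mono mult_pos_pos D_pos) auto
    then show ?thesis by (simp add: power_divide)
  qed
  note k = scaled_kernel_fourier_facts[OF K_nonneg K_L1 K_int K_supp K_lipschitz h]
  obtain B where B: "\<And>u. u \<in> freq_box ?h \<Longrightarrow> cmod (log_deriv_hat n \<omega> u) \<le> B"
    using log_deriv_hat_bounded[OF A] by blast
  have C: "0 \<le> log_deriv_const M1" by (rule log_deriv_const_nonneg[OF M1])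
  have E: "(\<integral>\<^sup>+u. ennreal (indicator (freq_box ?h) u * freq_weight u * cmod (log_deriv_hat n \<omega> u - fourier_measure (quartic_measure \<nu>) u)) \<partial>lborel)
      \<le> ennreal (log_deriv_const M1 * W)"
  proof -
    have "(\<integral>\<^sup>+u. ennreal (indicator (freq_box ?h) u * freq_weight u * cmod (log_deriv_hat n \<omega> u - fourier_measure (quartic_measure \<nu>) u)) \<partial>lborel)
        \<le> (\<integral>\<^sup>+u. ennreal (log_deriv_const M1) * ennreal (indicator (freq_box ?h) u * freq_weight u * S.deviation n u \<omega>) \<partial>lborel)"
    proof (rule nn_integral_mono)
      fix u :: plane
      have "indicator (freq_box ?h) u * freq_weight u * cmod (log_deriv_hat n \<omega> u - fourier_measure (quartic_measure \<nu>) u)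
          \<le> indicator (freq_box ?h) u * freq_weight u * (log_deriv_const M1 * S.deviation n u \<omega>)"
        using log_deriv_hat_error[OF A size M1] freq_weight_bounds(1)[of u]
        by (cases "u \<in> freq_box ?h") auto
      also have "\<dots> = log_deriv_const M1 * (indicator (freq_box ?h) u * freq_weight u * S.deviation n u \<omega>)" by (simp only: mult_ac)
      finally show "ennreal (indicator (freq_box ?h) u * freq_weight u * cmod (log_deriv_hat n \<omega> u - fourier_measure (quartic_measure \<nu>) u))
          \<le> ennreal (log_deriv_const M1) * ennreal (indicator (freq_box ?h) u * freq_weight u * S.deviation n u \<omega>)"
        unfolding ennreal_mult'[OF C, symmetric] by (rule ennreal_leI)
    qed
    also have "\<dots> = ennreal (log_deriv_const M1) * S.weighted_deviation ?h n \<omega>"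
    proof -
      have [measurable]: "(\<lambda>u. S.deviation n u \<omega>) \<in> borel_measurable borel"
        unfolding S.deviation_def S.sample_moment_def by measurable
      show ?thesis unfolding S.weighted_deviation_def by (rule nn_integral_cmult) measurable
    qed
    also have "\<dots> \<le> ennreal (log_deriv_const M1) * ennreal W" by (intro mult_left_mono W) auto
    finally show ?thesis by (simp add: ennreal_mult'[OF C])
  qed
  have "cmod (N_est n \<omega> a b - tail \<nu> a b)
      \<le> 36 * (1 + 1 / (a ^ 4 + b ^ 4)) * (log_deriv_const M1 * W + c * (8 * ?h * (L * ln (1 + 1 / ?h) + 2)))"
    unfolding N_est_eq if_P[OF A]
    by (rule estimation_error[OF finite_quartic decay ab(1,2) D_pos k(1) k(4) k(3) k(2) h L_nonneg log_deriv_hat_measurable B mult_nonneg_nonneg[OF C W(2)] E])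
  also have "\<dots> \<le> 36 * (1 + ln (real n) ^ 4) * (log_deriv_const M1 * W + c * (8 * ?h * (L * ln (1 + 1 / ?h) + 2)))"
    using inv_D C W(2) c_nonneg L_nonneg n by (intro mult_right_mono add_nonneg_nonneg mult_nonneg_nonneg) auto
  finally show ?thesis by simp
qed

text \<open>No exceptional set arises, because off \<open>cf_event\<close> the estimator vanishes
  identically.\<close>

lemma N_est_tendsto_0:
  assumes n: "2 \<le> n"
  shows "((\<lambda>x. N_est n \<omega> x 0) \<longlongrightarrow> 0) at_top" and "(N_est n \<omega> 0 \<longlongrightarrow> 0) at_top"
proof -
  let ?h = "1 / sqrt (real n)"
  let ?H = "\<lambda>u. if u \<in> freq_box ?h then log_deriv_hat n \<omega> u * fourier (\<lambda>z. complex_of_real (scaled_kernel K ?h z)) u else 0"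
  have h: "0 < ?h" using n by simp
  note k = scaled_kernel_fourier_facts[OF K_nonneg K_L1 K_int K_supp K_lipschitz h]
  have "((\<lambda>x. N_est n \<omega> x 0) \<longlongrightarrow> 0) at_top \<and> (N_est n \<omega> 0 \<longlongrightarrow> 0) at_top"
  proof (cases "cf_event n \<omega>")
    case True
    obtain B where B: "\<And>u. u \<in> freq_box ?h \<Longrightarrow> cmod (log_deriv_hat n \<omega> u) \<le> B"
      using log_deriv_hat_bounded[OF True] by blast
    have "integrable lborel ?H"
    proof (rule integrable_on_freq_box[of _ _ "B * 1"])
      show "(\<lambda>u. log_deriv_hat n \<omega> u * fourier (\<lambda>z. complex_of_real (scaled_kernel K ?h z)) u) \<in> borel_measurable borel"
        by (intro borel_measurable_times log_deriv_hat_measurable k(1))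
      show "cmod (log_deriv_hat n \<omega> u * fourier (\<lambda>z. complex_of_real (scaled_kernel K ?h z)) u) \<le> B * 1" if "u \<in> freq_box ?h" for u
        unfolding norm_mult by (intro mult_mono B that k(3) order_trans[OF norm_ge_zero B[OF that]]) auto
    qed
    note lim = weight_integral_tendsto_0[OF this]
    have "(\<lambda>x. N_est n \<omega> x 0) = (\<lambda>x. LINT y|lebesgue. complex_of_real (weight x 0 y) * inv_fourier ?H y)"
      "N_est n \<omega> 0 = (\<lambda>x. LINT y|lebesgue. complex_of_real (weight 0 x y) * inv_fourier ?H y)"
      by (rule ext, unfold N_est_eq if_P[OF True], rule refl)+
    then show ?thesis using lim by (simp only: simp_thms)
  next
    case False
    have "(\<lambda>x. N_est n \<omega> x 0) = (\<lambda>x. 0)" "N_est n \<omega> 0 = (\<lambda>x. 0)"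
      by (rule ext, unfold N_est_eq if_not_P[OF False], rule refl)+
    then show ?thesis by (simp only: tendsto_const simp_thms)
  qed
  then show "((\<lambda>x. N_est n \<omega> x 0) \<longlongrightarrow> 0) at_top" "(N_est n \<omega> 0 \<longlongrightarrow> 0) at_top" by auto
qed

lemma tail_le: "tail \<nu> a b \<le> \<Lambda>"
  unfolding tail_def using bounded_measure[of "{a..} \<times> {b..}"] by simp

text \<open>An error below half the uniform lower bound of |\<phi>| leaves more than half of
  |\<phi>|. Direction and order 0 stand for the characteristic functions themselves.\<close>

lemma cf_event_of_deviation:
  assumes "\<And>u. u \<in> freq_box (1 / sqrt (real n)) \<Longrightarrow> cmod (S.sample_moment 0 0 n u \<omega> - fourier_moment Q 0 0 u) < exp (- 2 * \<Lambda>) / 2"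
  shows "cf_event n \<omega>"
  unfolding cf_event_def
proof
  fix u assume u: "u \<in> freq_box (1 / sqrt (real n))"
  have "emp_cf (\<lambda>t. X (real t) \<omega>) n u = S.sample_moment 0 0 n u \<omega>"
    using partial_emp_cf[of 0 0 \<omega> n u] by simp
  moreover have "\<phi> u = fourier_moment Q 0 0 u" using partial_\<phi>[of 0 0] by simp
  ultimately show "1 / 2 * cmod (\<phi> u) < cmod (emp_cf (\<lambda>t. X (real t) \<omega>) n u)"
    using assms[OF u] norm_\<phi>_ge[of u] norm_triangle_ineq2[of "\<phi> u" "\<phi> u - emp_cf (\<lambda>t. X (real t) \<omega>) n u"]
      norm_triangle_ineq2[of "\<phi> u" "emp_cf (\<lambda>t. X (real t) \<omega>) n u"] norm_minus_commute[of "\<phi> u" "emp_cf (\<lambda>t. X (real t) \<omega>) n u"]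
    by simp
qed

text \<open>As \<open>a\<close> is positive, both tails attain the level \<Lambda> (1 - a) at fixed
  positive points, and the cutoff eventually lies to the left of both.\<close>

lemma tail_near_0:
  assumes a: "0 < a" "a < 1"
  obtains n0 where "2 \<le> n0" "\<And>n. n0 \<le> n \<Longrightarrow> \<Lambda> * (1 - a) \<le> tail \<nu> (1 / ln (real n)) 0 \<and> \<Lambda> * (1 - a) \<le> tail \<nu> 0 (1 / ln (real n))"
proof -
  have in_range: "\<Lambda> * (1 - a) \<in> {0<..<\<Lambda>}" using a Lambda_pos by (auto simp: algebra_simps)
  obtain x where x: "0 < x" "tail \<nu> x 0 = \<Lambda> * (1 - a)"
  proof -
    have "\<Lambda> * (1 - a) \<in> (\<lambda>x. tail \<nu> x 0) ` {0<..}" using in_range by (simp only: bij_betw_imp_surj_on[OF tail1_bij])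
    then show ?thesis using that by auto
  qed
  obtain y where y: "0 < y" "tail \<nu> 0 y = \<Lambda> * (1 - a)"
  proof -
    have "\<Lambda> * (1 - a) \<in> tail \<nu> 0 ` {0<..}" using in_range by (simp only: bij_betw_imp_surj_on[OF tail2_bij])
    then show ?thesis using that by auto
  qed
  have "((\<lambda>n. 1 / ln (real n)) \<longlonglongrightarrow> 0)" by real_asymp
  then have "\<forall>\<^sub>F n in sequentially. 1 / ln (real n) < min x y"
    by (rule order_tendstoD(2)) (use x y in simp)
  then obtain n1 where n1: "\<And>n. n1 \<le> n \<Longrightarrow> 1 / ln (real n) < min x y"
    unfolding eventually_sequentially by blast
  show ?thesis
  proof (rule that[of "max 2 n1"])
    fix n assume "max 2 n1 \<le> n"
    then have "1 / ln (real n) \<le> x" "1 / ln (real n) \<le> y" using n1[of n] by auto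
    then show "\<Lambda> * (1 - a) \<le> tail \<nu> (1 / ln (real n)) 0 \<and> \<Lambda> * (1 - a) \<le> tail \<nu> 0 (1 / ln (real n))"
      unfolding x(2)[symmetric] using tail_antimono[of "1 / ln (real n)" x 0 0] tail_antimono[of 0 0 "1 / ln (real n)" y]
      by (simp add: x(2) y(2))
  qed simp
qed

text \<open>For small \<open>n\<close> neither \<open>A\<^sub>h\<^sub>,\<^sub>n\<close> nor the inversion near the cutoff is under control, but the error is
  then still bounded, which suffices because only finitely many \<open>n\<close> are concerned.\<close>
lemma copula_estimator_error:
  assumes n: "2 \<le> n" and size: "S.sample_size n \<omega> \<le> M1" and M1: "0 \<le> M1"
    and W: "S.weighted_deviation (1 / sqrt (real n)) n \<omega> \<le> ennreal W" "0 \<le> W"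
    and uv: "a \<le> u" "u < 1" "a \<le> v" "v < 1" and a: "0 < a"
    and large: "n0 \<le> n \<Longrightarrow> cf_event n \<omega> \<and> \<Lambda> * (1 - a) \<le> tail \<nu> (1 / ln (real n)) 0 \<and> \<Lambda> * (1 - a) \<le> tail \<nu> 0 (1 / ln (real n))"
    and \<epsilon>: "36 * (1 + ln (real n) ^ 4) * (log_deriv_const M1 * W + c * (8 * (1 / sqrt n) * (L * ln (1 + sqrt n) + 2))) \<le> \<epsilon>"
  shows "cmod (jump_copula \<nu> u v - copula_estimator \<alpha> \<nu> K (\<lambda>t. X (real t) \<omega>) n u v)
    \<le> 5 * \<epsilon> / \<Lambda> + (if n0 \<le> n then 0 else 4)"
proof -
  let ?\<delta> = "1 / ln (real n)"
  have est: "copula_estimator \<alpha> \<nu> K (\<lambda>t. X (real t) \<omega>) n u v = C_hat (N_est n \<omega>) \<Lambda> ?\<delta> u v"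
    by (simp add: copula_estimator_def \<phi>_def)
  have \<delta>: "0 < ?\<delta>" using n by simp
  have "0 \<le> 36 * (1 + ln (real n) ^ 4) * (log_deriv_const M1 * W + c * (8 * (1 / sqrt n) * (L * ln (1 + sqrt n) + 2)))"
    using log_deriv_const_nonneg[OF M1] W(2) c_nonneg L_nonneg n by (intro mult_nonneg_nonneg add_nonneg_nonneg) auto
  then have \<epsilon>_nonneg: "0 \<le> \<epsilon>" using \<epsilon> by (rule order_trans)
  note lims = N_est_tendsto_0[OF n, of \<omega>]
  have uv': "0 < u" "u < 1" "0 < v" "v < 1" using uv a by auto
  have close: "cmod (N_est n \<omega> x y - tail \<nu> x y) \<le> \<epsilon>" if "cf_event n \<omega>" "0 \<le> x" "0 \<le> y" "?\<delta> \<le> x \<or> ?\<delta> \<le> y" for x y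
    by (rule order_trans[OF N_est_error[OF n that(1) size M1 W that(2-4)] \<epsilon>])
  show ?thesis
  proof (cases "n0 \<le> n")
    case True
    then have "cf_event n \<omega>" and *: "\<Lambda> * (1 - a) \<le> tail \<nu> ?\<delta> 0" "\<Lambda> * (1 - a) \<le> tail \<nu> 0 ?\<delta>"
      using large by auto
    moreover have "\<Lambda> * (1 - u) \<le> \<Lambda> * (1 - a)" "\<Lambda> * (1 - v) \<le> \<Lambda> * (1 - a)"
      using uv Lambda_pos by (auto intro: mult_left_mono)
    ultimately show ?thesis
      unfolding est using copula_error_sharp[OF \<delta> close lims uv'] True by auto
  next
    case False
    \<comment> \<open>Where the estimator is 0 the error is the tail itself, at most \<Lambda>. In
      the crude bound the \<Lambda> added to \<epsilon> contributes 3, which together with the 1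
      makes the additive 4.\<close>
    have "cmod (N_est n \<omega> x y - tail \<nu> x y) \<le> \<epsilon> + \<Lambda>" if "0 \<le> x" "0 \<le> y" "?\<delta> \<le> x \<or> ?\<delta> \<le> y" for x y
    proof (cases "cf_event n \<omega>")
      case True
      then show ?thesis using close[OF True that] Lambda_pos by linarith
    next
      case False
      have "N_est n \<omega> x y = 0" unfolding N_est_eq if_not_P[OF False] ..
      moreover have "0 \<le> tail \<nu> x y" by (simp add: tail_def)
      ultimately show ?thesis using tail_le[of x y] \<epsilon>_nonneg by simp
    qed
    from copula_error_crude[OF \<delta> this lims uv']
    have "cmod (jump_copula \<nu> u v - copula_estimator \<alpha> \<nu> K (\<lambda>t. X (real t) \<omega>) n u v) \<le> 1 + 3 * (\<epsilon> + \<Lambda>) / \<Lambda>"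
      unfolding est by simp
    also have "\<dots> = 4 + 3 * \<epsilon> / \<Lambda>" using Lambda_pos by (simp add: add_divide_distrib distrib_left)
    also have "\<dots> \<le> 4 + 5 * \<epsilon> / \<Lambda>" using \<epsilon>_nonneg Lambda_pos by (intro add_left_mono divide_right_mono) auto
    finally show ?thesis using False by simp
  qed
qed

text \<open>The probability \<open>d\<close> is shared by three exceptional sets: large
  \<open>sample_size\<close> and large weighted deviation, both by Markov's inequality, and failure
  on the frequency grid. Off these sets the bound is deterministic and covers all (u, v) at once, so
  it passes to the supremum regardless of measurability.\<close>

theorem copula_estimator_rate:
  assumes a: "0 < a" "a < 1" and b: "b < 1"
  shows "bigO_P P 2
     (\<lambda>n \<omega>. SUP (u, v)\<in>{a..b} \<times> {a..b}.
        ennreal (cmod (complex_of_real (jump_copula \<nu> u v) - copula_estimator \<alpha> \<nu> K (\<lambda>t. X (real t) \<omega>) n u v)))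
     log_rate"
  unfolding bigO_P_def
proof (intro allI impI)
  fix d :: real assume d: "0 < d"
  \<comment> \<open>\<open>M1\<close> and \<open>W n\<close> are the levels at which Markov's
    inequality returns exactly d / 3.\<close>
  define M1 where "M1 = S.B8 / (d / 3)"
  define W where "W n = 10 * (S.B8 + 1) / (d / 3) / sqrt (real n) * (2 * ln (1 + sqrt (real n)))\<^sup>2" for n
  have M1: "0 < M1" unfolding M1_def using d S.B8_ge_1 by simp
  have W: "0 < W n" if "0 < n" for n
  proof -
    have "0 < ln (1 + sqrt (real n))" using that by (intro ln_gt_zero) simp
    then show ?thesis unfolding W_def using d S.B8_ge_1 that by (intro mult_pos_pos divide_pos_pos zero_less_power) auto
  qed
  obtain p where p: "p \<longlonglongrightarrow> 0"
    and G: "\<And>n. 0 < n \<Longrightarrow> \<exists>G\<in>sets P. measure P G \<le> p n \<and>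
      (\<forall>\<omega>\<in>space P - G. S.sample_size n \<omega> \<le> M1 \<longrightarrow>
        (\<forall>u\<in>freq_box (1 / sqrt n). cmod (S.sample_moment 0 0 n u \<omega> - fourier_moment Q 0 0 u) < exp (- 2 * \<Lambda>) / 2))"
    using S.cf_uniform_deviation[of "exp (- 2 * \<Lambda>) / 2" M1 0] M1 by auto
  obtain n1 where n1: "2 \<le> n1" "\<And>n. n1 \<le> n \<Longrightarrow> \<Lambda> * (1 - a) \<le> tail \<nu> (1 / ln (real n)) 0 \<and> \<Lambda> * (1 - a) \<le> tail \<nu> 0 (1 / ln (real n))"
    using tail_near_0[OF a] by blast
  have "\<forall>\<^sub>F n in sequentially. p n < d / 3" by (rule order_tendstoD(2)[OF p]) (use d in simp)
  then obtain n2 where n2: "\<And>n. n2 \<le> n \<Longrightarrow> p n < d / 3" unfolding eventually_sequentially by blast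
  define n0 where "n0 = max n1 n2"
  define E where "E = log_deriv_const M1 * (10 * (S.B8 + 1) / (d / 3))"
  define C where "C = 72 * 1024 * (4 * E + 8 * c * (L + 2))"
  \<comment> \<open>Ensures that \<open>R * log_rate n\<close> is at least 1 for each of the
    finitely many n from 2 up to \<open>n0\<close>, so that the additive 4 of the crude bound is
    absorbed into the rate.\<close>
  define R where "R = (\<Sum>n\<in>{2..<n0}. 1 / log_rate n)"
  define m where "m = 5 * C / \<Lambda> + 4 * R"
  have E: "0 \<le> E" unfolding E_def using log_deriv_const_nonneg[of M1] M1 d S.B8_ge_1 by simp
  have C: "0 \<le> C" unfolding C_def using E c_nonneg L_nonneg by simp
  have R: "0 \<le> R" unfolding R_def by (intro sum_nonneg) (use log_rate_pos in \<open>auto intro: less_imp_le\<close>)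
  have m: "0 \<le> m" unfolding m_def using C R Lambda_pos by simp
  let ?Y = "\<lambda>n \<omega>. SUP (u, v)\<in>{a..b} \<times> {a..b}.
        ennreal (cmod (complex_of_real (jump_copula \<nu> u v) - copula_estimator \<alpha> \<nu> K (\<lambda>t. X (real t) \<omega>) n u v))"
  show "\<exists>M>0. \<forall>n\<ge>2. outer_measure_of P {\<omega> \<in> space P. ennreal M \<le> ?Y n \<omega> / ennreal (log_rate n)} \<le> ennreal d"
  \<comment> \<open>The event in \<open>bigO_P\<close> is a weak inequality; the added 1 makes the
    bound by \<open>m\<close> contradict it strictly.\<close>
  proof (intro exI[of _ "m + 1"] conjI allI impI)
    show "0 < m + 1" using m by simp
    fix n :: nat assume n: "2 \<le> n"
    have r: "0 < log_rate n" by (rule log_rate_pos[OF n])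
    obtain G where G: "G \<in> sets P" "measure P G \<le> p n"
      "\<And>\<omega>. \<omega> \<in> space P - G \<Longrightarrow> S.sample_size n \<omega> \<le> M1 \<Longrightarrow>
        (\<forall>u\<in>freq_box (1 / sqrt n). cmod (S.sample_moment 0 0 n u \<omega> - fourier_moment Q 0 0 u) < exp (- 2 * \<Lambda>) / 2)"
      using G[of n] n by auto
    define B1 where "B1 = {\<omega> \<in> space P. ennreal M1 \<le> ennreal (S.sample_size n \<omega>)}"
    define B2 where "B2 = {\<omega> \<in> space P. ennreal (W n) \<le> S.weighted_deviation (1 / sqrt (real n)) n \<omega>}"
    \<comment> \<open>Below \<open>n0\<close> the grid bound \<open>p n\<close> may be large, and
      nothing is removed there.\<close>
    define B3 where "B3 = (if n0 \<le> n then G else {})"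
    have B_sets: "B1 \<in> sets P" "B2 \<in> sets P" "B3 \<in> sets P"
      using G(1) by (auto simp: B1_def B2_def B3_def)
    have B1: "emeasure P B1 \<le> ennreal (d / 3)"
      unfolding B1_def
      by (rule S.emeasure_ge_le_Markov[OF _ S.nn_integral_sample_size_le M1])
         (use n d S.B8_ge_1 in \<open>auto simp: M1_def\<close>)
    have B2: "emeasure P B2 \<le> ennreal (d / 3)"
      unfolding B2_def
    proof (rule S.emeasure_ge_le_Markov[OF _ S.weighted_deviation_expectation W])
      show "10 * (S.B8 + 1) / sqrt (real n) * (2 * ln (1 + 1 / (1 / sqrt (real n))))\<^sup>2 \<le> W n * (d / 3)"
      proof -
        have "x / (d / 3) / s * y * (d / 3) = x / s * y" for x s y :: real using d by simp
        then have "W n * (d / 3) = 10 * (S.B8 + 1) / sqrt (real n) * (2 * ln (1 + sqrt (real n)))\<^sup>2"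
          unfolding W_def .
        then show ?thesis by (simp only: divide_divide_eq_right mult_1 div_by_1 order_refl)
      qed
    qed (use n S.B8_ge_1 in auto)
    have B3: "emeasure P B3 \<le> ennreal (d / 3)"
      using G(2) n2[of n] d by (auto simp: B3_def n0_def S.emeasure_eq_measure intro!: ennreal_leI)
    have "{\<omega> \<in> space P. ennreal (m + 1) \<le> ?Y n \<omega> / ennreal (log_rate n)} \<subseteq> B1 \<union> B2 \<union> B3"
    proof (rule subsetI, rule ccontr)
      fix \<omega> assume \<omega>: "\<omega> \<in> {\<omega> \<in> space P. ennreal (m + 1) \<le> ?Y n \<omega> / ennreal (log_rate n)}" and not: "\<omega> \<notin> B1 \<union> B2 \<union> B3"
      have sp: "\<omega> \<in> space P" using \<omega> by simp
      have size: "S.sample_size n \<omega> \<le> M1"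
      proof (rule ccontr)
        assume "\<not> S.sample_size n \<omega> \<le> M1"
        then have "ennreal M1 \<le> ennreal (S.sample_size n \<omega>)" by (intro ennreal_leI) simp
        then show False using not sp by (simp add: B1_def)
      qed
      have dev: "S.weighted_deviation (1 / sqrt (real n)) n \<omega> \<le> ennreal (W n)"
        using not sp by (auto simp: B2_def not_le)
      have large: "cf_event n \<omega> \<and> \<Lambda> * (1 - a) \<le> tail \<nu> (1 / ln (real n)) 0 \<and> \<Lambda> * (1 - a) \<le> tail \<nu> 0 (1 / ln (real n))"
        if "n0 \<le> n"
      proof -
        have "\<omega> \<in> space P - G" using not sp that by (auto simp: B3_def)
        from G(3)[OF this size] have "cf_event n \<omega>" by (intro cf_event_of_deviation) auto
        then show ?thesis using n1(2)[of n] that by (simp add: n0_def)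
      qed
      have \<epsilon>: "36 * (1 + ln (real n) ^ 4) * (log_deriv_const M1 * W n + c * (8 * (1 / sqrt n) * (L * ln (1 + sqrt n) + 2))) \<le> C * log_rate n"
      proof -
        have "k * (x / s * y) = k * x / s * y" for k x s y :: real by simp
        then have EW: "log_deriv_const M1 * W n = E / sqrt (real n) * (2 * ln (1 + sqrt (real n)))\<^sup>2"
          unfolding E_def W_def .
        show ?thesis unfolding EW C_def by (rule error_bound_le_log_rate[OF n E c_nonneg L_nonneg])
      qed
      have small: "(if n0 \<le> n then 0 else 4) \<le> 4 * R * log_rate n"
      proof (cases "n0 \<le> n")
        case False
        have "1 / log_rate n \<le> R"
          unfolding R_def using False n log_rate_pos by (intro member_le_sum) (auto intro: less_imp_le)
        then have "1 \<le> R * log_rate n" using r by (simp add: divide_le_eq)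
        then show ?thesis using False by simp
      qed (use R r in simp)
      have "?Y n \<omega> \<le> ennreal (m * log_rate n)"
      proof (rule SUP_least, clarify, rule ennreal_leI)
        fix u v assume uv: "u \<in> {a..b}" "v \<in> {a..b}"
        have "cmod (complex_of_real (jump_copula \<nu> u v) - copula_estimator \<alpha> \<nu> K (\<lambda>t. X (real t) \<omega>) n u v)
            \<le> 5 * (C * log_rate n) / \<Lambda> + (if n0 \<le> n then 0 else 4)"
          using uv a b n M1 W[of n]
          by (intro copula_estimator_error[OF n size _ dev _ _ _ _ _ _ large \<epsilon>]) auto
        also have "\<dots> \<le> m * log_rate n"
          using small by (simp add: m_def distrib_right)
        finally show "cmod (complex_of_real (jump_copula \<nu> u v) - copula_estimator \<alpha> \<nu> K (\<lambda>t. X (real t) \<omega>) n u v) \<le> m * log_rate n" .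
      qed
      then have "?Y n \<omega> / ennreal (log_rate n) \<le> ennreal (m * log_rate n) / ennreal (log_rate n)"
        by (rule divide_right_mono_ennreal)
      also have "\<dots> = ennreal m" using r m by (simp add: divide_ennreal)
      also have "\<dots> < ennreal (m + 1)" using m by (simp add: ennreal_lessI)
      finally show False using \<omega> by (simp add: not_le[symmetric])
    qed
    \<comment> \<open>The outer measure is an infimum over measurable supersets, of which this union
      is one.\<close>
    then have "outer_measure_of P {\<omega> \<in> space P. ennreal (m + 1) \<le> ?Y n \<omega> / ennreal (log_rate n)} \<le> emeasure P (B1 \<union> B2 \<union> B3)"
      unfolding outer_measure_of_def using B_sets by (intro INF_lower) auto
    also have "\<dots> \<le> emeasure P (B1 \<union> B2) + emeasure P B3"
      by (rule emeasure_subadditive) (use B_sets in auto)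
    also have "\<dots> \<le> (emeasure P B1 + emeasure P B2) + emeasure P B3"
      by (intro add_right_mono emeasure_subadditive) (use B_sets in auto)
    also have "\<dots> \<le> (ennreal (d / 3) + ennreal (d / 3)) + ennreal (d / 3)"
      by (intro add_mono B1 B2 B3)
    also have "\<dots> = ennreal d" using d by (simp add: ennreal_plus[symmetric] del: ennreal_plus)
    finally show "outer_measure_of P {\<omega> \<in> space P. ennreal (m + 1) \<le> ?Y n \<omega> / ennreal (log_rate n)} \<le> ennreal d" .
  qed
qed

end

theorem theorem4p7:
  fixes K :: "real \<times> real \<Rightarrow> real"
    and P :: "'w measure"
    and X :: "real \<Rightarrow> 'w \<Rightarrow> real \<times> real"
    and \<alpha> :: "real \<times> real"
    and \<nu> :: "(real \<times> real) measure"
    and \<Lambda> a b :: real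
  assumes K_nonneg: "\<And>x. 0 \<le> K x"
    and K_L1: "integrable lebesgue K"
    and K_L2: "integrable lebesgue (\<lambda>x. (K x)\<^sup>2)"
    and K_int: "(LINT x|lebesgue. K x) = 1"
    and K_supp: "closure {u. fourier (\<lambda>x. complex_of_real (K x)) u \<noteq> 0} \<subseteq> {-1..1} \<times> {-1..1}"
    and K_lipschitz: "\<exists>L. L-lipschitz_on UNIV (fourier (\<lambda>x. complex_of_real (K x)))"
    and X: "compound_poisson_with_drift P X \<alpha> \<nu>"
    and i_pos: "0 < \<Lambda>"
    and i_total: "emeasure \<nu> UNIV = ennreal \<Lambda>"
    and i_quadrant: "emeasure \<nu> ({0..} \<times> {0..}) = ennreal \<Lambda>"
    and ii: "\<exists>\<gamma>>0. integrable \<nu> (\<lambda>x. norm x powr (8 + \<gamma>))"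
    and iii: "\<exists>c>0. \<forall>u.
          cmod (fourier_measure (density \<nu> (\<lambda>x. ennreal (fst x ^ 4 + snd x ^ 4))) u)
            \<le> c * inverse (1 + \<bar>fst u\<bar>) * inverse (1 + \<bar>snd u\<bar>)"
    and iv: "\<And>U. U \<in> {\<lambda>x. tail \<nu> x 0, \<lambda>y. tail \<nu> 0 y} \<Longrightarrow>
          bij_betw U {0<..} {0<..<\<Lambda>} \<and>
          (\<forall>x>0. U field_differentiable (at x)) \<and>
          continuous_on {0<..} (deriv U) \<and>
          (\<forall>x>0. deriv U x < 0) \<and>
          (INF x\<in>{0<..1}. \<bar>deriv U x\<bar>) > 0 \<and>
          bdd_above ((\<lambda>x. min 1 x * \<bar>deriv U x\<bar>) ` {0<..})"
    and ab: "0 < a" "a < b" "b < 1"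
  shows "bigO_P P 2
     (\<lambda>n \<omega>. SUP (u, v)\<in>{a..b} \<times> {a..b}.
        ennreal (cmod (complex_of_real (jump_copula \<nu> u v)
                       - copula_estimator \<alpha> \<nu> K (\<lambda>t. X (real t) \<omega>) n u v)))
     (\<lambda>n. (ln (real n)) ^ 10 / sqrt (real n))"
proof -
  obtain L where L: "L-lipschitz_on UNIV (fourier (\<lambda>x. complex_of_real (K x)))"
    using K_lipschitz by blast
  obtain c where c: "\<And>u. cmod (fourier_measure (density \<nu> (\<lambda>x. ennreal (fst x ^ 4 + snd x ^ 4))) u)
      \<le> c * inverse (1 + \<bar>fst u\<bar>) * inverse (1 + \<bar>snd u\<bar>)"
    using iii by blast
  obtain \<gamma> where \<gamma>: "\<gamma> > 0" "integrable \<nu> (\<lambda>x. norm x powr (8 + \<gamma>))"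
    using ii by blast
  have sets_nu: "sets \<nu> = sets borel" and "finite_measure \<nu>"
    using X by (auto simp: compound_poisson_with_drift_def)
  then interpret nu: finite_measure \<nu> by simp
  have cont: "continuous_on {0<..} U" if "\<forall>x>0. U field_differentiable (at x)" for U :: "real \<Rightarrow> real"
    using that by (intro continuous_at_imp_continuous_on) (auto intro: field_differentiable_imp_continuous_at)
  \<comment> \<open>|x|^8 <= 1 + |x|^(8 + \<gamma>), and constants are integrable because \<nu> is
    finite.\<close>
  have moment8: "integrable \<nu> (\<lambda>x. (1 + norm x) ^ 8)"
  proof (rule Bochner_Integration.integrable_bound)
    show "integrable \<nu> (\<lambda>x. 2 ^ 8 * (2 + norm x powr (8 + \<gamma>)))"
      using \<gamma>(2) by simp
    show "(\<lambda>x. (1 + norm x) ^ 8) \<in> borel_measurable \<nu>"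
      unfolding measurable_cong_sets[OF sets_nu refl] by measurable
    show "AE x in \<nu>. norm ((1 + norm x) ^ 8) \<le> norm (2 ^ 8 * (2 + norm x powr (8 + \<gamma>)))"
    proof (rule AE_I2)
      fix x :: plane
      have "norm x ^ 8 \<le> 1 + norm x powr (8 + \<gamma>)"
      proof (cases "norm x \<le> 1")
        case True
        then have "norm x ^ 8 \<le> 1" by (intro power_le_one) auto
        then show ?thesis by (rule order_trans) simp
      next
        case False
        then have "norm x ^ 8 = norm x powr 8" by simp
        also have "\<dots> \<le> norm x powr (8 + \<gamma>)" using False \<gamma>(1) by (intro powr_mono) auto
        finally show ?thesis by simp
      qed
      then have "2 ^ 8 * (1 + norm x ^ 8) \<le> 2 ^ 8 * (2 + norm x powr (8 + \<gamma>))" by simp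
      then have "(1 + norm x) ^ 8 \<le> 2 ^ 8 * (2 + norm x powr (8 + \<gamma>))"
        by (rule order_trans[OF power_one_plus_le[OF norm_ge_zero]])
      then show "norm ((1 + norm x) ^ 8) \<le> norm (2 ^ 8 * (2 + norm x powr (8 + \<gamma>)))"
        by simp
    qed
  qed
  interpret copula_model \<nu> \<Lambda> P X \<alpha> K L c
  proof unfold_locales
    show "bij_betw (\<lambda>x. tail \<nu> x 0) {0<..} {0<..<\<Lambda>}" "bij_betw (tail \<nu> 0) {0<..} {0<..<\<Lambda>}"
      using iv by blast+
    show "continuous_on {0<..} (\<lambda>x. tail \<nu> x 0)" "continuous_on {0<..} (tail \<nu> 0)"
      using iv by (blast intro: cont)+
    show "cmod (fourier_measure (quartic_measure \<nu>) u) \<le> c * freq_weight u" for u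
      using c[of u] by (simp add: quartic_measure_def freq_weight_def divide_inverse)
  qed (fact sets_nu i_pos i_total i_quadrant X moment8 K_nonneg K_L1 K_int K_supp L)+
  show ?thesis
    using copula_estimator_rate[of a b] ab by (simp add: log_rate_def[abs_def])
qed

end
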